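(* Let $(\mathbf A_i)_{i\ge1}$ be an iid sequence of $d\times d$ random matrices with generic element $\mathbf A\in\mathrm{RV}(\alpha,\mu^{\mathbf A})$, and let $\mathbf\Pi_n=\mathbf A_1\cdots\mathbf A_n$. Assume that $$\frac{\mathbb P(\|\mathbf A\|>t)}{\mathbb P(\|\mathbf A_1\|\,\|\mathbf A_2\|>t)}\to0,\qquad t\to\infty.$$ Then for every $n\ge1$, $$\frac{\mathbb P(\|\mathbf\Pi_n\|>t)}{\mathbb P(\|\mathbf A_1\|\cdots\|\mathbf A_n\|>t)}\to\mathbb E\big[\|\Theta_{\mathbf A_1}\cdots\Theta_{\mathbf A_n}\|^\alpha\big],\qquad t\to\infty.$$ If $\mathbb P(\|\Theta_{\mathbf A_1}\cdots\Theta_{\mathbf A_n}\|>0)>0$, then $\mathbf\Pi_n$ is regularly varying and, as $t\to\infty$, $$\mathbb P\Big(\frac{\mathbf\Pi_n}{\|\mathbf\Pi_n\|}\in\cdot\,\Big|\,\|\mathbf\Pi_n\|>t\Big)\stackrel{w}{\to}\mathbb P(\Theta_{\mathbf\Pi_n}\in\cdot)=\mathbb E\Big[\frac{\|\Theta_{\mathbf A_1}\cdots\Theta_{\mathbf A_n}\|^\alpha}{\mathbb E[\|\Theta_{\mathbf A_1}\cdots\Theta_{\mathbf A_n}\|^\alpha]}\,\mathbf 1\Big(\frac{\Theta_{\mathbf A_1}\cdots\Theta_{\mathbf A_n}}{\|\Theta_{\mathbf A_1}\cdots\Theta_{\mathbf A_n}\|}\in\cdot\Big)\Big].$$ In particular,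 if $\|\cdot\|$ is the operator norm with respect to the Euclidean norm and $\Theta_{\mathbf A}$ is almost surely an orthogonal matrix, then $\Theta_{\mathbf\Pi_n}\stackrel{d}{=}\Theta_{\mathbf A_1}\cdots\Theta_{\mathbf A_n}$.
   Context: The space of $d\times d$ real matrices is identified with $\mathbb R^{d^2}$ and equipped with a fixed norm $\|\cdot\|$. For measures on a punctured Euclidean space $\mathbb R^m\setminus\{\mathbf 0\}$, $\stackrel{v}{\to}$ is vague convergence (convergence of integrals of non-negative continuous functions with compact support in $\mathbb R^m\setminus\{\mathbf 0\}$). $\stackrel{w}{\to}$ denotes weak convergence. A random element $\mathbf X$ of a finite-dimensional normed space is regularly varying with index $\alpha>0$ and limit measure $\mu^{\mathbf X}$, written $\mathbf X\in\mathrm{RV}(\alpha,\mu^{\mathbf X})$, if $\mu^{\mathbf X}$ is a non-null Radon measure on the space without the origin such that $\mathbb P(t^{-1}\mathbf X\in\cdot)/\mathbb P(\|\mathbf X\|>t)\stackrel{v}{\to}\mu^{\mathbf X}(\cdot)$ as $t\to\infty$, and $\mu^{\mathbf X}(tA)=t^{-\alpha}\mu^{\mathbf X}(A)$ for all $t>0$ and Borel $A$. Its spectral distribution is the law of a random element $\Theta_{\mathbf X}$ of the unit sphere with $\mathbb P(\mathbf X/\|\mathbf X\|\in\cdot\mid\|\mathbf X\|>x)\stackrel{w}{\to}\mathbb P(\Theta_{\mathbf X}\in\cdot)$ as $x\to\infty$. $\Theta_{\mathbf A_1},\Theta_{\mathbf A_2},\dots$ are iid copies of $\Theta_{\mathbf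 A}$. *)

theory Defs
  imports "HOL-Probability.Probability"
begin

text \<open>An arbitrary norm on a real vector space, not necessarily the type-class norm. On a
  \<^class>\<open>euclidean_space\<close> all such norms induce the type-class topology, so that notions such as
  borel, continuity and compactness are unaffected by the choice.\<close>

definition is_norm :: "('a::real_vector \<Rightarrow> real) \<Rightarrow> bool" where
  "is_norm N \<longleftrightarrow>
     (\<forall>x. N x = 0 \<longleftrightarrow> x = 0) \<and>
     (\<forall>x y. N (x + y) \<le> N x + N y) \<and>
     (\<forall>c x. N (c *\<^sub>R x) = \<bar>c\<bar> * N x)"

definition punctured_borel :: "'a::euclidean_space measure" where
  "punctured_borel = restrict_space borel (- {0})"

text \<open>The punctured space is locally compact with a countable base, so a Borel measure on it is
  Radon iff it is finite on compact sets.\<close>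

definition radon_punctured :: "'a::euclidean_space measure \<Rightarrow> bool" where
  "radon_punctured \<mu> \<longleftrightarrow>
     sets \<mu> = sets punctured_borel \<and>
     (\<forall>K. compact K \<longrightarrow> K \<subseteq> - {0} \<longrightarrow> emeasure \<mu> K < \<infinity>)"

definition vague_conv_punctured ::
  "('i \<Rightarrow> 'a::euclidean_space measure) \<Rightarrow> 'a measure \<Rightarrow> 'i filter \<Rightarrow> bool" where
  "vague_conv_punctured \<nu> \<mu> F \<longleftrightarrow>
     (\<forall>f :: 'a \<Rightarrow> real.
        continuous_on (- {0}) f \<longrightarrow> (\<forall>x. 0 \<le> f x) \<longrightarrow>
        (\<exists>K. compact K \<and> K \<subseteq> - {0} \<and> (\<forall>x. x \<notin> K \<longrightarrow> f x = 0)) \<longrightarrow>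
        ((\<lambda>i. \<integral>\<^sup>+ x. ennreal (f x) \<partial>\<nu> i) \<longlongrightarrow> (\<integral>\<^sup>+ x. ennreal (f x) \<partial>\<mu>)) F)"

text \<open>Weak convergence of Borel measures along an arbitrary filter; the library's
  \<^const>\<open>weak_conv_m\<close> covers sequences of measures on the real line only.\<close>

definition weak_conv_borel ::
  "('i \<Rightarrow> 'a::topological_space measure) \<Rightarrow> 'a measure \<Rightarrow> 'i filter \<Rightarrow> bool" where
  "weak_conv_borel \<nu> \<mu> F \<longleftrightarrow>
     (\<forall>f :: 'a \<Rightarrow> real. continuous_on UNIV f \<longrightarrow> bounded (range f) \<longrightarrow>
        ((\<lambda>i. \<integral>x. f x \<partial>\<nu> i) \<longlongrightarrow> (\<integral>x. f x \<partial>\<mu>)) F)"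

definition regularly_varying ::
  "('a::euclidean_space \<Rightarrow> real) \<Rightarrow> 'w measure \<Rightarrow> ('w \<Rightarrow> 'a) \<Rightarrow> real \<Rightarrow> 'a measure \<Rightarrow> bool" where
  "regularly_varying N M X \<alpha> \<mu> \<longleftrightarrow>
     X \<in> borel_measurable M \<and> \<alpha> > 0 \<and>
     radon_punctured \<mu> \<and> emeasure \<mu> (- {0}) \<noteq> 0 \<and>
     vague_conv_punctured
       (\<lambda>t. scale_measure (1 / ennreal (\<P>(\<omega> in M. N (X \<omega>) > t)))
              (restrict_space (distr M borel (\<lambda>\<omega>. (1 / t) *\<^sub>R X \<omega>)) (- {0})))
       \<mu> at_top \<and>
     (\<forall>t>0. \<forall>B\<in>sets punctured_borel.
        emeasure \<mu> ((\<lambda>x. t *\<^sub>R x) ` B) = ennreal (t powr (- \<alpha>)) * emeasure \<mu> B)"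

text \<open>The measure \<open>\<sigma>\<close> is the law of the spectral element of \<open>X\<close>. It is carried by the unit
  sphere of \<open>N\<close>; as the sphere is closed, weak convergence on the sphere and on the whole space
  agree. Conditioning on an event is \<^const>\<open>uniform_measure\<close>.\<close>

definition spectral_distribution ::
  "('a::euclidean_space \<Rightarrow> real) \<Rightarrow> 'w measure \<Rightarrow> ('w \<Rightarrow> 'a) \<Rightarrow> 'a measure \<Rightarrow> bool" where
  "spectral_distribution N M X \<sigma> \<longleftrightarrow>
     prob_space \<sigma> \<and> sets \<sigma> = sets borel \<and> (AE x in \<sigma>. N x = 1) \<and>
     weak_conv_borel
       (\<lambda>t. distr (uniform_measure M {\<omega> \<in> space M. N (X \<omega>) > t}) borel
              (\<lambda>\<omega>. (1 / N (X \<omega>)) *\<^sub>R X \<omega>))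
       \<sigma> at_top"

definition iid_with_law ::
  "'w measure \<Rightarrow> 'i set \<Rightarrow> ('i \<Rightarrow> 'w \<Rightarrow> 'a::topological_space) \<Rightarrow> 'a measure \<Rightarrow> bool" where
  "iid_with_law M I X \<nu> \<longleftrightarrow>
     prob_space.indep_vars M (\<lambda>_. borel) X I \<and> (\<forall>i\<in>I. distr M borel (X i) = \<nu>)"

text \<open>The ordered product of the factors with indices \<open>1, \<dots>, n\<close>.\<close>

fun mat_prod :: "(nat \<Rightarrow> 'w \<Rightarrow> real^'d^'d) \<Rightarrow> nat \<Rightarrow> 'w \<Rightarrow> real^'d^'d" where
  "mat_prod X 0 \<omega> = mat 1"
| "mat_prod X (Suc n) \<omega> = mat_prod X n \<omega> ** X (Suc n) \<omega>"

end

theory Submission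
  imports Defs
begin

text \<open>Every matrix is written in polar coordinates, \<open>A\<^sub>i = R\<^sub>i U\<^sub>i\<close> with \<open>R\<^sub>i = N A\<^sub>i\<close>, so that the product is
  \<open>V\<^sub>n W\<^sub>n\<close> with the scalar \<open>V\<^sub>n = R\<^sub>1 \<cdots> R\<^sub>n\<close> and the matrix \<open>W\<^sub>n = U\<^sub>1 \<cdots> U\<^sub>n\<close>, which stays in a compact
  set. The theorem follows from two statements: the tail of \<open>V\<^sub>n\<close> is regularly varying with index
  \<open>-\<alpha>\<close>, and given \<open>V\<^sub>n > t\<close> the direction \<open>W\<^sub>n\<close> converges in law to \<open>\<Theta>\<^sub>1 \<cdots> \<Theta>\<^sub>n\<close>.

  Both come from one mechanism. The hypothesis says that one factor alone is negligible against a
  product of two; by induction, \<open>P(V\<^sub>n\<^sub>-\<^sub>1 > s t)\<close> and \<open>P(R\<^sub>n > s t)\<close> are negligible against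
  \<open>P(V\<^sub>n\<^sub>-\<^sub>1 R\<^sub>n > t)\<close> for every \<open>s > 0\<close>. Hence on the event \<open>V\<^sub>n\<^sub>-\<^sub>1 R\<^sub>n > t\<close> both factors are large,
  up to a negligible error: conditionally on \<open>R\<^sub>n\<close>, the variable \<open>V\<^sub>n\<^sub>-\<^sub>1\<close> exceeds \<open>t / R\<^sub>n\<close>, which
  tends to infinity, so any asymptotic relation for \<open>V\<^sub>n\<^sub>-\<^sub>1\<close> may be inserted under the expectation
  (\<open>mixing_negligible\<close>). Inserting the regular variation of \<open>V\<^sub>n\<^sub>-\<^sub>1\<close> gives that of \<open>V\<^sub>n\<close>. Inserting the
  conditional limit law of \<open>W\<^sub>n\<^sub>-\<^sub>1\<close>, and then with the roles exchanged that of \<open>U\<^sub>n\<close>, shows that the two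
  directions become independent in the limit (\<open>directions_asymptotically_independent\<close>).

  The last step passes from the pair \<open>(V, W)\<close> to the vector \<open>V W\<close>. If \<open>V\<close> has a regularly varying tail and the direction
  \<open>W\<close> has the conditional limit law \<open>\<tau>\<close>, then \<open>V W / t\<close>, normalized by \<open>P(V > t)\<close>, converges to the
  measure with density \<open>\<alpha> r powr (-\<alpha>-1)\<close> along the rays and \<open>\<tau>\<close> across them
  (\<open>polar_limit_integral\<close>). Here \<open>\<tau>\<close> need not live on the unit sphere, and the norm of its points
  is what produces the weight \<open>N x powr \<alpha>\<close> in the constant and in the spectral law: the ray through
  \<open>x\<close> carries mass \<open>N x powr \<alpha>\<close> outside the unit ball (\<open>normalized_limit\<close>). If \<open>\<tau>\<close> charges only unit
  vectors, as for orthogonal matrices and the operator norm, the weight disappears.\<close>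

section \<open>Norms, limits and integrals\<close>

text \<open>Permits an approximation that depends on the tolerance, such as a step function or a smoothed
  indicator.\<close>

lemma tendsto_by_approximation:
  fixes X :: "'i \<Rightarrow> real"
  assumes "\<And>e. e > 0 \<Longrightarrow> \<exists>Y y. (Y \<longlongrightarrow> y) F \<and> (\<forall>\<^sub>F i in F. \<bar>X i - Y i\<bar> \<le> e) \<and> \<bar>x - y\<bar> \<le> e"
  shows "(X \<longlongrightarrow> x) F"
proof (rule tendstoI)
  fix e :: real assume "e > 0"
  then have "e / 4 > 0" by simp
  then obtain Y y where Y: "(Y \<longlongrightarrow> y) F" "\<forall>\<^sub>F i in F. \<bar>X i - Y i\<bar> \<le> e / 4" "\<bar>x - y\<bar> \<le> e / 4"
    using assms by blast
  have "\<forall>\<^sub>F i in F. dist (Y i) y < e / 4"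
    using Y(1) \<open>e / 4 > 0\<close> by (rule tendstoD)
  with Y(2) show "\<forall>\<^sub>F i in F. dist (X i) x < e"
    by eventually_elim (use Y(3) \<open>e > 0\<close> in \<open>unfold dist_real_def, linarith\<close>)
qed

context
  fixes N :: "'a::euclidean_space \<Rightarrow> real"
  assumes N: "is_norm N"
begin

lemma is_norm_zero: "N 0 = 0"
  using N by (auto simp: is_norm_def)

lemma is_norm_scaleR: "N (c *\<^sub>R x) = \<bar>c\<bar> * N x"
  using N by (auto simp: is_norm_def)

lemma is_norm_triangle: "N (x + y) \<le> N x + N y"
  using N by (auto simp: is_norm_def)

lemma is_norm_minus: "N (- x) = N x"
  using is_norm_scaleR[of "-1" x] by simp

lemma is_norm_nonneg: "0 \<le> N x"
  using is_norm_triangle[of x "- x"] is_norm_minus[of x] is_norm_zero by simp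

lemma is_norm_eq_0_iff: "N x = 0 \<longleftrightarrow> x = 0"
  using N by (auto simp: is_norm_def)

lemma is_norm_pos_iff: "0 < N x \<longleftrightarrow> x \<noteq> 0"
  using is_norm_nonneg[of x] is_norm_eq_0_iff[of x] by linarith

lemma is_norm_le_norm: "\<exists>C>0. \<forall>x. N x \<le> C * norm x"
proof -
  have *: "N (\<Sum>b\<in>B. f b) \<le> (\<Sum>b\<in>B. N (f b))" if "finite B" for f and B :: "'a set"
    using that by (induction B) (auto simp: is_norm_zero intro: order_trans[OF is_norm_triangle])
  have "N x \<le> (1 + (\<Sum>b\<in>Basis. N b)) * norm x" for x
  proof -
    have "N x = N (\<Sum>b\<in>Basis. (x \<bullet> b) *\<^sub>R b)" by (simp add: euclidean_representation)
    also have "\<dots> \<le> (\<Sum>b\<in>Basis. N ((x \<bullet> b) *\<^sub>R b))" by (rule *) simp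
    also have "\<dots> \<le> (\<Sum>b\<in>Basis. norm x * N b)"
      by (intro sum_mono) (auto simp: is_norm_scaleR Basis_le_norm is_norm_nonneg intro!: mult_right_mono)
    also have "\<dots> \<le> (1 + (\<Sum>b\<in>Basis. N b)) * norm x"
      by (simp add: sum_distrib_left algebra_simps)
    finally show ?thesis .
  qed
  moreover have "1 + (\<Sum>b\<in>Basis. N b) > 0"
    by (intro add_pos_nonneg sum_nonneg) (auto simp: is_norm_nonneg)
  ultimately show ?thesis by blast
qed

lemma is_norm_diff: "\<bar>N x - N y\<bar> \<le> N (x - y)"
  using is_norm_triangle[of "x - y" y] is_norm_triangle[of "y - x" x] is_norm_minus[of "x - y"]
  by simp

lemma is_norm_continuous: "continuous_on S N"
proof -
  obtain C where C: "C > 0" "\<And>x. N x \<le> C * norm x" using is_norm_le_norm by blast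
  have "C-lipschitz_on S N"
    using C by (intro lipschitz_onI)
      (auto simp: dist_real_def dist_norm intro: order_trans[OF is_norm_diff])
  then show ?thesis by (rule lipschitz_on_continuous_on)
qed

lemma is_norm_borel: "N \<in> borel_measurable borel"
  by (intro borel_measurable_continuous_onI is_norm_continuous)

lemma is_norm_ge_norm: "\<exists>c>0. \<forall>x. c * norm x \<le> N x"
proof -
  have "\<exists>x\<in>sphere 0 1. \<forall>y\<in>sphere (0::'a) 1. N x \<le> N y"
    by (intro continuous_attains_inf is_norm_continuous) auto
  then obtain z where z: "norm z = 1" "\<And>y. norm y = 1 \<Longrightarrow> N z \<le> N y" by auto
  have "N z * norm x \<le> N x" for x
  proof (cases "x = 0")
    case False
    then have "N z \<le> N ((1 / norm x) *\<^sub>R x)" by (intro z) simp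
    also have "\<dots> = N x / norm x" by (simp add: is_norm_scaleR)
    finally show ?thesis using False by (simp add: field_simps)
  qed (simp add: is_norm_zero)
  moreover have "N z > 0" using z(1) by (subst is_norm_pos_iff) auto
  ultimately show ?thesis by blast
qed

lemma is_norm_normalize: "x \<noteq> 0 \<Longrightarrow> N ((1 / N x) *\<^sub>R x) = 1"
  using is_norm_pos_iff[of x] by (simp add: is_norm_scaleR)

lemma is_norm_normalize_le: "N ((1 / N x) *\<^sub>R x) \<le> 1"
  by (cases "x = 0") (simp_all add: is_norm_normalize is_norm_zero)

lemma is_norm_polar: "N x *\<^sub>R ((1 / N x) *\<^sub>R x) = x"
  by (cases "x = 0") (simp_all add: is_norm_eq_0_iff)

lemma is_norm_compact_ball: "compact {x. N x \<le> r}"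
proof -
  obtain c where c: "c > 0" "\<And>x. c * norm x \<le> N x" using is_norm_ge_norm by blast
  have "closed {x. N x \<le> r}"
    by (intro closed_Collect_le is_norm_continuous continuous_on_const)
  moreover have "norm x \<le> r / c" if "N x \<le> r" for x
    using c(1) order_trans[OF c(2) that] by (simp add: field_simps)
  then have "bounded {x. N x \<le> r}" by (intro boundedI[where B = "r / c"]) auto
  ultimately show ?thesis by (simp add: compact_eq_bounded_closed)
qed

end

lemma continuous_on_section:
  assumes "continuous_on UNIV (\<lambda>z. g (fst z) (snd z))"
  shows "continuous_on UNIV (\<lambda>x. g x u)"
  using continuous_on_compose2[OF assms continuous_on_Pair[OF continuous_on_id continuous_on_const]]
  by simp

lemma borel_measurable_uncurried:
  fixes g :: "'b::second_countable_topology \<Rightarrow> 'c::second_countable_topology \<Rightarrow> 'd::topological_space"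
  assumes "(\<lambda>z. g (fst z) (snd z)) \<in> borel_measurable borel"
    and [measurable]: "f \<in> borel_measurable M" "h \<in> borel_measurable M"
  shows "(\<lambda>x. g (f x) (h x)) \<in> borel_measurable M"
proof -
  have "(\<lambda>x. (f x, h x)) \<in> measurable M borel" by measurable
  from measurable_compose[OF this assms(1)] show ?thesis by simp
qed

lemma compact_bounded_above:
  assumes "compact K" "continuous_on K (p :: _ \<Rightarrow> real)"
  shows "\<exists>D. \<forall>x\<in>K. p x \<le> D"
proof -
  obtain D where "\<And>y. y \<in> p ` K \<Longrightarrow> norm y \<le> D"
    using compact_imp_bounded[OF compact_continuous_image[OF assms(2,1)]] by (auto simp: bounded_iff)
  then have "p x \<le> D" if "x \<in> K" for x using that by force
  then show ?thesis by blast
qed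

lemma inverse_ennreal_times:
  assumes "0 < p" "0 \<le> x" shows "1 / ennreal p * ennreal x = ennreal (x / p)"
proof -
  have "1 / ennreal p = ennreal (1 / p)" using divide_ennreal[of 1 p] assms by simp
  then show ?thesis using assms by (simp add: ennreal_mult[symmetric])
qed

lemma continuous_on_parametric_integral:
  fixes g :: "'b::euclidean_space \<Rightarrow> 'c::euclidean_space \<Rightarrow> real"
  assumes "prob_space \<tau>" and s [measurable_cong]: "sets \<tau> = sets borel"
    and g: "continuous_on UNIV (\<lambda>z. g (fst z) (snd z))" and bnd: "\<And>w u. \<bar>g w u\<bar> \<le> B"
  shows "continuous_on UNIV (\<lambda>u. \<integral>x. g x u \<partial>\<tau>)"
proof -
  interpret prob_space \<tau> by fact
  have gc: "continuous_on UNIV (\<lambda>x. g x u)" for u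
    using g by (rule continuous_on_section)
  have [measurable]: "(\<lambda>x. g x u) \<in> borel_measurable borel" for u
    using gc by (rule borel_measurable_continuous_onI)
  have "continuous (at u) (\<lambda>u. \<integral>x. g x u \<partial>\<tau>)" for u
    unfolding continuous_at_sequentially comp_def
  proof (intro allI impI)
    fix y :: "nat \<Rightarrow> 'c" assume y: "y \<longlonglongrightarrow> u"
    show "(\<lambda>n. \<integral>x. g x (y n) \<partial>\<tau>) \<longlonglongrightarrow> (\<integral>x. g x u \<partial>\<tau>)"
    proof (rule integral_dominated_convergence[where w = "\<lambda>_. B"])
      have "(\<lambda>n. g x (y n)) \<longlonglongrightarrow> g x u" for x
        using continuous_on_tendsto_compose[OF g tendsto_Pair[OF tendsto_const y]] by simp
      then show "AE x in \<tau>. (\<lambda>n. g x (y n)) \<longlonglongrightarrow> g x u" by simp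
    qed (auto simp: bnd)
  qed
  then show ?thesis by (simp add: continuous_at_imp_continuous_on)
qed

lemma (in prob_space) expectation_abs_le:
  fixes X Y :: "'a \<Rightarrow> real"
  assumes "X \<in> borel_measurable M" "Y \<in> borel_measurable M"
    "\<And>\<omega>. \<bar>X \<omega>\<bar> \<le> Y \<omega>" "\<And>\<omega>. Y \<omega> \<le> C"
  shows "\<bar>expectation X\<bar> \<le> expectation Y"
proof -
  have "0 \<le> Y \<omega>" for \<omega> using assms(3)[of \<omega>] abs_ge_zero[of "X \<omega>"] by linarith
  with assms(4) have i: "integrable M Y"
    by (intro integrable_const_bound[where B = C]) (auto simp: assms)
  have "integrable M X"
    by (rule Bochner_Integration.integrable_bound[OF i])
      (use assms(1,3) \<open>\<And>\<omega>. 0 \<le> Y \<omega>\<close> in auto)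
  then have "\<bar>expectation X\<bar> \<le> expectation (\<lambda>\<omega>. \<bar>X \<omega>\<bar>)" by simp
  also have "\<dots> \<le> expectation Y"
    by (intro integral_mono i integrable_abs \<open>integrable M X\<close> assms)
  finally show ?thesis .
qed

lemma abs_integral_le_bound:
  assumes "prob_space \<tau>" "f \<in> borel_measurable \<tau>" "\<And>x. \<bar>f x\<bar> \<le> (B::real)"
  shows "\<bar>\<integral>x. f x \<partial>\<tau>\<bar> \<le> B"
proof -
  interpret prob_space \<tau> by fact
  have "\<bar>\<integral>x. f x \<partial>\<tau>\<bar> \<le> (\<integral>x. B \<partial>\<tau>)"
    using assms(2,3) by (intro expectation_abs_le) auto
  then show ?thesis by (simp add: prob_space)
qed

section \<open>Tails of products of independent variables\<close>

text \<open>Independence in the form of Fubini's theorem on the underlying space: condition on \<open>Y\<close> by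
  integrating an independent copy of \<open>X\<close> first.\<close>

lemma (in prob_space) indep_var_integral_iterated:
  fixes F :: "'b \<times> 'b \<Rightarrow> real"
  assumes ind: "indep_var S X T Y" and F [measurable]: "F \<in> borel_measurable (S \<Otimes>\<^sub>M T)"
    and bnd: "\<And>z. \<bar>F z\<bar> \<le> B"
  shows "expectation (\<lambda>\<omega>. F (X \<omega>, Y \<omega>)) = expectation (\<lambda>\<omega>. expectation (\<lambda>\<omega>'. F (X \<omega>', Y \<omega>)))"
proof -
  have [measurable]: "X \<in> measurable M S" "Y \<in> measurable M T"
    using ind by (auto dest: indep_var_rv1 indep_var_rv2)
  interpret X: prob_space "distr M S X" by (rule prob_space_distr) simp
  interpret Y: prob_space "distr M T Y" by (rule prob_space_distr) simp
  interpret XY: pair_prob_space "distr M S X" "distr M T Y" ..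
  have "expectation (\<lambda>\<omega>. F (X \<omega>, Y \<omega>)) = (\<integral>z. F z \<partial>distr M (S \<Otimes>\<^sub>M T) (\<lambda>\<omega>. (X \<omega>, Y \<omega>)))"
    by (subst integral_distr) auto
  also have "distr M (S \<Otimes>\<^sub>M T) (\<lambda>\<omega>. (X \<omega>, Y \<omega>)) = distr M S X \<Otimes>\<^sub>M distr M T Y"
    using ind by (simp add: indep_var_distribution_eq)
  also have "(\<integral>z. F z \<partial>(distr M S X \<Otimes>\<^sub>M distr M T Y)) = (\<integral>y. (\<integral>x. F (x, y) \<partial>distr M S X) \<partial>distr M T Y)"
  proof (subst XY.integral_snd)
    show "integrable (distr M S X \<Otimes>\<^sub>M distr M T Y) (\<lambda>(x, y). F (x, y))"
      by (intro XY.P.integrable_const_bound[where B = B]) (auto simp: bnd split_beta')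
  qed simp
  also have "\<dots> = expectation (\<lambda>\<omega>. (\<integral>x. F (x, Y \<omega>) \<partial>distr M S X))"
    by (subst integral_distr) (auto intro!: X.borel_measurable_lebesgue_integral)
  also have "\<dots> = expectation (\<lambda>\<omega>. expectation (\<lambda>\<omega>'. F (X \<omega>', Y \<omega>)))"
  proof (intro Bochner_Integration.integral_cong refl)
    fix \<omega> assume "\<omega> \<in> space M"
    then have "Y \<omega> \<in> space T" by (rule measurable_space[rotated]) simp
    then have "(\<lambda>x. F (x, Y \<omega>)) \<in> borel_measurable S" by measurable
    then show "(\<integral>x. F (x, Y \<omega>) \<partial>distr M S X) = expectation (\<lambda>\<omega>'. F (X \<omega>', Y \<omega>))"
      by (subst integral_distr) auto
  qed
  finally show ?thesis .
qed

lemma (in prob_space) indep_var_swap: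
  assumes "indep_var S X T Y" shows "indep_var T Y S X"
proof -
  have "indep_set B A" if "indep_set A B" for A B
    using that unfolding indep_sets2_eq
    by (metis (no_types, opaque_lifting) inf_commute mult.commute)
  with assms show ?thesis unfolding indep_var_eq by blast
qed

definition (in prob_space) tail :: "('a \<Rightarrow> real) \<Rightarrow> real \<Rightarrow> real" where
  "tail X t = prob {\<omega> \<in> space M. X \<omega> > t}"

context prob_space
begin

lemma tail_nonneg [simp]: "0 \<le> tail X t"
  by (simp add: tail_def)

lemma tail_le_1 [simp]: "tail X t \<le> 1"
  by (simp add: tail_def)

lemma tail_eq_expectation:
  assumes [measurable]: "X \<in> borel_measurable M"
  shows "tail X t = expectation (\<lambda>\<omega>. indicator {t<..} (X \<omega>))"
proof -
  have "expectation (\<lambda>\<omega>. indicator {t<..} (X \<omega>)) = expectation (indicator {\<omega> \<in> space M. X \<omega> > t})"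
    by (intro Bochner_Integration.integral_cong) (auto simp: indicator_def)
  also have "\<dots> = prob ({\<omega> \<in> space M. X \<omega> > t} \<inter> space M)" by (rule Bochner_Integration.integral_indicator)
  finally show ?thesis by (simp add: tail_def Int_absorb2 subset_eq)
qed

lemma tail_antimono:
  assumes [measurable]: "X \<in> borel_measurable M" and "s \<le> t"
  shows "tail X t \<le> tail X s"
  unfolding tail_def using assms(2) by (intro finite_measure_mono) auto

lemma tail_borel [measurable]:
  assumes [measurable]: "X \<in> borel_measurable M"
  shows "tail X \<in> borel_measurable borel"
proof -
  have "mono (\<lambda>t. - tail X t)" by (auto intro!: monoI tail_antimono)
  then have "(\<lambda>t. - tail X t) \<in> borel_measurable borel" by (rule borel_measurable_mono)
  then have "(\<lambda>t. - (- tail X t)) \<in> borel_measurable borel" by measurable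
  then show ?thesis by simp
qed

lemma tail_cong_distr:
  assumes [measurable]: "X \<in> borel_measurable M" "Y \<in> borel_measurable M"
    and "distr M borel X = distr M borel Y"
  shows "tail X = tail Y"
proof
  fix t
  have "measure (distr M borel X) {t<..} = measure (distr M borel Y) {t<..}" using assms by simp
  then show "tail X t = tail Y t"
    by (simp add: measure_distr tail_def vimage_def Int_def conj_commute)
qed

text \<open>For fixed \<open>R \<omega> > 0\<close> the event \<open>V * R > t\<close> is the tail event \<open>V > t / R \<omega>\<close>, and for \<open>R \<omega> = 0\<close> it
  is empty.\<close>

lemma expectation_on_product_tail:
  fixes W U :: "'a \<Rightarrow> 'b::euclidean_space" and V R :: "'a \<Rightarrow> real" and g :: "'b \<Rightarrow> 'b \<Rightarrow> real"
  assumes ind: "indep_var borel (\<lambda>\<omega>. (W \<omega>, V \<omega>)) borel (\<lambda>\<omega>. (U \<omega>, R \<omega>))"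
    and R0: "\<And>\<omega>. 0 \<le> R \<omega>" and "t \<ge> 0"
    and g [measurable]: "(\<lambda>z. g (fst z) (snd z)) \<in> borel_measurable borel"
    and bnd: "\<And>w u. \<bar>g w u\<bar> \<le> B"
  shows "expectation (\<lambda>\<omega>. g (W \<omega>) (U \<omega>) * indicator {t<..} (V \<omega> * R \<omega>)) =
    expectation (\<lambda>\<omega>. if R \<omega> > 0
      then expectation (\<lambda>\<omega>'. g (W \<omega>') (U \<omega>) * indicator {t / R \<omega><..} (V \<omega>')) else 0)"
proof -
  define F :: "('b \<times> real) \<times> 'b \<times> real \<Rightarrow> real" where
    "F = (\<lambda>z. g (fst (fst z)) (fst (snd z)) * indicator {t<..} (snd (fst z) * snd (snd z)))"
  have gF: "(\<lambda>z :: ('b \<times> real) \<times> 'b \<times> real. g (fst (fst z)) (fst (snd z)))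
    \<in> borel_measurable ((borel \<Otimes>\<^sub>M borel) \<Otimes>\<^sub>M (borel \<Otimes>\<^sub>M borel))"
    by (rule borel_measurable_uncurried[OF g]) measurable
  have F: "F \<in> borel_measurable (borel \<Otimes>\<^sub>M borel)"
    unfolding F_def borel_prod[symmetric] using gF by measurable
  have B: "0 \<le> B" using bnd[of undefined undefined] by linarith
  have "\<bar>F z\<bar> \<le> B" for z
    using bnd B by (auto simp: F_def indicator_def)
  from indep_var_integral_iterated[OF ind F this]
  have "expectation (\<lambda>\<omega>. g (W \<omega>) (U \<omega>) * indicator {t<..} (V \<omega> * R \<omega>)) =
    expectation (\<lambda>\<omega>. expectation (\<lambda>\<omega>'. g (W \<omega>') (U \<omega>) * indicator {t<..} (V \<omega>' * R \<omega>)))"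
    by (simp add: F_def)
  also have "\<dots> = expectation (\<lambda>\<omega>. if R \<omega> > 0
      then expectation (\<lambda>\<omega>'. g (W \<omega>') (U \<omega>) * indicator {t / R \<omega><..} (V \<omega>')) else 0)"
  proof (intro Bochner_Integration.integral_cong refl)
    fix \<omega>
    show "expectation (\<lambda>\<omega>'. g (W \<omega>') (U \<omega>) * indicator {t<..} (V \<omega>' * R \<omega>)) =
      (if R \<omega> > 0 then expectation (\<lambda>\<omega>'. g (W \<omega>') (U \<omega>) * indicator {t / R \<omega><..} (V \<omega>')) else 0)"
    proof (cases "R \<omega> > 0")
      case True
      then show ?thesis by (auto simp: field_simps indicator_def intro!: Bochner_Integration.integral_cong)
    next
      case False
      then have "R \<omega> = 0" using R0[of \<omega>] by linarith
      then show ?thesis using \<open>t \<ge> 0\<close> by simp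
    qed
  qed
  finally show ?thesis .
qed

lemma indep_pairs_borel:
  fixes W U :: "'a \<Rightarrow> 'b::euclidean_space" and V R :: "'a \<Rightarrow> real"
  assumes ind: "indep_var borel (\<lambda>\<omega>. (W \<omega>, V \<omega>)) borel (\<lambda>\<omega>. (U \<omega>, R \<omega>))"
  shows "W \<in> borel_measurable M" "V \<in> borel_measurable M"
    "U \<in> borel_measurable M" "R \<in> borel_measurable M"
proof -
  have 1: "(\<lambda>\<omega>. (W \<omega>, V \<omega>)) \<in> measurable M (borel \<Otimes>\<^sub>M borel)"
    "(\<lambda>\<omega>. (U \<omega>, R \<omega>)) \<in> measurable M (borel \<Otimes>\<^sub>M borel)"
    using ind by (auto dest: indep_var_rv1 indep_var_rv2 simp: borel_prod)
  from measurable_compose[OF 1(1) measurable_fst] measurable_compose[OF 1(1) measurable_snd]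
    measurable_compose[OF 1(2) measurable_fst] measurable_compose[OF 1(2) measurable_snd]
  show "W \<in> borel_measurable M" "V \<in> borel_measurable M"
    "U \<in> borel_measurable M" "R \<in> borel_measurable M" by auto
qed

lemma tail_product:
  fixes W U :: "'a \<Rightarrow> 'b::euclidean_space" and V R :: "'a \<Rightarrow> real"
  assumes ind: "indep_var borel (\<lambda>\<omega>. (W \<omega>, V \<omega>)) borel (\<lambda>\<omega>. (U \<omega>, R \<omega>))"
    and R0: "\<And>\<omega>. 0 \<le> R \<omega>" and "t \<ge> 0"
  shows "tail (\<lambda>\<omega>. V \<omega> * R \<omega>) t = expectation (\<lambda>\<omega>. if R \<omega> > 0 then tail V (t / R \<omega>) else 0)"
proof -
  note [measurable] = indep_pairs_borel[OF ind]
  show ?thesis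
    using expectation_on_product_tail[OF ind R0 \<open>t \<ge> 0\<close>, of "\<lambda>_ _. 1" 1]
    by (simp add: tail_eq_expectation[of V] tail_eq_expectation[of "\<lambda>\<omega>. V \<omega> * R \<omega>"] cong: if_cong)
qed

text \<open>Suppose that \<open>\<phi> u s\<close> is of smaller order than the tail of \<open>V\<close> as \<open>s \<rightarrow> \<infinity>\<close>. Where \<open>R\<close> is at most
  \<open>t / s0\<close>, the argument \<open>t / R\<close> is at least \<open>s0\<close>, so \<open>\<phi>\<close> is a small multiple of the conditional
  probability of \<open>V * R > t\<close>; where \<open>R\<close> is larger, the bound \<open>B\<close> is enough, because that event is
  negligible by assumption. Every passage from \<open>V\<close> to the product \<open>V * R\<close> below is an instance
  with a suitable \<open>\<phi>\<close>.\<close>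

lemma mixing_negligible:
  fixes W U :: "'a \<Rightarrow> 'b::euclidean_space" and V R :: "'a \<Rightarrow> real" and \<phi> :: "'b \<Rightarrow> real \<Rightarrow> real"
  assumes ind: "indep_var borel (\<lambda>\<omega>. (W \<omega>, V \<omega>)) borel (\<lambda>\<omega>. (U \<omega>, R \<omega>))"
    and R0: "\<And>\<omega>. 0 \<le> R \<omega>"
    and \<phi>: "(\<lambda>z. \<phi> (fst z) (snd z)) \<in> borel_measurable borel"
    and bnd: "\<And>u s. \<bar>\<phi> u s\<bar> \<le> B"
    and L: "\<And>\<omega>. U \<omega> \<in> L"
    and small: "\<And>e. e > 0 \<Longrightarrow> \<forall>\<^sub>F s in at_top. \<forall>u\<in>L. \<bar>\<phi> u s\<bar> \<le> e * tail V s"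
    and negl: "\<And>s. s > 0 \<Longrightarrow> ((\<lambda>t. tail R (s * t) / tail (\<lambda>\<omega>. V \<omega> * R \<omega>) t) \<longlongrightarrow> 0) at_top"
  shows "((\<lambda>t. expectation (\<lambda>\<omega>. if R \<omega> > 0 then \<phi> (U \<omega>) (t / R \<omega>) else 0) /
      tail (\<lambda>\<omega>. V \<omega> * R \<omega>) t) \<longlongrightarrow> 0) at_top"
proof (rule tendstoI)
  fix e :: real assume "e > 0"
  note [measurable] = indep_pairs_borel[OF ind]
  have B: "0 \<le> B" using bnd[of undefined undefined] by linarith
  have [measurable]: "(\<lambda>\<omega>. \<phi> (U \<omega>) (t / R \<omega>)) \<in> borel_measurable M" for t
    by (rule borel_measurable_uncurried[OF \<phi>]) measurable
  obtain s1 where s1: "\<And>s u. s \<ge> s1 \<Longrightarrow> u \<in> L \<Longrightarrow> \<bar>\<phi> u s\<bar> \<le> e / 2 * tail V s"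
    using small[of "e / 2"] \<open>e > 0\<close> by (auto simp: eventually_at_top_linorder)
  define s0 where "s0 = max 1 s1"
  have s0: "s0 > 0" "\<And>s u. s \<ge> s0 \<Longrightarrow> u \<in> L \<Longrightarrow> \<bar>\<phi> u s\<bar> \<le> e / 2 * tail V s"
    using s1 by (auto simp: s0_def)
  let ?P = "tail (\<lambda>\<omega>. V \<omega> * R \<omega>)"
  have "\<forall>\<^sub>F t in at_top. tail R (1 / (s0) * t) / ?P t < e / (2 * (B + 1))"
    using order_tendstoD(2)[OF negl[of "1 / s0"], of "e / (2 * (B + 1))"] s0 \<open>e > 0\<close> B by simp
  moreover have "\<forall>\<^sub>F t::real in at_top. t > 0" by (rule eventually_gt_at_top)
  ultimately show "\<forall>\<^sub>F t in at_top. dist (expectation (\<lambda>\<omega>. if R \<omega> > 0 then \<phi> (U \<omega>) (t / R \<omega>) else 0) / ?P t) 0 < e"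
  proof eventually_elim
    fix t :: real assume t: "tail R (1 / s0 * t) / ?P t < e / (2 * (B + 1))" "t > 0"
    let ?I = "expectation (\<lambda>\<omega>. if R \<omega> > 0 then \<phi> (U \<omega>) (t / R \<omega>) else 0)"
    have "\<bar>?I\<bar> \<le> expectation (\<lambda>\<omega>. e / 2 * (if R \<omega> > 0 then tail V (t / R \<omega>) else 0)
        + B * indicator {t / s0<..} (R \<omega>))"
    proof (rule expectation_abs_le)
      fix \<omega>
      show "\<bar>if R \<omega> > 0 then \<phi> (U \<omega>) (t / R \<omega>) else 0\<bar> \<le>
        e / 2 * (if R \<omega> > 0 then tail V (t / R \<omega>) else 0) + B * indicator {t / s0<..} (R \<omega>)"
      proof (cases "R \<omega> > t / s0")
        case True
        then have "R \<omega> > 0" using t s0 by (smt (verit) divide_nonneg_pos)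
        then show ?thesis using True bnd[of "U \<omega>" "t / R \<omega>"] \<open>e > 0\<close>
          by (simp add: add_increasing)
      next
        case False
        then have "R \<omega> > 0 \<Longrightarrow> t / R \<omega> \<ge> s0" using s0 by (simp add: field_simps)
        then show ?thesis using False B s0(2)[OF _ L] by auto
      qed
      show "e / 2 * (if R \<omega> > 0 then tail V (t / R \<omega>) else 0) + B * indicator {t / s0<..} (R \<omega>)
        \<le> e / 2 + B"
        using \<open>e > 0\<close> B by (intro add_mono) (auto simp: indicator_def)
    qed (measurable)
    also have "\<dots> = e / 2 * ?P t + B * tail R (t / s0)"
    proof (subst Bochner_Integration.integral_add)
      show "integrable M (\<lambda>\<omega>. e / 2 * (if R \<omega> > 0 then tail V (t / R \<omega>) else 0))"
        by (intro integrable_mult_right integrable_const_bound[where B = 1]) auto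
      show "integrable M (\<lambda>\<omega>. B * indicator {t / s0<..} (R \<omega>))"
        by (intro integrable_mult_right integrable_const_bound[where B = 1]) auto
      have "?P t = expectation (\<lambda>\<omega>. if R \<omega> > 0 then tail V (t / R \<omega>) else 0)"
        using t(2) by (intro tail_product[OF ind R0]) auto
      then show "expectation (\<lambda>\<omega>. e / 2 * (if R \<omega> > 0 then tail V (t / R \<omega>) else 0)) +
          expectation (\<lambda>\<omega>. B * indicator {t / s0<..} (R \<omega>)) = e / 2 * ?P t + B * tail R (t / s0)"
        by (simp add: tail_eq_expectation[of R])
    qed
    finally have *: "\<bar>?I\<bar> \<le> e / 2 * ?P t + B * tail R (t / s0)" .
    show "dist (?I / ?P t) 0 < e"
    proof (cases "?P t = 0")
      case False
      then have P: "?P t > 0" using tail_nonneg[of "\<lambda>\<omega>. V \<omega> * R \<omega>" t] by linarith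
      have "\<bar>?I / ?P t\<bar> \<le> (e / 2 * ?P t + B * tail R (t / s0)) / ?P t"
        using * P by (simp add: divide_right_mono)
      also have "\<dots> = e / 2 + B * (tail R (1 / s0 * t) / ?P t)"
        using P by (simp add: field_simps)
      also have "\<dots> \<le> e / 2 + B * (e / (2 * (B + 1)))"
        using t(1) B by (intro add_left_mono mult_left_mono) auto
      also have "\<dots> < e" using \<open>e > 0\<close> B by (simp add: field_simps)
      finally show ?thesis by simp
    qed (use \<open>e > 0\<close> in simp)
  qed
qed

text \<open>On a compact parameter set the maps \<open>g(\<cdot>, u)\<close> are equicontinuous in \<open>u\<close>, uniformly over \<open>K\<close>, so the
  convergence for the finitely many \<open>u\<close> of a net gives convergence uniformly in \<open>u\<close>.\<close>

lemma uniform_direction_limit: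
  fixes W :: "'a \<Rightarrow> 'b::euclidean_space" and g :: "'b \<Rightarrow> 'b \<Rightarrow> real"
  assumes [measurable]: "W \<in> borel_measurable M" "V \<in> borel_measurable M"
    and K: "compact K" "\<And>\<omega>. W \<omega> \<in> K" and L: "compact L"
    and \<tau>: "prob_space \<tau>" "sets \<tau> = sets borel" "AE x in \<tau>. x \<in> K"
    and dir: "\<And>f. continuous_on UNIV f \<Longrightarrow> bounded (range f) \<Longrightarrow>
      ((\<lambda>t. expectation (\<lambda>\<omega>. f (W \<omega>) * indicator {t<..} (V \<omega>)) / tail V t) \<longlongrightarrow> (\<integral>x. f x \<partial>\<tau>)) at_top"
    and pos: "\<And>t. tail V t > 0"
    and g: "continuous_on UNIV (\<lambda>z. g (fst z) (snd z))" and bnd: "\<And>w u. \<bar>g w u\<bar> \<le> B"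
    and "e > 0"
  shows "\<forall>\<^sub>F t in at_top. \<forall>u\<in>L.
    \<bar>expectation (\<lambda>\<omega>. g (W \<omega>) u * indicator {t<..} (V \<omega>)) - (\<integral>x. g x u \<partial>\<tau>) * tail V t\<bar> \<le> e * tail V t"
proof -
  interpret \<tau>: prob_space \<tau> by fact
  note [measurable_cong] = \<tau>(2)
  have B: "0 \<le> B" using bnd[of undefined undefined] by linarith
  have gc: "continuous_on UNIV (\<lambda>x. g x u)" for u
    using g by (rule continuous_on_section)
  have [measurable]: "(\<lambda>x. g x u) \<in> borel_measurable borel" for u
    using gc by (rule borel_measurable_continuous_onI)
  have gr: "bounded (range (\<lambda>x. g x u))" for u
    using bnd by (auto intro!: boundedI)
  have int\<tau>: "integrable \<tau> (\<lambda>x. g x u)" for u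
    by (intro \<tau>.integrable_const_bound[where B = B]) (auto simp: bnd)
  have intM: "integrable M (\<lambda>\<omega>. g (W \<omega>) u * indicator {t<..} (V \<omega>))" for u t
    by (intro integrable_const_bound[where B = B]) (auto simp: indicator_def bnd B)
  have "uniformly_continuous_on (K \<times> L) (\<lambda>z. g (fst z) (snd z))"
    using K L by (intro compact_uniformly_continuous compact_Times continuous_on_subset[OF g]) auto
  then obtain d where d: "d > 0"
    "\<And>z z'. z \<in> K \<times> L \<Longrightarrow> z' \<in> K \<times> L \<Longrightarrow> dist z' z < d \<Longrightarrow> dist (g (fst z') (snd z')) (g (fst z) (snd z)) < e / 3"
    using \<open>e > 0\<close> unfolding uniformly_continuous_on_def by (metis divide_pos_pos zero_less_numeral)
  have d': "\<bar>g x u - g x c\<bar> \<le> e / 3" if "x \<in> K" "u \<in> L" "c \<in> L" "dist u c < d" for x u c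
    using d(2)[of "(x, c)" "(x, u)"] that by (simp add: dist_Pair_Pair dist_real_def)
  obtain k where k: "finite k" "k \<subseteq> L" "L \<subseteq> (\<Union>x\<in>k. ball x d)"
    using seq_compact_imp_totally_bounded L d(1) by (metis compact_eq_seq_compact_metric)
  have "\<forall>\<^sub>F t in at_top. \<bar>expectation (\<lambda>\<omega>. g (W \<omega>) c * indicator {t<..} (V \<omega>)) / tail V t
      - (\<integral>x. g x c \<partial>\<tau>)\<bar> < e / 3" for c
    using tendstoD[OF dir[OF gc gr], of "e / 3" c] \<open>e > 0\<close> by (simp add: dist_real_def)
  then have "\<forall>\<^sub>F t in at_top. \<forall>c\<in>k. \<bar>expectation (\<lambda>\<omega>. g (W \<omega>) c * indicator {t<..} (V \<omega>)) / tail V t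
      - (\<integral>x. g x c \<partial>\<tau>)\<bar> < e / 3"
    using k(1) by (intro eventually_ball_finite) auto
  then show ?thesis
  proof eventually_elim
    fix t assume t: "\<forall>c\<in>k. \<bar>expectation (\<lambda>\<omega>. g (W \<omega>) c * indicator {t<..} (V \<omega>)) / tail V t
      - (\<integral>x. g x c \<partial>\<tau>)\<bar> < e / 3"
    show "\<forall>u\<in>L. \<bar>expectation (\<lambda>\<omega>. g (W \<omega>) u * indicator {t<..} (V \<omega>)) - (\<integral>x. g x u \<partial>\<tau>) * tail V t\<bar> \<le> e * tail V t"
    proof
      fix u assume "u \<in> L"
      then obtain c where c: "c \<in> k" "dist u c < d" using k(3) by (auto simp: dist_commute)
      then have "c \<in> L" using k by auto
      let ?E = "\<lambda>u. expectation (\<lambda>\<omega>. g (W \<omega>) u * indicator {t<..} (V \<omega>))" and ?h = "\<lambda>u. \<integral>x. g x u \<partial>\<tau>"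
      have "\<bar>?E u - ?E c\<bar> = \<bar>expectation (\<lambda>\<omega>. (g (W \<omega>) u - g (W \<omega>) c) * indicator {t<..} (V \<omega>))\<bar>"
        by (subst Bochner_Integration.integral_diff[symmetric]) (auto simp: intM left_diff_distrib)
      also have "\<dots> \<le> expectation (\<lambda>\<omega>. e / 3 * indicator {t<..} (V \<omega>))"
        using d'[OF K(2) \<open>u \<in> L\<close> \<open>c \<in> L\<close> c(2)] \<open>e > 0\<close>
        by (intro expectation_abs_le[where C = "e / 3"]) (auto simp: indicator_def)
      also have "\<dots> = e / 3 * tail V t" by (simp add: tail_eq_expectation)
      finally have 1: "\<bar>?E u - ?E c\<bar> \<le> e / 3 * tail V t" .
      have "\<bar>?h u - ?h c\<bar> = \<bar>\<integral>x. g x u - g x c \<partial>\<tau>\<bar>"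
        by (subst Bochner_Integration.integral_diff[symmetric]) (auto simp: int\<tau>)
      also have "\<dots> \<le> (\<integral>x. \<bar>g x u - g x c\<bar> \<partial>\<tau>)" by (rule integral_abs_bound)
      also have "\<dots> \<le> (\<integral>x. e / 3 \<partial>\<tau>)"
      proof (rule integral_mono_AE)
        show "AE x in \<tau>. \<bar>g x u - g x c\<bar> \<le> e / 3"
          using \<tau>(3) by eventually_elim (rule d'[OF _ \<open>u \<in> L\<close> \<open>c \<in> L\<close> c(2)])
      qed (auto intro!: int\<tau>)
      finally have 2: "\<bar>?h u - ?h c\<bar> \<le> e / 3" by (simp add: \<tau>.prob_space)
      have "?E c / tail V t - ?h c = (?E c - ?h c * tail V t) / tail V t"
        using pos[of t] by (simp add: field_simps)
      with t c(1) have "\<bar>(?E c - ?h c * tail V t) / tail V t\<bar> < e / 3" by auto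
      then have 3: "\<bar>?E c - ?h c * tail V t\<bar> \<le> e / 3 * tail V t"
        using pos[of t] by (simp add: abs_divide field_simps)
      have 4: "\<bar>?h u * tail V t - ?h c * tail V t\<bar> \<le> e / 3 * tail V t"
        using 2 pos[of t] by (simp add: left_diff_distrib[symmetric] abs_mult mult_right_mono)
      show "\<bar>?E u - ?h u * tail V t\<bar> \<le> e * tail V t"
      proof -
        have "\<bar>?E u - ?h u * tail V t\<bar> \<le> \<bar>?E u - ?E c\<bar> + \<bar>?E c - ?h c * tail V t\<bar>
          + \<bar>?h u * tail V t - ?h c * tail V t\<bar>" by linarith
        also have "\<dots> \<le> e / 3 * tail V t + e / 3 * tail V t + e / 3 * tail V t"
          by (intro add_mono 1 3 4)
        finally show ?thesis by simp
      qed
    qed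
  qed
qed

text \<open>Replaces \<open>W\<close> by its limit law inside the expectation over the event \<open>V * R > t\<close>, while \<open>U\<close> stays
  random. This is the mixing lemma for the error of the uniform limit.\<close>

lemma direction_averaging:
  fixes W U :: "'a \<Rightarrow> 'b::euclidean_space" and V R :: "'a \<Rightarrow> real" and g :: "'b \<Rightarrow> 'b \<Rightarrow> real"
  assumes ind: "indep_var borel (\<lambda>\<omega>. (W \<omega>, V \<omega>)) borel (\<lambda>\<omega>. (U \<omega>, R \<omega>))"
    and R0: "\<And>\<omega>. 0 \<le> R \<omega>"
    and K: "compact K" "\<And>\<omega>. W \<omega> \<in> K" and L: "compact L" "\<And>\<omega>. U \<omega> \<in> L"
    and \<tau>: "prob_space \<tau>" "sets \<tau> = sets borel" "AE x in \<tau>. x \<in> K"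
    and dir: "\<And>f. continuous_on UNIV f \<Longrightarrow> bounded (range f) \<Longrightarrow>
      ((\<lambda>t. expectation (\<lambda>\<omega>. f (W \<omega>) * indicator {t<..} (V \<omega>)) / tail V t) \<longlongrightarrow> (\<integral>x. f x \<partial>\<tau>)) at_top"
    and pos: "\<And>t. tail V t > 0"
    and negl: "\<And>s. s > 0 \<Longrightarrow> ((\<lambda>t. tail R (s * t) / tail (\<lambda>\<omega>. V \<omega> * R \<omega>) t) \<longlongrightarrow> 0) at_top"
    and g: "continuous_on UNIV (\<lambda>z. g (fst z) (snd z))" and bnd: "\<And>w u. \<bar>g w u\<bar> \<le> B"
  shows "((\<lambda>t. expectation (\<lambda>\<omega>. (g (W \<omega>) (U \<omega>) - (\<integral>x. g x (U \<omega>) \<partial>\<tau>)) * indicator {t<..} (V \<omega> * R \<omega>))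
    / tail (\<lambda>\<omega>. V \<omega> * R \<omega>) t) \<longlongrightarrow> 0) at_top"
proof -
  note [measurable] = indep_pairs_borel[OF ind]
  interpret \<tau>: prob_space \<tau> by fact
  note [measurable_cong] = \<tau>(2)
  have B: "0 \<le> B" using bnd[of undefined undefined] by linarith
  define h where "h u = (\<integral>x. g x u \<partial>\<tau>)" for u
  have gm: "(\<lambda>z. g (fst z) (snd z)) \<in> borel_measurable borel"
    using g by (rule borel_measurable_continuous_onI)
  have [measurable]: "(\<lambda>x. g x u) \<in> borel_measurable borel" for u
    by (rule borel_measurable_uncurried[OF gm]) measurable
  have hc: "continuous_on UNIV h"
    unfolding h_def using \<tau> g bnd by (intro continuous_on_parametric_integral) auto
  then have hm [measurable]: "h \<in> borel_measurable borel" by (rule borel_measurable_continuous_onI)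
  have hb: "\<bar>h u\<bar> \<le> B" for u
    unfolding h_def using \<tau> bnd by (intro abs_integral_le_bound) auto
  define \<psi> where "\<psi> u s = expectation (\<lambda>\<omega>. (g (W \<omega>) u - h u) * indicator {s<..} (V \<omega>))" for u s
  have \<psi>: "\<psi> u s = expectation (\<lambda>\<omega>. g (W \<omega>) u * indicator {s<..} (V \<omega>)) - h u * tail V s" for u s
  proof -
    have "integrable M (\<lambda>\<omega>. g (W \<omega>) u * indicator {s<..} (V \<omega>))"
      by (intro integrable_const_bound[where B = B]) (auto simp: indicator_def bnd B)
    moreover have "integrable M (\<lambda>\<omega>. h u * indicator {s<..} (V \<omega>))"
      by (intro integrable_const_bound[where B = B]) (auto simp: indicator_def hb B)
    ultimately show ?thesis
      unfolding \<psi>_def left_diff_distrib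
      by (subst Bochner_Integration.integral_diff) (auto simp: tail_eq_expectation)
  qed
  have gm3: "(\<lambda>z. g (fst z) (snd z) - h (snd z)) \<in> borel_measurable borel"
    using gm unfolding borel_prod[symmetric] by measurable
  have "((\<lambda>t. expectation (\<lambda>\<omega>. if R \<omega> > 0 then \<psi> (U \<omega>) (t / R \<omega>) else 0) /
      tail (\<lambda>\<omega>. V \<omega> * R \<omega>) t) \<longlongrightarrow> 0) at_top"
  proof (rule mixing_negligible[OF ind R0 _ _ L(2) _ negl])
    have "(\<lambda>z. g (W (snd z)) (fst (fst z)) - h (fst (fst z))) \<in> borel_measurable ((borel \<Otimes>\<^sub>M borel) \<Otimes>\<^sub>M M)"
      by (intro borel_measurable_diff borel_measurable_uncurried[OF gm]) measurable
    then have "(\<lambda>z. (g (W (snd z)) (fst (fst z)) - h (fst (fst z))) * indicator {snd (fst z)<..} (V (snd z)))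
      \<in> borel_measurable ((borel \<Otimes>\<^sub>M borel) \<Otimes>\<^sub>M M)"
      unfolding indicator_def greaterThan_iff of_bool_def by measurable
    then show "(\<lambda>z. \<psi> (fst z) (snd z)) \<in> borel_measurable borel"
      unfolding \<psi>_def borel_prod[symmetric]
      by (intro borel_measurable_lebesgue_integral) (simp add: split_beta')
    show "\<bar>\<psi> u s\<bar> \<le> 2 * B" for u s
      unfolding \<psi>_def
    proof (rule abs_integral_le_bound)
      fix \<omega>
      show "\<bar>(g (W \<omega>) u - h u) * indicator {s<..} (V \<omega>)\<bar> \<le> 2 * B"
        using bnd[of "W \<omega>" u] hb[of u] by (auto simp: indicator_def)
    qed (auto intro: prob_space_axioms)
    fix e :: real assume "e > 0"
    show "\<forall>\<^sub>F s in at_top. \<forall>u\<in>L. \<bar>\<psi> u s\<bar> \<le> e * tail V s"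
      unfolding \<psi> h_def
      by (rule uniform_direction_limit[OF _ _ K L(1) \<tau> dir pos g bnd \<open>e > 0\<close>]) auto
  qed
  moreover have "\<forall>\<^sub>F t in at_top. expectation (\<lambda>\<omega>. if R \<omega> > 0 then \<psi> (U \<omega>) (t / R \<omega>) else 0) /
      tail (\<lambda>\<omega>. V \<omega> * R \<omega>) t = expectation (\<lambda>\<omega>. (g (W \<omega>) (U \<omega>) - h (U \<omega>)) * indicator {t<..} (V \<omega> * R \<omega>))
    / tail (\<lambda>\<omega>. V \<omega> * R \<omega>) t"
    using eventually_ge_at_top[of 0]
  proof eventually_elim
    fix t :: real assume "0 \<le> t"
    have "\<bar>g w u - h u\<bar> \<le> 2 * B" for w u
      using bnd[of w u] hb[of u] by linarith
    from expectation_on_product_tail[OF ind R0 \<open>0 \<le> t\<close> gm3 this]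
    show "expectation (\<lambda>\<omega>. if R \<omega> > 0 then \<psi> (U \<omega>) (t / R \<omega>) else 0) /
      tail (\<lambda>\<omega>. V \<omega> * R \<omega>) t = expectation (\<lambda>\<omega>. (g (W \<omega>) (U \<omega>) - h (U \<omega>)) * indicator {t<..} (V \<omega> * R \<omega>))
    / tail (\<lambda>\<omega>. V \<omega> * R \<omega>) t"
      by (simp add: \<psi>_def cong: if_cong)
  qed
  ultimately show ?thesis unfolding h_def by (rule Lim_transform_eventually)
qed

text \<open>The averaging lemma is used twice: first for \<open>W\<close>, which leaves a function \<open>h\<close> of \<open>U\<close> alone, then
  for \<open>U\<close> with the two pairs exchanged.\<close>

proposition directions_asymptotically_independent:
  fixes W U :: "'a \<Rightarrow> 'b::euclidean_space" and V R :: "'a \<Rightarrow> real" and g :: "'b \<Rightarrow> 'b \<Rightarrow> real"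
  assumes ind: "indep_var borel (\<lambda>\<omega>. (W \<omega>, V \<omega>)) borel (\<lambda>\<omega>. (U \<omega>, R \<omega>))"
    and V0: "\<And>\<omega>. 0 \<le> V \<omega>" and R0: "\<And>\<omega>. 0 \<le> R \<omega>"
    and K: "compact K" "\<And>\<omega>. W \<omega> \<in> K" and L: "compact L" "\<And>\<omega>. U \<omega> \<in> L"
    and \<tau>: "prob_space \<tau>" "sets \<tau> = sets borel" "AE x in \<tau>. x \<in> K"
    and \<sigma>: "prob_space \<sigma>" "sets \<sigma> = sets borel" "AE x in \<sigma>. x \<in> L"
    and dirV: "\<And>f. continuous_on UNIV f \<Longrightarrow> bounded (range f) \<Longrightarrow>
      ((\<lambda>t. expectation (\<lambda>\<omega>. f (W \<omega>) * indicator {t<..} (V \<omega>)) / tail V t) \<longlongrightarrow> (\<integral>x. f x \<partial>\<tau>)) at_top"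
    and dirR: "\<And>f. continuous_on UNIV f \<Longrightarrow> bounded (range f) \<Longrightarrow>
      ((\<lambda>t. expectation (\<lambda>\<omega>. f (U \<omega>) * indicator {t<..} (R \<omega>)) / tail R t) \<longlongrightarrow> (\<integral>x. f x \<partial>\<sigma>)) at_top"
    and posV: "\<And>t. tail V t > 0" and posR: "\<And>t. tail R t > 0"
    and pos: "\<And>t. tail (\<lambda>\<omega>. V \<omega> * R \<omega>) t > 0"
    and neglV: "\<And>s. s > 0 \<Longrightarrow> ((\<lambda>t. tail V (s * t) / tail (\<lambda>\<omega>. V \<omega> * R \<omega>) t) \<longlongrightarrow> 0) at_top"
    and neglR: "\<And>s. s > 0 \<Longrightarrow> ((\<lambda>t. tail R (s * t) / tail (\<lambda>\<omega>. V \<omega> * R \<omega>) t) \<longlongrightarrow> 0) at_top"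
    and g: "continuous_on UNIV (\<lambda>z. g (fst z) (snd z))" and bnd: "\<And>w u. \<bar>g w u\<bar> \<le> B"
  shows "((\<lambda>t. expectation (\<lambda>\<omega>. g (W \<omega>) (U \<omega>) * indicator {t<..} (V \<omega> * R \<omega>))
    / tail (\<lambda>\<omega>. V \<omega> * R \<omega>) t) \<longlongrightarrow> (\<integral>u. (\<integral>w. g w u \<partial>\<tau>) \<partial>\<sigma>)) at_top"
proof -
  note [measurable] = indep_pairs_borel[OF ind]
  note [measurable_cong] = \<tau>(2) \<sigma>(2)
  have B: "0 \<le> B" using bnd[of undefined undefined] by linarith
  define h where "h u = (\<integral>x. g x u \<partial>\<tau>)" for u
  have hc: "continuous_on UNIV h"
    unfolding h_def using \<tau> g bnd by (intro continuous_on_parametric_integral) auto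
  then have hm [measurable]: "h \<in> borel_measurable borel" by (rule borel_measurable_continuous_onI)
  have gm: "(\<lambda>z. g (fst z) (snd z)) \<in> borel_measurable borel"
    using g by (rule borel_measurable_continuous_onI)
  have [measurable]: "(\<lambda>x. g x u) \<in> borel_measurable borel" for u
    by (rule borel_measurable_uncurried[OF gm]) measurable
  have gWU [measurable]: "(\<lambda>\<omega>. g (W \<omega>) (U \<omega>)) \<in> borel_measurable M"
    by (rule borel_measurable_uncurried[OF gm]) measurable
  have hb: "\<bar>h u\<bar> \<le> B" for u
    unfolding h_def using \<tau> bnd by (intro abs_integral_le_bound) auto
  let ?T = "tail (\<lambda>\<omega>. V \<omega> * R \<omega>)" and ?I = "\<lambda>t \<omega>. indicator {t<..} (V \<omega> * R \<omega>) :: real"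
  have "((\<lambda>t. expectation (\<lambda>\<omega>. (g (W \<omega>) (U \<omega>) - h (U \<omega>)) * ?I t \<omega>) / ?T t) \<longlongrightarrow> 0) at_top"
    unfolding h_def by (rule direction_averaging[OF ind R0 K L \<tau> dirV posV neglR g bnd])
  moreover have "((\<lambda>t. expectation (\<lambda>\<omega>. (h (U \<omega>) - (\<integral>u. h u \<partial>\<sigma>)) * ?I t \<omega>) / ?T t) \<longlongrightarrow> 0) at_top"
    using direction_averaging[OF indep_var_swap[OF ind] V0 L K \<sigma> dirR posR, where g = "\<lambda>u w. h u" and B = B]
      neglV hb continuous_on_compose2[OF hc, of UNIV fst]
    by (simp add: mult.commute[of "R _"] continuous_on_fst)
  ultimately have "((\<lambda>t. expectation (\<lambda>\<omega>. (g (W \<omega>) (U \<omega>) - h (U \<omega>)) * ?I t \<omega>) / ?T t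
      + expectation (\<lambda>\<omega>. (h (U \<omega>) - (\<integral>u. h u \<partial>\<sigma>)) * ?I t \<omega>) / ?T t + (\<integral>u. h u \<partial>\<sigma>))
      \<longlongrightarrow> 0 + 0 + (\<integral>u. h u \<partial>\<sigma>)) at_top"
    by (intro tendsto_intros)
  also have "(\<lambda>t. expectation (\<lambda>\<omega>. (g (W \<omega>) (U \<omega>) - h (U \<omega>)) * ?I t \<omega>) / ?T t
      + expectation (\<lambda>\<omega>. (h (U \<omega>) - (\<integral>u. h u \<partial>\<sigma>)) * ?I t \<omega>) / ?T t + (\<integral>u. h u \<partial>\<sigma>))
    = (\<lambda>t. expectation (\<lambda>\<omega>. g (W \<omega>) (U \<omega>) * ?I t \<omega>) / ?T t)"
  proof
    fix t
    have i: "integrable M (\<lambda>\<omega>. g (W \<omega>) (U \<omega>) * ?I t \<omega>)" "integrable M (\<lambda>\<omega>. h (U \<omega>) * ?I t \<omega>)"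
      by (intro integrable_const_bound[where B = B]; auto simp: indicator_def bnd hb B)+
    have j: "integrable M (\<lambda>\<omega>. c * ?I t \<omega>)" for c
      by (intro integrable_const_bound[where B = "\<bar>c\<bar>"]) (auto simp: indicator_def)
    have "?T t = expectation (?I t)" by (simp add: tail_eq_expectation)
    then show "expectation (\<lambda>\<omega>. (g (W \<omega>) (U \<omega>) - h (U \<omega>)) * ?I t \<omega>) / ?T t
      + expectation (\<lambda>\<omega>. (h (U \<omega>) - (\<integral>u. h u \<partial>\<sigma>)) * ?I t \<omega>) / ?T t + (\<integral>u. h u \<partial>\<sigma>)
      = expectation (\<lambda>\<omega>. g (W \<omega>) (U \<omega>) * ?I t \<omega>) / ?T t"
      using pos[of t] i j
      by (simp add: left_diff_distrib Bochner_Integration.integral_diff field_simps)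
  qed
  finally show ?thesis by (simp add: h_def)
qed

end

section \<open>Matrix products\<close>

lemma continuous_on_matrix_mult:
  fixes f :: "'a::topological_space \<Rightarrow> real^'n^'m" and g :: "'a \<Rightarrow> real^'k^'n"
  assumes "continuous_on S f" "continuous_on S g"
  shows "continuous_on S (\<lambda>x. f x ** g x)"
  unfolding matrix_matrix_mult_def using assms
  by (intro continuous_on_vec_lambda continuous_on_sum continuous_on_mult continuous_on_component)

lemma borel_measurable_matrix_mult [measurable]:
  fixes f :: "'a \<Rightarrow> real^'n^'m" and g :: "'a \<Rightarrow> real^'k^'n"
  assumes "f \<in> borel_measurable M" "g \<in> borel_measurable M"
  shows "(\<lambda>x. f x ** g x) \<in> borel_measurable M"
  by (rule borel_measurable_uncurried[OF _ assms])
    (intro borel_measurable_continuous_onI continuous_on_matrix_mult continuous_on_fst continuous_on_snd continuous_on_id)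

lemma mat_prod_cong:
  "(\<And>i. 1 \<le> i \<Longrightarrow> i \<le> n \<Longrightarrow> X i x = Y i y) \<Longrightarrow> mat_prod X n x = mat_prod Y n y"
  by (induction n) auto

lemma borel_measurable_mat_prod:
  "(\<And>i. 1 \<le> i \<Longrightarrow> i \<le> n \<Longrightarrow> X i \<in> borel_measurable M) \<Longrightarrow> mat_prod X n \<in> borel_measurable M"
proof (induction n)
  case (Suc n)
  then have [measurable]: "mat_prod X n \<in> borel_measurable M" "X (Suc n) \<in> borel_measurable M" by auto
  have "(\<lambda>x. mat_prod X n x ** X (Suc n) x) \<in> borel_measurable M" by measurable
  then show ?case by (simp add: fun_eq_iff cong: measurable_cong)
qed (simp add: measurable_const cong: measurable_cong)

lemma mat_prod_scaleR:
  "mat_prod (\<lambda>i x. r i x *\<^sub>R X i x) n x = (\<Prod>i=1..n. r i x) *\<^sub>R mat_prod X n x"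
  by (induction n)
    (auto simp: matrix_scalar_ac scalar_matrix_assoc[symmetric] mult.commute)

text \<open>The functions of the first \<open>n\<close> variables are expressed through the restriction of the sequence to
  \<open>{1..n}\<close>, since independence is available for such restrictions.\<close>

lemma (in prob_space) indep_var_prefix:
  assumes ind: "indep_vars (\<lambda>_. borel) X {1::nat..}" and "n < m"
    and f: "f \<in> measurable (PiM {1..n} (\<lambda>_. borel)) borel"
  shows "indep_var borel (\<lambda>\<omega>. f (restrict (\<lambda>i. X i \<omega>) {1..n})) borel (X m)"
proof -
  have "indep_var borel (f \<circ> (\<lambda>\<omega>. restrict (\<lambda>i. X i \<omega>) {1..n}))
      borel ((\<lambda>x. x m) \<circ> (\<lambda>\<omega>. restrict (\<lambda>i. X i \<omega>) {m}))"
    using \<open>n < m\<close> by (intro indep_var_compose[OF indep_var_restrict[OF ind] f]) auto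
  then show ?thesis by (simp add: comp_def)
qed

lemma (in prob_space) indep_var_mat_prod:
  fixes X :: "nat \<Rightarrow> 'a \<Rightarrow> real^'d^'d"
  assumes ind: "indep_vars (\<lambda>_. borel) X {1::nat..}" and "n < m"
  shows "indep_var borel (mat_prod X n) borel (X m)"
proof -
  let ?f = "mat_prod (\<lambda>i (x :: nat \<Rightarrow> real^'d^'d). x i) n"
  have "?f \<in> measurable (PiM {1..n} (\<lambda>_. borel)) borel"
    by (intro borel_measurable_mat_prod measurable_component_singleton) auto
  from indep_var_prefix[OF ind \<open>n < m\<close> this]
  have "indep_var borel (\<lambda>\<omega>. ?f (restrict (\<lambda>i. X i \<omega>) {1..n})) borel (X m)" .
  also have "(\<lambda>\<omega>. ?f (restrict (\<lambda>i. X i \<omega>) {1..n})) = mat_prod X n"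
    by (intro ext mat_prod_cong) auto
  finally show ?thesis .
qed

section \<open>Products of independent factors in polar coordinates\<close>

text \<open>An iid sequence of matrices \<open>R i \<omega> *\<^sub>R U i \<omega>\<close> in polar coordinates, with directions in a compact
  set \<open>L\<close> and conditional limit law \<open>\<sigma>\<close>. The axioms isolate what the induction over the number of
  factors uses of the decomposition of a matrix into its norm and its direction.\<close>

locale polar_factors = prob_space M for M :: "'w measure" +
  fixes U :: "nat \<Rightarrow> 'w \<Rightarrow> real^'d^'d" and R :: "nat \<Rightarrow> 'w \<Rightarrow> real" and \<alpha> :: real
    and L :: "(real^'d^'d) set" and \<sigma> :: "(real^'d^'d) measure"
  assumes indep: "indep_vars (\<lambda>_. borel) (\<lambda>i \<omega>. (U i \<omega>, R i \<omega>)) {1..}"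
    and ident: "\<And>i. i \<ge> 1 \<Longrightarrow> distr M borel (\<lambda>\<omega>. (U i \<omega>, R i \<omega>)) = distr M borel (\<lambda>\<omega>. (U 1 \<omega>, R 1 \<omega>))"
    and R_nonneg: "\<And>i \<omega>. 0 \<le> R i \<omega>"
    and L: "compact L" "\<And>i \<omega>. U i \<omega> \<in> L"
    and tail_R_pos: "\<And>t. tail (R 1) t > 0"
    and tail_R_rv: "\<And>c. c > 0 \<Longrightarrow> ((\<lambda>t. tail (R 1) (c * t) / tail (R 1) t) \<longlongrightarrow> c powr (- \<alpha>)) at_top"
    and one_negl_two: "((\<lambda>t. tail (R 1) t / tail (\<lambda>\<omega>. R 1 \<omega> * R 2 \<omega>) t) \<longlongrightarrow> 0) at_top"
    and \<sigma>: "prob_space \<sigma>" "sets \<sigma> = sets borel" "AE x in \<sigma>. x \<in> L"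
    and dir: "\<And>f. continuous_on UNIV f \<Longrightarrow> bounded (range f) \<Longrightarrow>
      ((\<lambda>t. expectation (\<lambda>\<omega>. f (U 1 \<omega>) * indicator {t<..} (R 1 \<omega>)) / tail (R 1) t) \<longlongrightarrow> (\<integral>x. f x \<partial>\<sigma>)) at_top"
begin

definition V :: "nat \<Rightarrow> 'w \<Rightarrow> real" where "V n \<omega> = (\<Prod>i=1..n. R i \<omega>)"

lemma V_1: "V (Suc 0) = R 1" and V_Suc: "V (Suc n) = (\<lambda>\<omega>. V n \<omega> * R (Suc n) \<omega>)"
  by (auto simp: V_def fun_eq_iff)

lemma V_nonneg: "0 \<le> V n \<omega>"
  by (auto simp: V_def R_nonneg intro!: prod_nonneg)

lemma indep_prefix:
  assumes "n < m"
  shows "indep_var borel (\<lambda>\<omega>. (mat_prod U n \<omega>, V n \<omega>)) borel (\<lambda>\<omega>. (U m \<omega>, R m \<omega>))"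
proof -
  let ?f = "\<lambda>x :: nat \<Rightarrow> (real^'d^'d) \<times> real. (mat_prod (\<lambda>i x. fst (x i)) n x, \<Prod>i=1..n. snd (x i))"
  have c [measurable]: "(\<lambda>x :: nat \<Rightarrow> (real^'d^'d) \<times> real. x i) \<in> borel_measurable (PiM {1..n} (\<lambda>_. borel))"
    if "1 \<le> i" "i \<le> n" for i
    using that by (intro measurable_component_singleton) auto
  have "?f \<in> measurable (PiM {1..n} (\<lambda>_. borel)) borel"
  proof (intro borel_measurable_Pair borel_measurable_mat_prod borel_measurable_prod)
    show "(\<lambda>x :: nat \<Rightarrow> (real^'d^'d) \<times> real. fst (x i)) \<in> borel_measurable (PiM {1..n} (\<lambda>_. borel))"
      if "1 \<le> i" "i \<le> n" for i
      using measurable_compose[OF c[OF that] borel_measurable_continuous_onI[OF continuous_on_fst[OF continuous_on_id]]] .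
    show "(\<lambda>x :: nat \<Rightarrow> (real^'d^'d) \<times> real. snd (x i)) \<in> borel_measurable (PiM {1..n} (\<lambda>_. borel))"
      if "i \<in> {1..n}" for i
      using that measurable_compose[OF c borel_measurable_continuous_onI[OF continuous_on_snd[OF continuous_on_id]]] by auto
  qed
  from indep_var_prefix[OF indep assms this]
  have "indep_var borel (\<lambda>\<omega>. ?f (restrict (\<lambda>i. (U i \<omega>, R i \<omega>)) {1..n})) borel (\<lambda>\<omega>. (U m \<omega>, R m \<omega>))" .
  also have "(\<lambda>\<omega>. ?f (restrict (\<lambda>i. (U i \<omega>, R i \<omega>)) {1..n})) = (\<lambda>\<omega>. (mat_prod U n \<omega>, V n \<omega>))"
    by (intro ext) (auto simp: V_def intro!: mat_prod_cong prod.cong)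
  finally show ?thesis .
qed

lemma V_borel [measurable]: "V n \<in> borel_measurable M"
  and mat_prod_U_borel [measurable]: "mat_prod U n \<in> borel_measurable M"
  using indep_pairs_borel[OF indep_prefix[of n "Suc n"]] by auto

lemma factor_borel: assumes "i \<ge> 1" shows "U i \<in> borel_measurable M" "R i \<in> borel_measurable M"
  using indep_pairs_borel[OF indep_prefix[of 0 i]] assms by auto

lemma distr_factor:
  assumes "i \<ge> 1" and "f \<in> borel_measurable borel"
  shows "distr M borel (\<lambda>\<omega>. f (U i \<omega>, R i \<omega>)) = distr M borel (\<lambda>\<omega>. f (U 1 \<omega>, R 1 \<omega>))"
proof -
  note [measurable] = factor_borel[OF assms(1)] factor_borel[of 1, simplified]
  have "(\<lambda>\<omega>. (U i \<omega>, R i \<omega>)) \<in> borel_measurable M" "(\<lambda>\<omega>. (U 1 \<omega>, R 1 \<omega>)) \<in> borel_measurable M"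
    by simp_all
  then have "distr M borel (\<lambda>\<omega>. f (U i \<omega>, R i \<omega>)) = distr (distr M borel (\<lambda>\<omega>. (U i \<omega>, R i \<omega>))) borel f"
    "distr M borel (\<lambda>\<omega>. f (U 1 \<omega>, R 1 \<omega>)) = distr (distr M borel (\<lambda>\<omega>. (U 1 \<omega>, R 1 \<omega>))) borel f"
    using assms(2) by (simp_all add: distr_distr comp_def)
  then show ?thesis using ident[OF assms(1)] by simp
qed

lemma expectation_factor:
  fixes f :: "(real^'d^'d) \<times> real \<Rightarrow> real"
  assumes "i \<ge> 1" and [measurable]: "f \<in> borel_measurable borel"
  shows "expectation (\<lambda>\<omega>. f (U i \<omega>, R i \<omega>)) = expectation (\<lambda>\<omega>. f (U 1 \<omega>, R 1 \<omega>))"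
proof -
  note [measurable] = factor_borel[OF assms(1)] factor_borel[of 1, simplified]
  have "expectation (\<lambda>\<omega>. f (U i \<omega>, R i \<omega>)) = (\<integral>x. f x \<partial>distr M borel (\<lambda>\<omega>. (U i \<omega>, R i \<omega>)))"
    "expectation (\<lambda>\<omega>. f (U 1 \<omega>, R 1 \<omega>)) = (\<integral>x. f x \<partial>distr M borel (\<lambda>\<omega>. (U 1 \<omega>, R 1 \<omega>)))"
    by (simp_all add: integral_distr)
  then show ?thesis using ident[OF assms(1)] by simp
qed

lemma tail_R: assumes "i \<ge> 1" shows "tail (R i) = tail (R 1)"
proof (rule tail_cong_distr)
  show "distr M borel (R i) = distr M borel (R 1)"
    using distr_factor[OF assms borel_measurable_continuous_onI[OF continuous_on_snd[OF continuous_on_id]]] by simp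
qed (use factor_borel assms in auto)

text \<open>Since the factors are identically distributed, the last one may be replaced by any later one. This
  makes the tail of \<open>V (Suc n)\<close> comparable with an expectation over the same variable \<open>R m\<close> that
  produces \<open>V m\<close>.\<close>

lemma tail_V_Suc:
  assumes "n < m" "t \<ge> 0"
  shows "tail (V (Suc n)) t = expectation (\<lambda>\<omega>. if R m \<omega> > 0 then tail (V n) (t / R m \<omega>) else 0)"
proof -
  define f :: "(real^'d^'d) \<times> real \<Rightarrow> real" where "f z = (if snd z > 0 then tail (V n) (t / snd z) else 0)" for z
  have [measurable]: "f \<in> borel_measurable borel" unfolding f_def borel_prod[symmetric] by measurable
  have "tail (V (Suc n)) t = expectation (\<lambda>\<omega>. f (U (Suc n) \<omega>, R (Suc n) \<omega>))"
    unfolding V_Suc f_def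
    using tail_product[OF indep_prefix[of n "Suc n"] R_nonneg \<open>t \<ge> 0\<close>] by (simp cong: if_cong)
  also have "\<dots> = expectation (\<lambda>\<omega>. f (U m \<omega>, R m \<omega>))"
    using expectation_factor[of "Suc n" f] expectation_factor[of m f] \<open>n < m\<close> by simp
  finally show ?thesis by (simp add: f_def cong: if_cong)
qed

text \<open>The factor \<open>R (Suc n)\<close> exceeds 1 with a fixed positive probability, and then it only enlarges the
  product.\<close>

lemma tail_V_Suc_ge:
  assumes "t \<ge> 0" shows "tail (V n) t * tail (R 1) 1 \<le> tail (V (Suc n)) t"
proof -
  note [measurable] = factor_borel[of "Suc n", simplified]
  have "tail (V n) t * tail (R 1) 1 = expectation (\<lambda>\<omega>. tail (V n) t * indicator {1<..} (R (Suc n) \<omega>))"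
    using tail_R[of "Suc n"] tail_eq_expectation[of "R (Suc n)" 1] by simp
  also have "\<dots> \<le> expectation (\<lambda>\<omega>. if R (Suc n) \<omega> > 0 then tail (V n) (t / R (Suc n) \<omega>) else 0)"
  proof (rule integral_mono)
    fix \<omega>
    have "tail (V n) t \<le> tail (V n) (t / R (Suc n) \<omega>)" if "R (Suc n) \<omega> > 1"
      using that \<open>t \<ge> 0\<close> by (intro tail_antimono) (auto simp: divide_le_eq mult_right_mono[of 1 _ t, simplified] mult_le_cancel_left1)
    then show "tail (V n) t * indicator {1<..} (R (Suc n) \<omega>) \<le>
      (if R (Suc n) \<omega> > 0 then tail (V n) (t / R (Suc n) \<omega>) else 0)"
      by (auto simp: indicator_def)
  qed (auto intro!: integrable_const_bound[where B = 1] simp: indicator_def)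
  also have "\<dots> = tail (V (Suc n)) t" using \<open>t \<ge> 0\<close> by (subst tail_V_Suc[of n "Suc n"]) auto
  finally show ?thesis .
qed

lemma tail_V_pos: "tail (V (Suc n)) t > 0"
proof -
  have "tail (V (Suc n)) t > 0" if "t \<ge> 0" for t
    using that
  proof (induction n)
    case 0
    show ?case unfolding V_1 by (rule tail_R_pos)
  next
    case (Suc n)
    show ?case
      using mult_pos_pos[OF Suc.IH[OF Suc.prems] tail_R_pos[of 1]] tail_V_Suc_ge[OF Suc.prems, of "Suc n"]
      by linarith
  qed
  from this[of "max 0 t"] tail_antimono[of "V (Suc n)" t "max 0 t"] show ?thesis by simp
qed

text \<open>Adding factors costs at most a constant in the tail, so the negligibility of one factor against
  two propagates.\<close>

lemma one_negl:
  "((\<lambda>t. tail (R 1) t / tail (V (Suc (Suc n))) t) \<longlongrightarrow> 0) at_top"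
proof (induction n)
  case 0
  show ?case using one_negl_two by (simp add: V_1 V_Suc[of "Suc 0"] numeral_2_eq_2)
next
  case (Suc n)
  from tendsto_mult[OF Suc tendsto_const[of "1 / tail (R 1) 1"]]
  have lim: "((\<lambda>t. tail (R 1) t / tail (V (Suc (Suc n))) t * (1 / tail (R 1) 1)) \<longlongrightarrow> 0) at_top" by simp
  show ?case
  proof (rule tendsto_sandwich[OF _ _ tendsto_const lim])
    show "\<forall>\<^sub>F t in at_top. tail (R 1) t / tail (V (Suc (Suc (Suc n)))) t
        \<le> tail (R 1) t / tail (V (Suc (Suc n))) t * (1 / tail (R 1) 1)"
      using eventually_ge_at_top[of 0]
    proof eventually_elim
      fix t :: real assume "t \<ge> 0"
      have "tail (R 1) t / tail (V (Suc (Suc (Suc n)))) t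
          \<le> tail (R 1) t / (tail (V (Suc (Suc n))) t * tail (R 1) 1)"
        using tail_V_Suc_ge[OF \<open>t \<ge> 0\<close>] tail_V_pos tail_R_pos
        by (intro divide_left_mono mult_pos_pos) auto
      then show "tail (R 1) t / tail (V (Suc (Suc (Suc n)))) t
        \<le> tail (R 1) t / tail (V (Suc (Suc n))) t * (1 / tail (R 1) 1)" by simp
    qed
  qed simp
qed

lemma one_negl_scaled:
  assumes "s > 0" "i \<ge> 1"
  shows "((\<lambda>t. tail (R i) (s * t) / tail (V (Suc (Suc n))) t) \<longlongrightarrow> 0) at_top"
proof -
  have "((\<lambda>t. (tail (R 1) (s * t) / tail (R 1) t) * (tail (R 1) t / tail (V (Suc (Suc n))) t))
      \<longlongrightarrow> s powr (- \<alpha>) * 0) at_top"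
    by (intro tendsto_mult tail_R_rv assms one_negl)
  then show ?thesis using tail_R_pos tail_R[OF assms(2)] by (simp add: less_imp_neq[THEN not_sym])
qed

text \<open>Induction with the mixing lemma for \<open>\<phi> u s = P(V > c * s) - c powr (- \<alpha>) * P(V > s)\<close>, whose
  expectation at \<open>s = t / R\<close> is the same difference for the product with one more factor.\<close>

lemma tail_V_rv:
  assumes "c > 0"
  shows "((\<lambda>t. tail (V (Suc n)) (c * t) / tail (V (Suc n)) t) \<longlongrightarrow> c powr (- \<alpha>)) at_top"
proof (induction n)
  case 0
  show ?case unfolding V_1 by (rule tail_R_rv[OF assms])
next
  case (Suc n)
  let ?V = "V (Suc n)" and ?R = "R (Suc (Suc n))" and ?T = "tail (V (Suc (Suc n)))"
  note [measurable] = factor_borel[of "Suc (Suc n)", simplified]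
  define \<phi> where "\<phi> (u :: real^'d^'d) s = tail ?V (c * s) - c powr (- \<alpha>) * tail ?V s" for u s
  have "((\<lambda>t. expectation (\<lambda>\<omega>. if ?R \<omega> > 0 then \<phi> (U (Suc (Suc n)) \<omega>) (t / ?R \<omega>) else 0) /
      tail (\<lambda>\<omega>. ?V \<omega> * ?R \<omega>) t) \<longlongrightarrow> 0) at_top"
  proof (rule mixing_negligible[OF indep_prefix R_nonneg])
    show "(\<lambda>z. \<phi> (fst z) (snd z)) \<in> borel_measurable borel"
      unfolding \<phi>_def borel_prod[symmetric] by measurable
    show "\<bar>\<phi> u s\<bar> \<le> 1 + c powr (- \<alpha>)" for u s
    proof -
      have "0 \<le> c powr (- \<alpha>) * tail ?V s" "c powr (- \<alpha>) * tail ?V s \<le> c powr (- \<alpha>)"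
        by (auto intro!: mult_left_le)
      moreover have "0 \<le> tail ?V (c * s)" "tail ?V (c * s) \<le> 1" by simp_all
      ultimately show ?thesis unfolding \<phi>_def by linarith
    qed
    fix e :: real assume "e > 0"
    from tendstoD[OF Suc this]
    show "\<forall>\<^sub>F s in at_top. \<forall>u\<in>L. \<bar>\<phi> u s\<bar> \<le> e * tail ?V s"
    proof eventually_elim
      fix s assume "dist (tail ?V (c * s) / tail ?V s) (c powr - \<alpha>) < e"
      moreover have "tail ?V (c * s) / tail ?V s - c powr - \<alpha> = \<phi> u s / tail ?V s" for u
        using tail_V_pos[of n s] by (simp add: \<phi>_def field_simps)
      ultimately have "\<bar>\<phi> u s / tail ?V s\<bar> < e" for u
        by (simp add: dist_real_def del: abs_divide)
      then have "\<bar>\<phi> u s\<bar> / tail ?V s < e" for u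
        using tail_V_pos[of n s] by simp
      then show "\<forall>u\<in>L. \<bar>\<phi> u s\<bar> \<le> e * tail ?V s"
        using tail_V_pos[of n s] by (auto simp: divide_less_eq intro: less_imp_le)
    qed
  next
    show "((\<lambda>t. tail ?R (s * t) / tail (\<lambda>\<omega>. ?V \<omega> * ?R \<omega>) t) \<longlongrightarrow> 0) at_top" if "s > 0" for s
      using one_negl_scaled[OF that, of "Suc (Suc n)" n] unfolding V_Suc[of "Suc n"] by simp
  qed (auto simp: L)
  then have "((\<lambda>t. expectation (\<lambda>\<omega>. if ?R \<omega> > 0 then \<phi> (U (Suc (Suc n)) \<omega>) (t / ?R \<omega>) else 0) /
      ?T t + c powr (- \<alpha>)) \<longlongrightarrow> 0 + c powr (- \<alpha>)) at_top"
    unfolding V_Suc[of "Suc n"] by (intro tendsto_add tendsto_const)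
  moreover have "\<forall>\<^sub>F t in at_top. expectation (\<lambda>\<omega>. if ?R \<omega> > 0 then \<phi> (U (Suc (Suc n)) \<omega>) (t / ?R \<omega>) else 0) /
      ?T t + c powr (- \<alpha>) = ?T (c * t) / ?T t"
    using eventually_ge_at_top[of 0]
  proof eventually_elim
    fix t :: real assume "t \<ge> 0"
    have "expectation (\<lambda>\<omega>. if ?R \<omega> > 0 then \<phi> (U (Suc (Suc n)) \<omega>) (t / ?R \<omega>) else 0)
      = expectation (\<lambda>\<omega>. (if ?R \<omega> > 0 then tail ?V (c * t / ?R \<omega>) else 0)
          - c powr (- \<alpha>) * (if ?R \<omega> > 0 then tail ?V (t / ?R \<omega>) else 0))"
      unfolding \<phi>_def by (intro Bochner_Integration.integral_cong) auto
    also have "\<dots> = ?T (c * t) - c powr (- \<alpha>) * ?T t"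
      using \<open>t \<ge> 0\<close> \<open>c > 0\<close>
      by (subst Bochner_Integration.integral_diff)
        (auto simp: tail_V_Suc[of "Suc n" "Suc (Suc n)"] intro!: integrable_const_bound[where B = 1] integrable_mult_right)
    finally show "expectation (\<lambda>\<omega>. if ?R \<omega> > 0 then \<phi> (U (Suc (Suc n)) \<omega>) (t / ?R \<omega>) else 0) /
      ?T t + c powr (- \<alpha>) = ?T (c * t) / ?T t"
      using tail_V_pos[of "Suc n" t] by (simp add: field_simps)
  qed
  ultimately show ?case by (simp add: Lim_transform_eventually)
qed

text \<open>Compare the products of \<open>n + 1\<close> and \<open>n + 2\<close> factors by attaching to both the same further factor:
  the mixing lemma for \<open>\<phi> u s = P(V > s)\<close> with one factor less lifts the relation by one.\<close>

lemma prefix_negl: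
  "((\<lambda>t. tail (V (Suc n)) t / tail (V (Suc (Suc n))) t) \<longlongrightarrow> 0) at_top"
proof (induction n)
  case 0
  show ?case using one_negl[of 0] by (simp add: V_1)
next
  case (Suc n)
  let ?V = "V (Suc (Suc n))" and ?m = "Suc (Suc (Suc n))"
  define \<phi> where "\<phi> (u :: real^'d^'d) s = tail (V (Suc n)) s" for u s
  have "((\<lambda>t. expectation (\<lambda>\<omega>. if R ?m \<omega> > 0 then \<phi> (U ?m \<omega>) (t / R ?m \<omega>) else 0) /
      tail (\<lambda>\<omega>. ?V \<omega> * R ?m \<omega>) t) \<longlongrightarrow> 0) at_top"
  proof (rule mixing_negligible[OF indep_prefix R_nonneg])
    show "(\<lambda>z. \<phi> (fst z) (snd z)) \<in> borel_measurable borel"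
      unfolding \<phi>_def borel_prod[symmetric] by measurable
    show "\<bar>\<phi> u s\<bar> \<le> 1" for u s by (simp add: \<phi>_def)
    fix e :: real assume "e > 0"
    from tendstoD[OF Suc this]
    show "\<forall>\<^sub>F s in at_top. \<forall>u\<in>L. \<bar>\<phi> u s\<bar> \<le> e * tail ?V s"
    proof eventually_elim
      fix s assume "dist (tail (V (Suc n)) s / tail ?V s) 0 < e"
      then show "\<forall>u\<in>L. \<bar>\<phi> u s\<bar> \<le> e * tail ?V s"
        using tail_V_pos[of "Suc n" s] by (auto simp: \<phi>_def divide_less_eq intro: less_imp_le)
    qed
  next
    show "((\<lambda>t. tail (R ?m) (s * t) / tail (\<lambda>\<omega>. ?V \<omega> * R ?m \<omega>) t) \<longlongrightarrow> 0) at_top" if "s > 0" for s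
      using one_negl_scaled[OF that, of ?m "Suc n"] unfolding V_Suc[of "Suc (Suc n)"] by simp
  qed (auto simp: L)
  then have "((\<lambda>t. expectation (\<lambda>\<omega>. if R ?m \<omega> > 0 then \<phi> (U ?m \<omega>) (t / R ?m \<omega>) else 0) /
      tail (V ?m) t) \<longlongrightarrow> 0) at_top"
    unfolding V_Suc[of "Suc (Suc n)"] .
  then show ?case
  proof (rule Lim_transform_eventually)
    show "\<forall>\<^sub>F t in at_top. expectation (\<lambda>\<omega>. if R ?m \<omega> > 0 then \<phi> (U ?m \<omega>) (t / R ?m \<omega>) else 0) /
      tail (V ?m) t = tail ?V t / tail (V ?m) t"
      using eventually_ge_at_top[of 0]
      by eventually_elim (simp add: \<phi>_def tail_V_Suc[of "Suc n" ?m] cong: if_cong)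
  qed
qed

lemma prefix_negl_scaled:
  assumes "s > 0"
  shows "((\<lambda>t. tail (V (Suc n)) (s * t) / tail (V (Suc (Suc n))) t) \<longlongrightarrow> 0) at_top"
proof -
  have "((\<lambda>t. (tail (V (Suc n)) (s * t) / tail (V (Suc n)) t) * (tail (V (Suc n)) t / tail (V (Suc (Suc n))) t))
      \<longlongrightarrow> s powr (- \<alpha>) * 0) at_top"
    by (intro tendsto_mult tail_V_rv assms prefix_negl)
  then show ?thesis using tail_V_pos[of n] by (simp add: less_imp_neq[THEN not_sym])
qed

text \<open>A compact set that contains the direction of the product of \<open>n\<close> factors.\<close>

fun K :: "nat \<Rightarrow> (real^'d^'d) set" where
  "K 0 = {mat 1}"
| "K (Suc n) = (\<lambda>z. fst z ** snd z) ` (K n \<times> L)"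

lemma compact_K: "compact (K n)"
proof (induction n)
  case (Suc n)
  then show ?case
    using L(1) by (auto intro!: compact_continuous_image compact_Times continuous_on_matrix_mult
      continuous_on_fst continuous_on_snd continuous_on_id)
qed simp

lemma mat_prod_in_K: "mat_prod U n \<omega> \<in> K n"
  using L(2) by (induction n) (auto intro!: image_eqI)

text \<open>Induction on the number of factors. The limit law of the direction of \<open>Suc n\<close> factors is the image
  of the product of the laws for \<open>n\<close> factors and for one factor under multiplication, which is how
  the law of an independent matrix product evolves.\<close>

proposition direction_of_product:
  fixes M' :: "'v measure" and \<Theta> :: "nat \<Rightarrow> 'v \<Rightarrow> real^'d^'d"
  assumes M': "prob_space M'" and \<Theta>: "iid_with_law M' {1..} \<Theta> \<sigma>"
  shows "\<And>f. continuous_on UNIV f \<Longrightarrow> bounded (range f) \<Longrightarrow>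
      ((\<lambda>t. expectation (\<lambda>\<omega>. f (mat_prod U (Suc n) \<omega>) * indicator {t<..} (V (Suc n) \<omega>)) / tail (V (Suc n)) t)
    \<longlongrightarrow> (\<integral>x. f x \<partial>distr M' borel (mat_prod \<Theta> (Suc n)))) at_top"
    and "AE x in distr M' borel (mat_prod \<Theta> (Suc n)). x \<in> K (Suc n)"
proof -
  interpret M': prob_space M' by fact
  have \<Theta>_ind: "M'.indep_vars (\<lambda>_. borel) \<Theta> {1..}"
    and \<Theta>_law: "\<And>i. i \<ge> 1 \<Longrightarrow> distr M' borel (\<Theta> i) = \<sigma>"
    using \<Theta> by (auto simp: iid_with_law_def)
  have \<Theta>m [measurable]: "\<Theta> i \<in> borel_measurable M'" if "i \<ge> 1" for i
    using \<Theta>_ind that by (auto simp: M'.indep_vars_def)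
  have Pm [measurable]: "mat_prod \<Theta> n \<in> borel_measurable M'" for n
    by (intro borel_measurable_mat_prod \<Theta>m)
  note [measurable_cong] = \<sigma>(2)
  define \<tau> where "\<tau> n = distr M' borel (mat_prod \<Theta> n)" for n
  have \<tau>: "prob_space (\<tau> n)" "sets (\<tau> n) = sets borel" for n
    by (auto simp: \<tau>_def intro!: M'.prob_space_distr)
  have inL: "AE \<omega> in M'. \<Theta> i \<omega> \<in> L" if "i \<ge> 1" for i
    using \<sigma>(3) L(1) \<Theta>m[OF that] unfolding \<Theta>_law[OF that, symmetric]
    by (subst (asm) AE_distr_iff) (auto intro!: borel_closed compact_imp_closed)
  have "AE \<omega> in M'. mat_prod \<Theta> n \<omega> \<in> K n" for n
  proof (induction n)
    case (Suc n)
    from Suc inL[of "Suc n", simplified] show ?case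
      by eventually_elim (auto intro!: image_eqI)
  qed simp
  then have \<tau>K: "AE x in \<tau> n. x \<in> K n" for n
    unfolding \<tau>_def using compact_K[of n]
    by (subst AE_distr_iff) (auto intro!: borel_closed compact_imp_closed)
  from this[of "Suc n"] show "AE x in distr M' borel (mat_prod \<Theta> (Suc n)). x \<in> K (Suc n)"
    unfolding \<tau>_def .
  have \<tau>_Suc: "(\<integral>x. f x \<partial>\<tau> (Suc n)) = (\<integral>u. (\<integral>w. f (w ** u) \<partial>\<tau> n) \<partial>\<sigma>)"
    if f: "continuous_on UNIV f" "bounded (range f)" for f :: "real^'d^'d \<Rightarrow> real" and n
  proof -
    obtain B where B: "\<And>x. \<bar>f x\<bar> \<le> B" using f(2) by (auto simp: bounded_iff)
    have [measurable]: "f \<in> borel_measurable borel" by (rule borel_measurable_continuous_onI[OF f(1)])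
    have "(\<integral>x. f x \<partial>\<tau> (Suc n)) = (\<integral>\<omega>. f (mat_prod \<Theta> n \<omega> ** \<Theta> (Suc n) \<omega>) \<partial>M')"
      unfolding \<tau>_def by (subst integral_distr) auto
    also have "\<dots> = (\<integral>\<omega>. (\<integral>\<omega>'. f (mat_prod \<Theta> n \<omega>' ** \<Theta> (Suc n) \<omega>) \<partial>M') \<partial>M')"
      using M'.indep_var_integral_iterated[OF M'.indep_var_mat_prod[OF \<Theta>_ind, of n "Suc n"],
        of "\<lambda>z. f (fst z ** snd z)" B] B by simp
    also have "\<dots> = (\<integral>\<omega>. (\<integral>w. f (w ** \<Theta> (Suc n) \<omega>) \<partial>\<tau> n) \<partial>M')"
      unfolding \<tau>_def by (subst integral_distr) auto
    also have "\<dots> = (\<integral>u. (\<integral>w. f (w ** u) \<partial>\<tau> n) \<partial>distr M' borel (\<Theta> (Suc n)))"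
    proof (subst integral_distr)
      have "continuous_on UNIV (\<lambda>u. \<integral>w. f (w ** u) \<partial>\<tau> n)"
        using \<tau> B by (intro continuous_on_parametric_integral[where B = B] continuous_on_compose2[OF f(1)]
          continuous_on_matrix_mult continuous_on_fst continuous_on_snd continuous_on_id) auto
      then show "(\<lambda>u. \<integral>w. f (w ** u) \<partial>\<tau> n) \<in> borel_measurable borel"
        by (rule borel_measurable_continuous_onI)
    qed auto
    finally show ?thesis by (simp add: \<Theta>_law)
  qed
  have "((\<lambda>t. expectation (\<lambda>\<omega>. f (mat_prod U (Suc n) \<omega>) * indicator {t<..} (V (Suc n) \<omega>)) / tail (V (Suc n)) t)
    \<longlongrightarrow> (\<integral>x. f x \<partial>\<tau> (Suc n))) at_top"
    if "continuous_on UNIV f" "bounded (range f)" for f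
    using that
  proof (induction n arbitrary: f)
    case 0
    have "mat_prod \<Theta> (Suc 0) = \<Theta> 1" by (simp add: fun_eq_iff)
    then have "\<tau> (Suc 0) = \<sigma>" using \<Theta>_law[of 1] by (simp add: \<tau>_def)
    then show ?case using dir[OF 0] by (simp add: V_1)
  next
    case (Suc n)
    let ?m = "Suc (Suc n)"
    note [measurable] = factor_borel[of ?m, simplified]
    have tR: "tail (R ?m) = tail (R 1)" by (rule tail_R) simp
    obtain B where B: "\<And>x. \<bar>f x\<bar> \<le> B" using Suc.prems(2) by (auto simp: bounded_iff)
    have g: "continuous_on UNIV (\<lambda>z :: (real^'d^'d) \<times> (real^'d^'d). f (fst z ** snd z))"
      by (intro continuous_on_compose2[OF Suc.prems(1)] continuous_on_matrix_mult
        continuous_on_fst continuous_on_snd continuous_on_id) auto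
    have "((\<lambda>t. expectation (\<lambda>\<omega>. f (mat_prod U (Suc n) \<omega> ** U ?m \<omega>) * indicator {t<..} (V (Suc n) \<omega> * R ?m \<omega>))
      / tail (\<lambda>\<omega>. V (Suc n) \<omega> * R ?m \<omega>) t) \<longlongrightarrow> (\<integral>u. (\<integral>w. f (w ** u) \<partial>\<tau> (Suc n)) \<partial>\<sigma>)) at_top"
    proof (rule directions_asymptotically_independent[OF indep_prefix V_nonneg R_nonneg
        compact_K mat_prod_in_K L \<tau> \<tau>K \<sigma> Suc.IH _ tail_V_pos])
      fix h :: "real^'d^'d \<Rightarrow> real" assume h: "continuous_on UNIV h" "bounded (range h)"
      have [measurable]: "h \<in> borel_measurable borel" by (rule borel_measurable_continuous_onI[OF h(1)])
      have "expectation (\<lambda>\<omega>. h (U ?m \<omega>) * indicator {t<..} (R ?m \<omega>)) =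
        expectation (\<lambda>\<omega>. h (U 1 \<omega>) * indicator {t<..} (R 1 \<omega>))" for t
      proof -
        have "(\<lambda>z :: (real^'d^'d) \<times> real. h (fst z) * indicator {t<..} (snd z)) \<in> borel_measurable borel"
          unfolding borel_prod[symmetric] by measurable
        from expectation_factor[OF _ this, of ?m] show ?thesis by simp
      qed
      then show "((\<lambda>t. expectation (\<lambda>\<omega>. h (U ?m \<omega>) * indicator {t<..} (R ?m \<omega>)) / tail (R ?m) t)
          \<longlongrightarrow> (\<integral>x. h x \<partial>\<sigma>)) at_top"
        using dir[OF h] tR by simp
    next
      fix t
      show "tail (R ?m) t > 0" using tR tail_R_pos by simp
      show "tail (\<lambda>\<omega>. V (Suc n) \<omega> * R ?m \<omega>) t > 0"
        using tail_V_pos[of "Suc n" t] unfolding V_Suc[of "Suc n"] .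
    next
      fix s :: real assume "s > 0"
      show "((\<lambda>t. tail (V (Suc n)) (s * t) / tail (\<lambda>\<omega>. V (Suc n) \<omega> * R ?m \<omega>) t) \<longlongrightarrow> 0) at_top"
        using prefix_negl_scaled[OF \<open>s > 0\<close>, of n] unfolding V_Suc[of "Suc n"] .
      show "((\<lambda>t. tail (R ?m) (s * t) / tail (\<lambda>\<omega>. V (Suc n) \<omega> * R ?m \<omega>) t) \<longlongrightarrow> 0) at_top"
        using one_negl_scaled[OF \<open>s > 0\<close>, of ?m n] unfolding V_Suc[of "Suc n"] by simp
    qed (use g B in auto)
    then show ?case
      using \<tau>_Suc[OF Suc.prems, of "Suc n"] by (simp add: V_Suc[of "Suc n"])
  qed
  then show "\<And>f. continuous_on UNIV f \<Longrightarrow> bounded (range f) \<Longrightarrow>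
      ((\<lambda>t. expectation (\<lambda>\<omega>. f (mat_prod U (Suc n) \<omega>) * indicator {t<..} (V (Suc n) \<omega>)) / tail (V (Suc n)) t)
    \<longlongrightarrow> (\<integral>x. f x \<partial>distr M' borel (mat_prod \<Theta> (Suc n)))) at_top"
    unfolding \<tau>_def by blast
qed

end

section \<open>Measures given in polar coordinates\<close>

text \<open>The substitution \<open>s = r powr (- \<alpha>)\<close> turns the measure \<open>\<alpha> r powr (-\<alpha>-1) dr\<close> on the half-line into
  Lebesgue measure. So the heavy-tailed radial part is the image of \<^const>\<open>lborel\<close> under this map;
  negative \<open>s\<close> are sent to 0, where the punctured space has no point.\<close>

definition radius :: "real \<Rightarrow> real \<Rightarrow> real" where
  "radius \<alpha> s = max 0 s powr (- 1 / \<alpha>)"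

lemma radius_nonneg [simp]: "0 \<le> radius \<alpha> s"
  by (simp add: radius_def)

lemma radius_borel [measurable]: "radius \<alpha> \<in> borel_measurable borel"
  unfolding radius_def by measurable

lemma radius_mult: "u > 0 \<Longrightarrow> radius \<alpha> (u * s) = u powr (- 1 / \<alpha>) * radius \<alpha> s"
  by (cases "s \<le> 0") (auto simp: radius_def max_def powr_mult mult_less_0_iff not_le)

text \<open>The ray through a point of norm \<open>p\<close> has radial mass \<open>c powr (- \<alpha>) * p powr \<alpha>\<close> beyond \<open>c\<close>, also for
  \<open>p = 0\<close>.\<close>

lemma less_radius_mult_iff:
  assumes "\<alpha> > 0" "c > 0" "p \<ge> 0"
  shows "c < radius \<alpha> s * p \<longleftrightarrow> s \<in> {0<..<c powr (- \<alpha>) * p powr \<alpha>}"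
proof (cases "p = 0 \<or> s \<le> 0")
  case True
  then show ?thesis using assms by (auto simp: radius_def)
next
  case False
  then have p: "p > 0" and s: "s > 0" using assms by auto
  have "c < radius \<alpha> s * p \<longleftrightarrow> c / p < s powr (- 1 / \<alpha>)"
    using p s by (simp add: radius_def field_simps)
  also have "\<dots> \<longleftrightarrow> (s powr (- 1 / \<alpha>)) powr (- \<alpha>) < (c / p) powr (- \<alpha>)"
  proof
    assume "c / p < s powr (- 1 / \<alpha>)"
    then show "(s powr (- 1 / \<alpha>)) powr (- \<alpha>) < (c / p) powr (- \<alpha>)"
      using p s assms by (intro powr_less_mono2_neg) auto
  next
    assume *: "(s powr (- 1 / \<alpha>)) powr (- \<alpha>) < (c / p) powr (- \<alpha>)"
    show "c / p < s powr (- 1 / \<alpha>)"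
    proof (rule ccontr)
      assume "\<not> ?thesis"
      then have "(c / p) powr (- \<alpha>) \<le> (s powr (- 1 / \<alpha>)) powr (- \<alpha>)"
        using p s assms by (intro powr_mono2') auto
      with * show False by simp
    qed
  qed
  also have "(s powr (- 1 / \<alpha>)) powr (- \<alpha>) = s"
    using s assms by (simp add: powr_powr)
  also have "(c / p) powr (- \<alpha>) = c powr (- \<alpha>) * p powr \<alpha>"
    using p assms by (simp add: powr_divide powr_minus_divide)
  finally show ?thesis using s by simp
qed

definition polar_map :: "real \<Rightarrow> 'b::real_vector \<times> real \<Rightarrow> 'b" where
  "polar_map \<alpha> z = radius \<alpha> (snd z) *\<^sub>R fst z"

text \<open>Integration of a function \<open>f\<close> against this measure averages \<open>f (r *\<^sub>R x)\<close> over \<open>x\<close> with law \<open>\<tau>\<close> and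
  \<open>r\<close> with density \<open>\<alpha> r powr (-\<alpha>-1)\<close>.\<close>

definition polar_measure :: "real \<Rightarrow> 'b::euclidean_space measure \<Rightarrow> 'b measure" where
  "polar_measure \<alpha> \<tau> = restrict_space (distr (\<tau> \<Otimes>\<^sub>M lborel) borel (polar_map \<alpha>)) (- {0})"

text \<open>The law \<open>\<tau>\<close> lives on a compact set, so that a function vanishing near the origin has an integrand
  supported where the radius is bounded away from 0, a set of finite mass.\<close>

locale spectral_law = prob_space \<tau> for \<tau> :: "'b::euclidean_space measure" +
  fixes \<alpha> :: real and K :: "'b set"
  assumes sets_\<tau> [measurable_cong]: "sets \<tau> = sets borel" and \<alpha>: "\<alpha> > 0"
    and K: "compact K" and AE_K: "AE x in \<tau>. x \<in> K"
begin

abbreviation "Q \<equiv> \<tau> \<Otimes>\<^sub>M lborel"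

sublocale pair_sigma_finite \<tau> lborel ..

lemma polar_map_borel [measurable]: "polar_map \<alpha> \<in> measurable Q borel"
  unfolding polar_map_def by measurable

lemma AE_Q_fst:
  assumes [measurable]: "{x \<in> space borel. P x} \<in> sets borel" and "AE x in \<tau>. P x"
  shows "AE z in Q. P (fst z)"
proof (rule AE_pair_measure)
  have "(\<lambda>z. fst z) -` {x \<in> space borel. P x} \<inter> space Q \<in> sets Q"
    by (rule measurable_sets[OF _ assms(1)]) measurable
  then show "{z \<in> space Q. P (fst z)} \<in> sets Q" by (simp add: vimage_def Int_def conj_commute)
  show "AE x in \<tau>. AE y in lborel. P (fst (x, y))" using assms(2) by eventually_elim simp
qed

lemma AE_Q_K: "AE z in Q. fst z \<in> K"
  using AE_K compact_imp_closed[OF K] by (intro AE_Q_fst) auto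

lemma radial_integral:
  fixes h p :: "'b \<Rightarrow> real"
  assumes h [measurable]: "h \<in> borel_measurable borel" and hb: "\<And>x. \<bar>h x\<bar> \<le> B"
    and p [measurable]: "p \<in> borel_measurable borel" and p0: "\<And>x. 0 \<le> p x" and pb: "\<And>x. x \<in> K \<Longrightarrow> p x \<le> D"
    and "c > 0"
  shows "integrable Q (\<lambda>z. h (fst z) * indicator {c<..} (radius \<alpha> (snd z) * p (fst z)))"
    and "(\<integral>z. h (fst z) * indicator {c<..} (radius \<alpha> (snd z) * p (fst z)) \<partial>Q)
      = c powr (- \<alpha>) * (\<integral>x. h x * p x powr \<alpha> \<partial>\<tau>)"
proof -
  let ?F = "\<lambda>z. h (fst z) * indicator {c<..} (radius \<alpha> (snd z) * p (fst z))"
  have F: "?F (x, s) = h x * indicator {0<..<c powr (- \<alpha>) * p x powr \<alpha>} s" for x s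
    using less_radius_mult_iff[OF \<alpha> \<open>c > 0\<close> p0] by (simp add: indicator_def)
  let ?A = "UNIV \<times> {0<..<c powr (- \<alpha>) * max 0 D powr \<alpha>}"
  show int: "integrable Q ?F"
  proof (rule integrableI_bounded_set[where A = ?A and B = B])
    show "?A \<in> sets Q" by (intro pair_measureI) (auto simp: sets_\<tau>)
    show "emeasure Q ?A < \<infinity>"
      using emeasure_space_1 sets_eq_imp_space_eq[OF sets_\<tau>]
      by (subst lborel.emeasure_pair_measure_Times) (auto simp: sets_\<tau>)
    show "AE z in Q. z \<in> ?A \<longrightarrow> norm (?F z) \<le> B"
      using hb order_trans[OF abs_ge_zero hb] by (intro AE_I2) (auto simp: indicator_def)
    show "AE z in Q. z \<notin> ?A \<longrightarrow> ?F z = 0"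
      using AE_Q_K
    proof eventually_elim
      fix z :: "'b \<times> real" assume z: "fst z \<in> K"
      obtain x s where [simp]: "z = (x, s)" by (cases z)
      have "c powr (- \<alpha>) * p x powr \<alpha> \<le> c powr (- \<alpha>) * max 0 D powr \<alpha>"
        using pb[of x] z p0[of x] \<alpha> by (intro mult_left_mono powr_mono2) auto
      then show "z \<notin> ?A \<longrightarrow> ?F z = 0" using F[of x s] by (auto simp: indicator_def)
    qed
  qed measurable
  have "(\<integral>z. ?F z \<partial>Q) = (\<integral>x. (\<integral>s. ?F (x, s) \<partial>lborel) \<partial>\<tau>)"
    by (rule integral_fst'[OF int, symmetric])
  also have "\<dots> = (\<integral>x. c powr (- \<alpha>) * (h x * p x powr \<alpha>) \<partial>\<tau>)"
    unfolding F by (intro Bochner_Integration.integral_cong refl) (simp add: p0)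
  finally show "(\<integral>z. ?F z \<partial>Q) = c powr (- \<alpha>) * (\<integral>x. h x * p x powr \<alpha> \<partial>\<tau>)" by simp
qed

lemma integrable_away_from_zero:
  fixes f :: "'b \<Rightarrow> real"
  assumes [measurable]: "f \<in> borel_measurable borel" and fb: "\<And>x. \<bar>f x\<bar> \<le> B"
    and "\<delta> > 0" and f0: "\<And>x. norm x \<le> \<delta> \<Longrightarrow> f x = 0"
  shows "integrable Q (\<lambda>z. f (polar_map \<alpha> z))"
proof -
  obtain D where D: "\<And>x. x \<in> K \<Longrightarrow> norm x \<le> D" using compact_imp_bounded[OF K] by (auto simp: bounded_iff)
  have "integrable Q (\<lambda>z. B * indicator {\<delta><..} (radius \<alpha> (snd z) * norm (fst z)))"
    by (rule radial_integral[where B = "\<bar>B\<bar>" and D = D]) (use \<open>\<delta> > 0\<close> D in auto)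
  then show ?thesis
  proof (rule Bochner_Integration.integrable_bound)
    show "AE z in Q. norm (f (polar_map \<alpha> z)) \<le> norm (B * indicator {\<delta><..} (radius \<alpha> (snd z) * norm (fst z)))"
    proof (rule AE_I2)
      fix z :: "'b \<times> real"
      show "norm (f (polar_map \<alpha> z)) \<le> norm (B * indicator {\<delta><..} (radius \<alpha> (snd z) * norm (fst z)))"
        using fb[of "polar_map \<alpha> z"] f0[of "polar_map \<alpha> z"] by (auto simp: indicator_def polar_map_def)
    qed
  qed measurable
qed

text \<open>Scaling by \<open>t\<close> corresponds under the radial substitution to the dilation of Lebesgue measure by
  \<open>t powr (- \<alpha>)\<close>.\<close>

lemma emeasure_polar_scale:
  assumes "t > 0" and B: "B \<in> sets punctured_borel"
  shows "emeasure (polar_measure \<alpha> \<tau>) ((\<lambda>x. t *\<^sub>R x) ` B) = ennreal (t powr (- \<alpha>)) * emeasure (polar_measure \<alpha> \<tau>) B"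
proof -
  have B0 [measurable]: "B \<in> sets borel" "B \<subseteq> - {0}"
    using B by (auto simp: punctured_borel_def sets_restrict_space)
  have img: "(\<lambda>x. t *\<^sub>R x) ` B = (\<lambda>x. (1 / t) *\<^sub>R x) -` B \<inter> space borel"
  proof (intro set_eqI iffI)
    fix x assume "x \<in> (\<lambda>x. (1 / t) *\<^sub>R x) -` B \<inter> space borel"
    then have "(1 / t) *\<^sub>R x \<in> B" "x = t *\<^sub>R ((1 / t) *\<^sub>R x)" using \<open>t > 0\<close> by auto
    then show "x \<in> (\<lambda>x. t *\<^sub>R x) ` B" by blast
  qed (use \<open>t > 0\<close> in auto)
  have tB [measurable]: "(\<lambda>x. t *\<^sub>R x) ` B \<in> sets borel"
    unfolding img by (rule measurable_sets[OF _ B0(1)]) measurable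
  have tB0: "(\<lambda>x. t *\<^sub>R x) ` B \<subseteq> - {0}" using B0(2) \<open>t > 0\<close> by auto
  have em: "emeasure (polar_measure \<alpha> \<tau>) A = (\<integral>\<^sup>+x. (\<integral>\<^sup>+s. indicator A (radius \<alpha> s *\<^sub>R x) \<partial>lborel) \<partial>\<tau>)"
    if [measurable]: "A \<in> sets borel" and "A \<subseteq> - {0}" for A
  proof -
    have "emeasure (polar_measure \<alpha> \<tau>) A = emeasure (distr Q borel (polar_map \<alpha>)) A"
      unfolding polar_measure_def using that by (subst emeasure_restrict_space) auto
    also have "\<dots> = (\<integral>\<^sup>+z. indicator A (polar_map \<alpha> z) \<partial>Q)"
      by (simp add: nn_integral_indicator[symmetric] nn_integral_distr del: nn_integral_indicator)
    also have "\<dots> = (\<integral>\<^sup>+x. (\<integral>\<^sup>+s. indicator A (radius \<alpha> s *\<^sub>R x) \<partial>lborel) \<partial>\<tau>)"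
      by (subst lborel.nn_integral_fst[symmetric]) (auto simp: polar_map_def)
    finally show ?thesis .
  qed
  have inner: "(\<integral>\<^sup>+s. indicator ((\<lambda>x. t *\<^sub>R x) ` B) (radius \<alpha> s *\<^sub>R x) \<partial>lborel)
    = ennreal (t powr (- \<alpha>)) * (\<integral>\<^sup>+s. indicator B (radius \<alpha> s *\<^sub>R x) \<partial>lborel)" for x
  proof -
    have "(t powr (- \<alpha>)) powr (- 1 / \<alpha>) = t" using \<open>t > 0\<close> \<alpha> by (simp add: powr_powr)
    then have r: "radius \<alpha> (t powr (- \<alpha>) * s) = t * radius \<alpha> s" for s
      using \<open>t > 0\<close> by (simp add: radius_mult)
    have ind: "indicator ((\<lambda>x. t *\<^sub>R x) ` B) ((t * radius \<alpha> s) *\<^sub>R x) = (indicator B (radius \<alpha> s *\<^sub>R x) :: ennreal)" for s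
      unfolding img using \<open>t > 0\<close> by (simp add: indicator_def)
    have "(\<integral>\<^sup>+s. indicator ((\<lambda>x. t *\<^sub>R x) ` B) (radius \<alpha> s *\<^sub>R x) \<partial>lborel)
      = \<bar>t powr (- \<alpha>)\<bar> * (\<integral>\<^sup>+s. indicator ((\<lambda>x. t *\<^sub>R x) ` B) (radius \<alpha> (0 + t powr (- \<alpha>) * s) *\<^sub>R x) \<partial>lborel)"
      using \<open>t > 0\<close> by (intro nn_integral_real_affine) auto
    then show ?thesis by (simp add: r ind)
  qed
  show ?thesis
    unfolding em[OF tB tB0] em[OF B0] inner by (rule nn_integral_cmult) measurable
qed

end

section \<open>From directional to regular variation\<close>

text \<open>A random vector \<open>V \<omega> *\<^sub>R W \<omega>\<close> whose scalar part is regularly varying and whose direction has the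
  conditional limit law \<open>\<tau>\<close>. For a product of matrices \<open>W\<close> is a product of unit matrices, which can
  have any length up to a constant and can vanish, so \<open>V\<close> is in general not the norm of the vector.\<close>

locale polar_limit = prob_space M + spec: spectral_law \<tau> \<alpha> K
  for M :: "'w measure" and \<tau> :: "'b::euclidean_space measure" and \<alpha> K +
  fixes W :: "'w \<Rightarrow> 'b" and V :: "'w \<Rightarrow> real"
  assumes W [measurable]: "W \<in> borel_measurable M" and V [measurable]: "V \<in> borel_measurable M"
    and V0: "\<And>\<omega>. 0 \<le> V \<omega>" and WK: "\<And>\<omega>. W \<omega> \<in> K"
    and pos: "\<And>t. tail V t > 0"
    and rv: "\<And>c. c > 0 \<Longrightarrow> ((\<lambda>t. tail V (c * t) / tail V t) \<longlongrightarrow> c powr (- \<alpha>)) at_top"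
    and dir: "\<And>f. continuous_on UNIV f \<Longrightarrow> bounded (range f) \<Longrightarrow>
      ((\<lambda>t. expectation (\<lambda>\<omega>. f (W \<omega>) * indicator {t<..} (V \<omega>)) / tail V t) \<longlongrightarrow> (\<integral>x. f x \<partial>\<tau>)) at_top"
begin

lemma dir_scaled:
  assumes "continuous_on UNIV f" "bounded (range f)" "c > 0"
  shows "((\<lambda>t. expectation (\<lambda>\<omega>. f (W \<omega>) * indicator {c * t<..} (V \<omega>)) / tail V t)
    \<longlongrightarrow> c powr (- \<alpha>) * (\<integral>x. f x \<partial>\<tau>)) at_top"
proof -
  have "filterlim (\<lambda>t. c * t) at_top at_top"
    using \<open>c > 0\<close> by (intro filterlim_tendsto_pos_mult_at_top[OF tendsto_const _ filterlim_ident])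
  from tendsto_mult[OF rv[OF \<open>c > 0\<close>] filterlim_compose[OF dir[OF assms(1,2)] this]]
  show ?thesis using pos by (simp add: less_imp_neq[THEN not_sym])
qed

text \<open>On directions in \<open>K\<close> the function \<open>f (\<rho> *\<^sub>R w)\<close> vanishes for \<open>\<rho> \<le> a\<close>. Between \<open>a\<close> and a large \<open>T\<close> it
  is uniformly approximated by a step function of \<open>\<rho>\<close> with coefficients depending continuously on
  \<open>w\<close>, and for such functions the claim is the joint convergence \<open>dir_scaled\<close>. Radii beyond \<open>T\<close>
  contribute at most \<open>B * T powr (- \<alpha>)\<close>.\<close>

proposition polar_limit_integral:
  fixes f :: "'b \<Rightarrow> real"
  assumes f: "continuous_on UNIV f" and fb: "\<And>x. \<bar>f x\<bar> \<le> B"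
    and "\<delta> > 0" and f0: "\<And>x. norm x \<le> \<delta> \<Longrightarrow> f x = 0"
  shows "((\<lambda>t. expectation (\<lambda>\<omega>. f ((1 / t) *\<^sub>R (V \<omega> *\<^sub>R W \<omega>))) / tail V t)
    \<longlongrightarrow> (\<integral>z. f (polar_map \<alpha> z) \<partial>spec.Q)) at_top"
proof (rule tendsto_by_approximation)
  fix e :: real assume "e > 0"
  note \<alpha> = spec.\<alpha> and K = spec.K
  have [measurable]: "f \<in> borel_measurable borel" using f by (rule borel_measurable_continuous_onI)
  have B: "0 \<le> B" using fb[of 0] by linarith
  obtain C where C: "C > 0" "\<And>x. x \<in> K \<Longrightarrow> norm x \<le> C"
    using compact_imp_bounded[OF K] unfolding bounded_pos by auto
  define a where "a = \<delta> / C"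
  have a: "a > 0" using \<open>\<delta> > 0\<close> C by (simp add: a_def)
  have fa: "f (r *\<^sub>R w) = 0" if "0 \<le> r" "r \<le> a" "w \<in> K" for r w
  proof (rule f0)
    have "r * norm w \<le> a * C" using that C a by (intro mult_mono) auto
    then show "norm (r *\<^sub>R w) \<le> \<delta>" using that C(1) by (simp add: a_def)
  qed
  \<comment> \<open>The error bound is \<open>e'\<close> times the mass beyond \<open>a\<close> plus \<open>B\<close> times the mass beyond \<open>T\<close>.\<close>
  define e' where "e' = e / 4 * a powr \<alpha>"
  have e': "e' > 0" "e' * a powr (- \<alpha>) = e / 4" using \<open>e > 0\<close> a by (auto simp: e'_def powr_minus field_simps)
  obtain T where T: "T > a" "B * T powr (- \<alpha>) < e / 4"
  proof -
    have "((\<lambda>x. B * x powr (- \<alpha>)) \<longlongrightarrow> B * 0) at_top"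
      by (intro tendsto_mult tendsto_const tendsto_neg_powr) (use \<alpha> in \<open>auto intro: filterlim_ident\<close>)
    then have "\<forall>\<^sub>F x in at_top. B * x powr (- \<alpha>) < e / 4"
      using \<open>e > 0\<close> by (intro order_tendstoD) auto
    then have "\<forall>\<^sub>F x in at_top. a < x \<and> B * x powr (- \<alpha>) < e / 4"
      using eventually_gt_at_top by (rule eventually_elim2) auto
    then show ?thesis using that by (auto simp: eventually_at_top_linorder)
  qed
  have "uniformly_continuous_on ({a..T} \<times> K) (\<lambda>z. f (fst z *\<^sub>R snd z))"
    by (intro compact_uniformly_continuous compact_Times K compact_Icc continuous_on_compose2[OF f]
      continuous_intros) auto
  then obtain d where d: "d > 0" "\<And>z z'. z \<in> {a..T} \<times> K \<Longrightarrow> z' \<in> {a..T} \<times> K \<Longrightarrow> dist z' z < d \<Longrightarrow>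
      dist (f (fst z' *\<^sub>R snd z')) (f (fst z *\<^sub>R snd z)) < e'"
    using e'(1) unfolding uniformly_continuous_on_def by meson
  obtain m :: nat where m: "(T - a) / d < m" using reals_Archimedean2 by blast
  have m0: "m > 0" using m T d(1) by (cases m) (auto simp: divide_less_0_iff)
  define r where "r k = a + real k * ((T - a) / m)" for k
  have step: "(T - a) / m < d" "(T - a) / m > 0" using m T(1) d(1) m0 by (auto simp: field_simps)
  have r_0: "r 0 = a" and r_m: "r m = T" using m0 by (auto simp: r_def)
  have r_Suc: "r (Suc k) = r k + (T - a) / m" for k by (simp add: r_def distrib_right add_divide_distrib)
  have r_mono: "i \<le> j \<Longrightarrow> r i \<le> r j" for i j
    unfolding r_def using step(2) by (intro add_left_mono mult_right_mono) auto
  have r_ge: "r k \<ge> a" for k using r_mono[of 0 k] r_0 by simp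
  then have r_pos: "r k > 0" for k using a by (meson less_le_trans)
  have r_le: "r k \<le> T" if "k \<le> m" for k using r_mono[OF that] r_m by simp
  define I where "I k \<rho> = (indicator {r k<..} \<rho> :: real)" for k \<rho>
  define S where "S \<rho> w = (\<Sum>k<m. f (r k *\<^sub>R w) * (I k \<rho> - I (Suc k) \<rho>))" for \<rho> w
  have approx: "\<bar>f (\<rho> *\<^sub>R w) - S \<rho> w\<bar> \<le> e' * I 0 \<rho> + B * I m \<rho>" if "\<rho> \<ge> 0" "w \<in> K" for \<rho> w
  proof -
    \<comment> \<open>The increments \<open>I k \<rho> - I (Suc k) \<rho>\<close> are the indicators of a partition of \<open>(a, T]\<close>; only the cell
      containing \<open>\<rho>\<close> contributes.\<close>
    have tel: "(\<Sum>k<m. I k \<rho> - I (Suc k) \<rho>) = I 0 \<rho> - I m \<rho>"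
      using sum_lessThan_telescope'[of "\<lambda>k. I k \<rho>" m] by simp
    have I_mono: "I (Suc k) \<rho> \<le> I k \<rho>" for k
      using r_mono[of k "Suc k"] by (auto simp: I_def indicator_def)
    have "\<bar>f (\<rho> *\<^sub>R w) * (I 0 \<rho> - I m \<rho>) - S \<rho> w\<bar>
        = \<bar>\<Sum>k<m. (f (\<rho> *\<^sub>R w) - f (r k *\<^sub>R w)) * (I k \<rho> - I (Suc k) \<rho>)\<bar>"
      unfolding S_def tel[symmetric] sum_distrib_left sum_subtractf[symmetric] by (simp add: left_diff_distrib)
    also have "\<dots> \<le> (\<Sum>k<m. e' * (I k \<rho> - I (Suc k) \<rho>))"
    proof (rule order_trans[OF sum_abs], rule sum_mono)
      fix k assume "k \<in> {..<m}"
      then have k: "k < m" by simp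
      show "\<bar>(f (\<rho> *\<^sub>R w) - f (r k *\<^sub>R w)) * (I k \<rho> - I (Suc k) \<rho>)\<bar> \<le> e' * (I k \<rho> - I (Suc k) \<rho>)"
      proof (cases "r k < \<rho> \<and> \<rho> \<le> r (Suc k)")
        case True
        then have "dist (\<rho>, w) (r k, w) < d" using step(1) r_Suc[of k] by (simp add: dist_Pair_Pair dist_real_def)
        then have "\<bar>f (\<rho> *\<^sub>R w) - f (r k *\<^sub>R w)\<bar> < e'"
          using d(2)[of "(r k, w)" "(\<rho>, w)"] True r_ge[of k] r_le[of "Suc k"] k \<open>w \<in> K\<close>
          by (auto simp: dist_real_def)
        then show ?thesis using True by (simp add: I_def)
      next
        case False
        then have "I k \<rho> - I (Suc k) \<rho> = 0" using r_mono[of k "Suc k"] by (auto simp: I_def indicator_def)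
        then show ?thesis by simp
      qed
    qed
    also have "\<dots> = e' * (I 0 \<rho> - I m \<rho>)" by (simp add: sum_distrib_left[symmetric] tel)
    also have "\<dots> \<le> e' * I 0 \<rho>" using e'(1) by (simp add: I_def)
    finally have 1: "\<bar>f (\<rho> *\<^sub>R w) * (I 0 \<rho> - I m \<rho>) - S \<rho> w\<bar> \<le> e' * I 0 \<rho>" .
    have 2: "\<bar>f (\<rho> *\<^sub>R w) - f (\<rho> *\<^sub>R w) * (I 0 \<rho> - I m \<rho>)\<bar> \<le> B * I m \<rho>"
      using fa[OF \<open>\<rho> \<ge> 0\<close> _ \<open>w \<in> K\<close>] fb[of "\<rho> *\<^sub>R w"] B T(1)
      by (auto simp: I_def indicator_def r_0 r_m)
    show ?thesis using 1 2 by linarith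
  qed
  define Y where "Y t = (\<Sum>k<m. expectation (\<lambda>\<omega>. f (r k *\<^sub>R W \<omega>) * indicator {r k * t<..} (V \<omega>)) / tail V t
    - expectation (\<lambda>\<omega>. f (r k *\<^sub>R W \<omega>) * indicator {r (Suc k) * t<..} (V \<omega>)) / tail V t)" for t
  define y where "y = (\<Sum>k<m. r k powr (- \<alpha>) * (\<integral>w. f (r k *\<^sub>R w) \<partial>\<tau>) - r (Suc k) powr (- \<alpha>) * (\<integral>w. f (r k *\<^sub>R w) \<partial>\<tau>))"
  have fr: "continuous_on UNIV (\<lambda>w. f (r k *\<^sub>R w))" "bounded (range (\<lambda>w. f (r k *\<^sub>R w)))" for k
    using fb by (auto intro!: continuous_on_compose2[OF f] continuous_intros boundedI)
  have "(Y \<longlongrightarrow> y) at_top"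
    unfolding Y_def y_def by (intro tendsto_sum tendsto_diff dir_scaled fr r_pos)
  moreover have "\<forall>\<^sub>F t in at_top. \<bar>expectation (\<lambda>\<omega>. f ((1 / t) *\<^sub>R (V \<omega> *\<^sub>R W \<omega>))) / tail V t - Y t\<bar> \<le> e"
  proof -
    have "((\<lambda>t. e' * (tail V (a * t) / tail V t) + B * (tail V (T * t) / tail V t))
        \<longlongrightarrow> e' * a powr (- \<alpha>) + B * T powr (- \<alpha>)) at_top"
      using a T(1) by (intro tendsto_intros rv) auto
    moreover have "e' * a powr (- \<alpha>) + B * T powr (- \<alpha>) < e" using e'(2) T(2) \<open>e > 0\<close> by linarith
    ultimately have "\<forall>\<^sub>F t in at_top. e' * (tail V (a * t) / tail V t) + B * (tail V (T * t) / tail V t) < e"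
      by (rule order_tendstoD)
    then show ?thesis using eventually_gt_at_top[of 0]
    proof eventually_elim
      fix t :: real
      assume bound: "e' * (tail V (a * t) / tail V t) + B * (tail V (T * t) / tail V t) < e" and "t > 0"
      have I_t: "I k (V \<omega> / t) = indicator {r k * t<..} (V \<omega>)" for k \<omega>
        using \<open>t > 0\<close> by (simp add: I_def indicator_def field_simps)
      have int: "integrable M (\<lambda>\<omega>. f (c *\<^sub>R W \<omega>) * indicator {u<..} (V \<omega>))" for c u
        by (intro integrable_const_bound[where B = B]) (auto simp: fb indicator_def B)
      have "expectation (\<lambda>\<omega>. S (V \<omega> / t) (W \<omega>)) = Y t * tail V t"
        unfolding S_def I_t right_diff_distrib using pos[of t]
        by (simp add: Bochner_Integration.integral_sum Bochner_Integration.integral_diff int Y_def sum_distrib_right left_diff_distrib)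
      moreover have "integrable M (\<lambda>\<omega>. S (V \<omega> / t) (W \<omega>))"
        unfolding S_def I_t right_diff_distrib by (intro Bochner_Integration.integrable_sum Bochner_Integration.integrable_diff int)
      moreover have "integrable M (\<lambda>\<omega>. f ((V \<omega> / t) *\<^sub>R W \<omega>))"
        by (intro integrable_const_bound[where B = B]) (auto simp: fb)
      ultimately have "expectation (\<lambda>\<omega>. f ((V \<omega> / t) *\<^sub>R W \<omega>)) - Y t * tail V t
          = expectation (\<lambda>\<omega>. f ((V \<omega> / t) *\<^sub>R W \<omega>) - S (V \<omega> / t) (W \<omega>))"
        by simp
      also have "\<bar>\<dots>\<bar> \<le> expectation (\<lambda>\<omega>. e' * indicator {a * t<..} (V \<omega>) + B * indicator {T * t<..} (V \<omega>))"
      proof (rule expectation_abs_le)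
        fix \<omega>
        show "\<bar>f ((V \<omega> / t) *\<^sub>R W \<omega>) - S (V \<omega> / t) (W \<omega>)\<bar> \<le> e' * indicator {a * t<..} (V \<omega>) + B * indicator {T * t<..} (V \<omega>)"
          using approx[of "V \<omega> / t" "W \<omega>"] V0[of \<omega>] WK[of \<omega>] \<open>t > 0\<close> unfolding I_t by (simp add: r_0 r_m)
        show "e' * indicator {a * t<..} (V \<omega>) + B * indicator {T * t<..} (V \<omega>) \<le> e' + B"
          using e'(1) B by (auto simp: indicator_def)
      qed (unfold S_def I_t, measurable)
      also have "\<dots> = e' * tail V (a * t) + B * tail V (T * t)"
        by (subst Bochner_Integration.integral_add)
          (auto simp: tail_eq_expectation intro!: integrable_const_bound[where B = 1])
      finally have "\<bar>expectation (\<lambda>\<omega>. f ((V \<omega> / t) *\<^sub>R W \<omega>)) - Y t * tail V t\<bar> / tail V t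
          \<le> (e' * tail V (a * t) + B * tail V (T * t)) / tail V t"
        using pos[of t] by (intro divide_right_mono) auto
      also have "\<dots> \<le> e" using bound by (simp add: add_divide_distrib)
      also have "\<bar>expectation (\<lambda>\<omega>. f ((V \<omega> / t) *\<^sub>R W \<omega>)) - Y t * tail V t\<bar> / tail V t
          = \<bar>(expectation (\<lambda>\<omega>. f ((V \<omega> / t) *\<^sub>R W \<omega>)) - Y t * tail V t) / tail V t\<bar>"
        using pos[of t] by simp
      also have "(expectation (\<lambda>\<omega>. f ((V \<omega> / t) *\<^sub>R W \<omega>)) - Y t * tail V t) / tail V t
          = expectation (\<lambda>\<omega>. f ((1 / t) *\<^sub>R (V \<omega> *\<^sub>R W \<omega>))) / tail V t - Y t"
        using pos[of t] by (simp add: diff_divide_distrib)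
      finally show "\<bar>expectation (\<lambda>\<omega>. f ((1 / t) *\<^sub>R (V \<omega> *\<^sub>R W \<omega>))) / tail V t - Y t\<bar> \<le> e" .
    qed
  qed
  moreover have "\<bar>(\<integral>z. f (polar_map \<alpha> z) \<partial>spec.Q) - y\<bar> \<le> e"
  proof -
    let ?\<rho> = "\<lambda>z :: 'b \<times> real. radius \<alpha> (snd z)"
    have rad: "integrable spec.Q (\<lambda>z. h (fst z) * indicator {c<..} (?\<rho> z))"
        "(\<integral>z. h (fst z) * indicator {c<..} (?\<rho> z) \<partial>spec.Q) = c powr (- \<alpha>) * (\<integral>x. h x \<partial>\<tau>)"
      if "h \<in> borel_measurable borel" "\<And>x. \<bar>h x\<bar> \<le> B'" "c > 0" for h :: "'b \<Rightarrow> real" and c B'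
      using spec.radial_integral[of h B' "\<lambda>_. 1" 1 c] that by auto
    have fm: "(\<lambda>w. f (r k *\<^sub>R w)) \<in> borel_measurable borel" for k by measurable
    have int: "integrable spec.Q (\<lambda>z. f (r k *\<^sub>R fst z) * I j (?\<rho> z))"
      and val: "(\<integral>z. f (r k *\<^sub>R fst z) * I j (?\<rho> z) \<partial>spec.Q) = r j powr (- \<alpha>) * (\<integral>w. f (r k *\<^sub>R w) \<partial>\<tau>)" for k j
      unfolding I_def using rad[OF fm fb r_pos] by auto
    have "(\<integral>z. S (?\<rho> z) (fst z) \<partial>spec.Q) = y"
      unfolding S_def right_diff_distrib
      by (simp add: Bochner_Integration.integral_sum Bochner_Integration.integral_diff int val y_def)
    moreover have intS: "integrable spec.Q (\<lambda>z. S (?\<rho> z) (fst z))"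
      unfolding S_def right_diff_distrib by (intro Bochner_Integration.integrable_sum Bochner_Integration.integrable_diff int)
    moreover have intf: "integrable spec.Q (\<lambda>z. f (polar_map \<alpha> z))"
      by (rule spec.integrable_away_from_zero[OF _ fb \<open>\<delta> > 0\<close> f0]) auto
    ultimately have "\<bar>(\<integral>z. f (polar_map \<alpha> z) \<partial>spec.Q) - y\<bar> = \<bar>\<integral>z. f (polar_map \<alpha> z) - S (?\<rho> z) (fst z) \<partial>spec.Q\<bar>"
      by simp
    also have "\<dots> \<le> (\<integral>z. \<bar>f (polar_map \<alpha> z) - S (?\<rho> z) (fst z)\<bar> \<partial>spec.Q)" by (rule integral_abs_bound)
    also have "\<dots> \<le> (\<integral>z. e' * indicator {a<..} (?\<rho> z) + B * indicator {T<..} (?\<rho> z) \<partial>spec.Q)"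
    proof (rule integral_mono_AE)
      show "integrable spec.Q (\<lambda>z. \<bar>f (polar_map \<alpha> z) - S (?\<rho> z) (fst z)\<bar>)"
        by (intro integrable_abs Bochner_Integration.integrable_diff intf intS)
      show "integrable spec.Q (\<lambda>z. e' * indicator {a<..} (?\<rho> z) + B * indicator {T<..} (?\<rho> z))"
        using rad(1)[of "\<lambda>_. e'" "\<bar>e'\<bar>" a] rad(1)[of "\<lambda>_. B" "\<bar>B\<bar>" T] a T(1)
        by (intro Bochner_Integration.integrable_add) auto
      show "AE z in spec.Q. \<bar>f (polar_map \<alpha> z) - S (?\<rho> z) (fst z)\<bar> \<le> e' * indicator {a<..} (?\<rho> z) + B * indicator {T<..} (?\<rho> z)"
        using spec.AE_Q_K
      proof eventually_elim
        fix z :: "'b \<times> real" assume "fst z \<in> K"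
        from approx[OF _ this, of "?\<rho> z"]
        show "\<bar>f (polar_map \<alpha> z) - S (?\<rho> z) (fst z)\<bar> \<le> e' * indicator {a<..} (?\<rho> z) + B * indicator {T<..} (?\<rho> z)"
          by (simp add: polar_map_def I_def r_0 r_m)
      qed
    qed
    also have "\<dots> = e' * a powr (- \<alpha>) + B * T powr (- \<alpha>)"
      using rad[of "\<lambda>_. e'" "\<bar>e'\<bar>" a] rad[of "\<lambda>_. B" "\<bar>B\<bar>" T] a T(1)
      by (subst Bochner_Integration.integral_add) (auto simp: spec.prob_space)
    also have "\<dots> \<le> e" using e'(2) T(2) \<open>e > 0\<close> by linarith
    finally show ?thesis .
  qed
  ultimately show "\<exists>Y y. (Y \<longlongrightarrow> y) at_top \<and>
      (\<forall>\<^sub>F t in at_top. \<bar>expectation (\<lambda>\<omega>. f ((1 / t) *\<^sub>R (V \<omega> *\<^sub>R W \<omega>))) / tail V t - Y t\<bar> \<le> e) \<and>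
      \<bar>(\<integral>z. f (polar_map \<alpha> z) \<partial>spec.Q) - y\<bar> \<le> e"
    by blast
qed

text \<open>The function \<open>G\<close> that describes direction and exceedance of the norm is discontinuous on the unit
  sphere of \<open>N\<close>. It is replaced by a continuous \<open>f\<close> whose error is dominated by a continuous \<open>d\<close>
  concentrated on the shell \<open>1 - e < N x < 1 + e\<close>; by homogeneity the limit measure of that shell is
  \<open>((1 - e) powr (- \<alpha>) - (1 + e) powr (- \<alpha>)) * I\<close>, which tends to 0 with \<open>e\<close>.\<close>

proposition normalized_limit:
  fixes g N :: "'b \<Rightarrow> real"
  assumes N: "is_norm N" and g: "continuous_on UNIV g" and gb: "\<And>x. \<bar>g x\<bar> \<le> B"
  defines "X \<equiv> \<lambda>\<omega>. V \<omega> *\<^sub>R W \<omega>"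
  shows "((\<lambda>t. expectation (\<lambda>\<omega>. g ((1 / N (X \<omega>)) *\<^sub>R X \<omega>) * indicator {t<..} (N (X \<omega>))) / tail V t)
    \<longlongrightarrow> (\<integral>x. g ((1 / N x) *\<^sub>R x) * N x powr \<alpha> \<partial>\<tau>)) at_top"
proof -
  note [measurable] = is_norm_borel[OF N] borel_measurable_continuous_onI[OF g]
  note Nc = is_norm_continuous[OF N] and N0 = is_norm_nonneg[OF N] and Ns = is_norm_scaleR[OF N]
  have [measurable]: "X \<in> borel_measurable M" unfolding X_def by measurable
  have B: "0 \<le> B" using gb[of 0] by linarith
  obtain C where C: "C > 0" "\<And>x. N x \<le> C * norm x" using is_norm_le_norm[OF N] by blast
  obtain D where D: "\<And>x. x \<in> K \<Longrightarrow> N x \<le> D"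
    using compact_bounded_above[OF spec.K Nc] by blast
  define I where "I = (\<integral>x. N x powr \<alpha> \<partial>\<tau>)"
  define G where "G x = g ((1 / N x) *\<^sub>R x) * indicator {1<..} (N x)" for x
  have [measurable]: "G \<in> borel_measurable borel" unfolding G_def by measurable
  have Z: "N (polar_map \<alpha> z) = radius \<alpha> (snd z) * N (fst z)" for z
    by (simp add: polar_map_def Ns)
  have GZ: "G (polar_map \<alpha> z) = g ((1 / N (fst z)) *\<^sub>R fst z) * indicator {1<..} (radius \<alpha> (snd z) * N (fst z))" for z
  proof (cases "radius \<alpha> (snd z) = 0")
    case False
    then have "radius \<alpha> (snd z) > 0" using radius_nonneg[of \<alpha> "snd z"] by linarith
    then show ?thesis by (simp add: G_def Z) (simp add: polar_map_def)
  qed (simp add: G_def Z)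
  have rad: "integrable spec.Q (\<lambda>z. h (fst z) * indicator {c<..} (radius \<alpha> (snd z) * N (fst z)))"
      "(\<integral>z. h (fst z) * indicator {c<..} (radius \<alpha> (snd z) * N (fst z)) \<partial>spec.Q) = c powr (- \<alpha>) * (\<integral>x. h x * N x powr \<alpha> \<partial>\<tau>)"
    if "h \<in> borel_measurable borel" "\<And>x. \<bar>h x\<bar> \<le> B'" "c > 0" for h :: "'b \<Rightarrow> real" and c B'
    using spec.radial_integral[of h B' N D c] that D N0 by auto
  have hm: "(\<lambda>x. g ((1 / N x) *\<^sub>R x)) \<in> borel_measurable borel" by measurable
  have intG: "integrable spec.Q (\<lambda>z. G (polar_map \<alpha> z))"
    and valG: "(\<integral>z. G (polar_map \<alpha> z) \<partial>spec.Q) = (\<integral>x. g ((1 / N x) *\<^sub>R x) * N x powr \<alpha> \<partial>\<tau>)"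
    using rad[OF hm gb, of 1] unfolding GZ by auto
  have "((\<lambda>t. expectation (\<lambda>\<omega>. G ((1 / t) *\<^sub>R X \<omega>)) / tail V t) \<longlongrightarrow> (\<integral>z. G (polar_map \<alpha> z) \<partial>spec.Q)) at_top"
  proof (rule tendsto_by_approximation)
    fix \<epsilon> :: real assume "\<epsilon> > 0"
    obtain e where e: "0 < e" "e < 1 / 2" "B * (((1 - e) powr (- \<alpha>) - (1 + e) powr (- \<alpha>)) * I) < \<epsilon>"
    proof -
      have "((\<lambda>e. B * (((1 - e) powr (- \<alpha>) - (1 + e) powr (- \<alpha>)) * I))
          \<longlongrightarrow> B * (((1 - 0) powr (- \<alpha>) - (1 + 0) powr (- \<alpha>)) * I)) (at_right 0)"
        by (intro tendsto_intros) auto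
      then have "\<forall>\<^sub>F e in at_right 0. B * (((1 - e) powr (- \<alpha>) - (1 + e) powr (- \<alpha>)) * I) < \<epsilon>"
        using \<open>\<epsilon> > 0\<close> by (intro order_tendstoD) auto
      moreover have "\<forall>\<^sub>F e in at_right (0::real). 0 < e" by (rule eventually_at_right_less)
      moreover have "\<forall>\<^sub>F e in at_right (0::real). e < 1 / 2"
        by (rule eventually_at_right_field[THEN iffD2]) (auto intro!: exI[of _ "1/2"])
      ultimately have "\<forall>\<^sub>F e in at_right 0. 0 < e \<and> e < 1 / 2 \<and>
          B * (((1 - e) powr (- \<alpha>) - (1 + e) powr (- \<alpha>)) * I) < \<epsilon>"
        by eventually_elim simp
      then have "\<exists>e. 0 < e \<and> e < 1 / 2 \<and> B * (((1 - e) powr (- \<alpha>) - (1 + e) powr (- \<alpha>)) * I) < \<epsilon>"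
        by (rule eventually_happens'[OF trivial_limit_at_right_real])
      then show ?thesis using that by blast
    qed
    \<comment> \<open>A continuous function that rises from 0 to 1 while \<open>N x\<close> goes from \<open>u\<close> to \<open>u + e\<close>.\<close>
    define \<phi> where "\<phi> u x = max 0 (min 1 ((N x - u) / e))" for u x
    have \<phi>c: "continuous_on UNIV (\<phi> u)" for u
      unfolding \<phi>_def using e(1) by (intro continuous_intros Nc) auto
    have [measurable]: "\<phi> u \<in> borel_measurable borel" for u
      by (rule borel_measurable_continuous_onI[OF \<phi>c])
    have \<phi>_bnd: "0 \<le> \<phi> u x" "\<phi> u x \<le> 1" for u x by (auto simp: \<phi>_def)
    have \<phi>_0: "\<phi> u x = 0" if "N x \<le> u" for u x
    proof -
      have "(N x - u) / e \<le> 0" using that e(1) by (simp add: divide_le_0_iff)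
      then show ?thesis by (simp add: \<phi>_def)
    qed
    have \<phi>_1: "\<phi> u x = 1" if "N x \<ge> u + e" for u x
      using that e(1) by (auto simp: \<phi>_def max_def min_def field_simps)
    have \<phi>_mono: "\<phi> 1 x \<le> \<phi> (1 - e) x" for x
      unfolding \<phi>_def using e(1) by (intro max.mono min.mono order_refl divide_right_mono) auto
    define \<delta> where "\<delta> = 1 / (2 * C)"
    have "\<delta> > 0" using C(1) by (simp add: \<delta>_def)
    have small: "\<phi> 1 x = 0 \<and> \<phi> (1 - e) x = 0" if "norm x \<le> \<delta>" for x
    proof -
      have "N x \<le> C * \<delta>" using C(2)[of x] mult_left_mono[OF that, of C] C(1) by linarith
      then have "N x \<le> 1 / 2" using C(1) by (simp add: \<delta>_def)
      then show ?thesis using e(2) by (auto intro!: \<phi>_0)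
    qed
    \<comment> \<open>The lower cutoff 1/2 makes the normalization continuous at the origin; it is inactive where
      \<open>\<phi> 1\<close> does not vanish.\<close>
    define f where "f x = g ((1 / max (1 / 2) (N x)) *\<^sub>R x) * \<phi> 1 x" for x
    define d where "d x = \<phi> (1 - e) x - \<phi> 1 x" for x
    have fc: "continuous_on UNIV f"
      unfolding f_def by (intro continuous_intros continuous_on_compose2[OF g] Nc \<phi>c) (auto simp: max_def)
    have dc: "continuous_on UNIV d" unfolding d_def by (intro continuous_intros \<phi>c)
    have [measurable]: "f \<in> borel_measurable borel" "d \<in> borel_measurable borel"
      by (auto intro!: borel_measurable_continuous_onI fc dc)
    have fb: "\<bar>f x\<bar> \<le> B" for x
    proof -
      have "\<bar>g ((1 / max (1 / 2) (N x)) *\<^sub>R x)\<bar> * \<bar>\<phi> 1 x\<bar> \<le> B * 1"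
        using gb \<phi>_bnd[of 1 x] B by (intro mult_mono) auto
      then show ?thesis by (simp add: f_def abs_mult)
    qed
    have db: "\<bar>d x\<bar> \<le> 1" and d0: "0 \<le> d x" for x
      using \<phi>_bnd[of 1 x] \<phi>_bnd[of "1 - e" x] \<phi>_mono[of x] by (auto simp: d_def)
    have close: "\<bar>G x - f x\<bar> \<le> B * d x" for x
    proof (cases "N x > 1")
      case True
      then have "G x - f x = g ((1 / N x) *\<^sub>R x) * (1 - \<phi> 1 x)" by (simp add: G_def f_def right_diff_distrib)
      moreover have "d x = 1 - \<phi> 1 x" using \<phi>_1[of "1 - e" x] True by (simp add: d_def)
      moreover have "\<bar>g ((1 / N x) *\<^sub>R x)\<bar> * (1 - \<phi> 1 x) \<le> B * (1 - \<phi> 1 x)"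
        using gb \<phi>_bnd[of 1 x] by (intro mult_right_mono) auto
      ultimately show ?thesis using \<phi>_bnd[of 1 x] by (simp add: abs_mult)
    next
      case False
      then have "G x = 0" "f x = 0" using \<phi>_0[of x 1] by (auto simp: G_def f_def)
      then show ?thesis using B d0[of x] by simp
    qed
    have limf: "((\<lambda>t. expectation (\<lambda>\<omega>. f ((1 / t) *\<^sub>R X \<omega>)) / tail V t) \<longlongrightarrow> (\<integral>z. f (polar_map \<alpha> z) \<partial>spec.Q)) at_top"
      unfolding X_def by (rule polar_limit_integral[OF fc fb \<open>\<delta> > 0\<close>]) (auto simp: f_def small)
    have limd: "((\<lambda>t. expectation (\<lambda>\<omega>. d ((1 / t) *\<^sub>R X \<omega>)) / tail V t) \<longlongrightarrow> (\<integral>z. d (polar_map \<alpha> z) \<partial>spec.Q)) at_top"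
      unfolding X_def by (rule polar_limit_integral[OF dc db \<open>\<delta> > 0\<close>]) (auto simp: d_def small)
    have intf: "integrable spec.Q (\<lambda>z. f (polar_map \<alpha> z))"
      by (rule spec.integrable_away_from_zero[OF _ fb \<open>\<delta> > 0\<close>]) (auto simp: f_def small)
    have intd: "integrable spec.Q (\<lambda>z. d (polar_map \<alpha> z))"
      by (rule spec.integrable_away_from_zero[OF _ db \<open>\<delta> > 0\<close>]) (auto simp: d_def small)
    have "(\<integral>z. d (polar_map \<alpha> z) \<partial>spec.Q) \<le> (\<integral>z. 1 * indicator {1 - e<..} (radius \<alpha> (snd z) * N (fst z))
        - 1 * indicator {1 + e<..} (radius \<alpha> (snd z) * N (fst z)) \<partial>spec.Q)"
    proof (rule integral_mono[OF intd Bochner_Integration.integrable_diff])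
      fix z
      show "d (polar_map \<alpha> z) \<le> 1 * indicator {1 - e<..} (radius \<alpha> (snd z) * N (fst z))
        - 1 * indicator {1 + e<..} (radius \<alpha> (snd z) * N (fst z))"
        unfolding Z[symmetric] d_def
        using \<phi>_0[of "polar_map \<alpha> z" "1 - e"] \<phi>_1[of 1 "polar_map \<alpha> z"] \<phi>_1[of "1 - e" "polar_map \<alpha> z"]
          \<phi>_bnd[of 1 "polar_map \<alpha> z"] \<phi>_bnd[of "1 - e" "polar_map \<alpha> z"] e(1)
        by (auto simp: indicator_def)
    qed (use rad(1)[of "\<lambda>_. 1" 1] e in auto)
    also have "\<dots> = ((1 - e) powr (- \<alpha>) - (1 + e) powr (- \<alpha>)) * I"
      using rad[of "\<lambda>_. 1" 1 "1 - e"] rad[of "\<lambda>_. 1" 1 "1 + e"] e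
      by (subst Bochner_Integration.integral_diff) (auto simp: I_def left_diff_distrib)
    finally have "(\<integral>z. d (polar_map \<alpha> z) \<partial>spec.Q) \<le> ((1 - e) powr (- \<alpha>) - (1 + e) powr (- \<alpha>)) * I" .
    from le_less_trans[OF mult_left_mono[OF this B] e(3)]
    have Ld: "B * (\<integral>z. d (polar_map \<alpha> z) \<partial>spec.Q) < \<epsilon>" .
    have "\<bar>(\<integral>z. G (polar_map \<alpha> z) \<partial>spec.Q) - (\<integral>z. f (polar_map \<alpha> z) \<partial>spec.Q)\<bar>
      = \<bar>\<integral>z. G (polar_map \<alpha> z) - f (polar_map \<alpha> z) \<partial>spec.Q\<bar>"
      using intG intf by simp
    also have "\<dots> \<le> (\<integral>z. \<bar>G (polar_map \<alpha> z) - f (polar_map \<alpha> z)\<bar> \<partial>spec.Q)" by (rule integral_abs_bound)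
    also have "\<dots> \<le> (\<integral>z. B * d (polar_map \<alpha> z) \<partial>spec.Q)"
      using close by (intro integral_mono integrable_abs Bochner_Integration.integrable_diff intG intf integrable_mult_right intd) auto
    also have "\<dots> \<le> \<epsilon>" using Ld by simp
    finally have lim_close: "\<bar>(\<integral>z. G (polar_map \<alpha> z) \<partial>spec.Q) - (\<integral>z. f (polar_map \<alpha> z) \<partial>spec.Q)\<bar> \<le> \<epsilon>" .
    have "\<forall>\<^sub>F t in at_top. B * (expectation (\<lambda>\<omega>. d ((1 / t) *\<^sub>R X \<omega>)) / tail V t) < \<epsilon>"
      using order_tendstoD(2)[OF tendsto_mult[OF tendsto_const limd] Ld] .
    then have "\<forall>\<^sub>F t in at_top. \<bar>expectation (\<lambda>\<omega>. G ((1 / t) *\<^sub>R X \<omega>)) / tail V t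
        - expectation (\<lambda>\<omega>. f ((1 / t) *\<^sub>R X \<omega>)) / tail V t\<bar> \<le> \<epsilon>"
    proof eventually_elim
      fix t assume t: "B * (expectation (\<lambda>\<omega>. d ((1 / t) *\<^sub>R X \<omega>)) / tail V t) < \<epsilon>"
      have Gb: "\<bar>G x\<bar> \<le> B" for x using gb[of "(1 / N x) *\<^sub>R x"] B by (auto simp: G_def indicator_def)
      have iG: "integrable M (\<lambda>\<omega>. G ((1 / t) *\<^sub>R X \<omega>))"
        by (intro integrable_const_bound[where B = B]) (auto simp: Gb)
      have "integrable M (\<lambda>\<omega>. f ((1 / t) *\<^sub>R X \<omega>))"
        by (intro integrable_const_bound[where B = B]) (auto simp: fb)
      with iG have "\<bar>expectation (\<lambda>\<omega>. G ((1 / t) *\<^sub>R X \<omega>)) - expectation (\<lambda>\<omega>. f ((1 / t) *\<^sub>R X \<omega>))\<bar>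
        = \<bar>expectation (\<lambda>\<omega>. G ((1 / t) *\<^sub>R X \<omega>) - f ((1 / t) *\<^sub>R X \<omega>))\<bar>" by simp
      also have "\<dots> \<le> expectation (\<lambda>\<omega>. B * d ((1 / t) *\<^sub>R X \<omega>))"
      proof (rule expectation_abs_le)
        fix \<omega>
        show "\<bar>G ((1 / t) *\<^sub>R X \<omega>) - f ((1 / t) *\<^sub>R X \<omega>)\<bar> \<le> B * d ((1 / t) *\<^sub>R X \<omega>)" by (rule close)
        show "B * d ((1 / t) *\<^sub>R X \<omega>) \<le> B"
          using B db[of "(1 / t) *\<^sub>R X \<omega>"] by (intro mult_left_le) auto
      qed measurable
      finally have "\<bar>expectation (\<lambda>\<omega>. G ((1 / t) *\<^sub>R X \<omega>)) - expectation (\<lambda>\<omega>. f ((1 / t) *\<^sub>R X \<omega>))\<bar> / tail V t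
        \<le> B * expectation (\<lambda>\<omega>. d ((1 / t) *\<^sub>R X \<omega>)) / tail V t"
        using pos[of t] by (intro divide_right_mono) auto
      with t show "\<bar>expectation (\<lambda>\<omega>. G ((1 / t) *\<^sub>R X \<omega>)) / tail V t
        - expectation (\<lambda>\<omega>. f ((1 / t) *\<^sub>R X \<omega>)) / tail V t\<bar> \<le> \<epsilon>"
        using pos[of t] by (simp add: diff_divide_distrib[symmetric] abs_divide)
    qed
    with limf lim_close show "\<exists>Y y. (Y \<longlongrightarrow> y) at_top \<and>
      (\<forall>\<^sub>F t in at_top. \<bar>expectation (\<lambda>\<omega>. G ((1 / t) *\<^sub>R X \<omega>)) / tail V t - Y t\<bar> \<le> \<epsilon>) \<and>
      \<bar>(\<integral>z. G (polar_map \<alpha> z) \<partial>spec.Q) - y\<bar> \<le> \<epsilon>"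
      by blast
  qed
  then show ?thesis
    unfolding valG
  proof (rule Lim_transform_eventually)
    show "\<forall>\<^sub>F t in at_top. expectation (\<lambda>\<omega>. G ((1 / t) *\<^sub>R X \<omega>)) / tail V t =
      expectation (\<lambda>\<omega>. g ((1 / N (X \<omega>)) *\<^sub>R X \<omega>) * indicator {t<..} (N (X \<omega>))) / tail V t"
      using eventually_gt_at_top[of 0]
      by eventually_elim (simp add: G_def Ns indicator_def)
  qed
qed

corollary norm_tail_limit:
  assumes N: "is_norm N"
  shows "((\<lambda>t. tail (\<lambda>\<omega>. N (V \<omega> *\<^sub>R W \<omega>)) t / tail V t) \<longlongrightarrow> (\<integral>x. N x powr \<alpha> \<partial>\<tau>)) at_top"
  using normalized_limit[OF N, of "\<lambda>_. 1" 1] is_norm_borel[OF N]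
  by (simp add: tail_eq_expectation[of "\<lambda>\<omega>. N (V \<omega> *\<^sub>R W \<omega>)"])

end

text \<open>If the conditioning event is null, both sides are 0 by the conventions for division by zero.\<close>

lemma (in prob_space) expectation_normalized_conditional:
  fixes Y :: "'a \<Rightarrow> real" and Z :: "'a \<Rightarrow> 'b::euclidean_space" and f :: "'b \<Rightarrow> real"
  assumes [measurable]: "Y \<in> borel_measurable M" "Z \<in> borel_measurable M" "f \<in> borel_measurable borel"
  shows "(\<integral>x. f x \<partial>distr (uniform_measure M {\<omega> \<in> space M. Y \<omega> > t}) borel Z)
    = expectation (\<lambda>\<omega>. f (Z \<omega>) * indicator {t<..} (Y \<omega>)) / tail Y t"
proof -
  let ?A = "{\<omega> \<in> space M. Y \<omega> > t}"
  have eq: "uniform_measure M ?A = density M (\<lambda>\<omega>. ennreal (indicator ?A \<omega> / tail Y t))" if "tail Y t \<noteq> 0"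
    unfolding uniform_measure_def
  proof (rule density_cong)
    have "emeasure M ?A = ennreal (tail Y t)" by (simp add: tail_def emeasure_eq_measure)
    moreover have "tail Y t > 0" using that tail_nonneg[of Y t] by linarith
    ultimately show "AE x in M. indicator ?A x / emeasure M ?A = ennreal (indicator ?A x / tail Y t)"
      by (intro AE_I2) (auto simp: indicator_def divide_ennreal[symmetric])
  qed auto
  have *: "(\<integral>x. f x \<partial>distr (uniform_measure M ?A) borel Z) = (\<integral>\<omega>. f (Z \<omega>) \<partial>uniform_measure M ?A)"
    by (rule integral_distr) auto
  show ?thesis
  proof (cases "tail Y t = 0")
    case True
    then have "?A \<in> null_sets M" by (simp add: tail_def emeasure_eq_measure null_sets_def)
    then have "AE x in M. indicator ?A x / emeasure M ?A = (0 :: ennreal)"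
      by (rule AE_not_in[THEN eventually_mono]) simp
    then have "uniform_measure M ?A = density M (\<lambda>_. 0)"
      unfolding uniform_measure_def by (intro density_cong) auto
    then have "(\<integral>\<omega>. f (Z \<omega>) \<partial>uniform_measure M ?A) = 0"
      using integral_density[of "\<lambda>\<omega>. f (Z \<omega>)" M "\<lambda>_. 0"] by (simp add: zero_ennreal_def[symmetric])
    then show ?thesis using True * by simp
  next
    case False
    have "(\<integral>\<omega>. f (Z \<omega>) \<partial>uniform_measure M ?A) = (\<integral>\<omega>. (indicator ?A \<omega> / tail Y t) * f (Z \<omega>) \<partial>M)"
      unfolding eq[OF False] by (subst integral_density) auto
    also have "\<dots> = (\<integral>\<omega>. (f (Z \<omega>) * indicator {t<..} (Y \<omega>)) / tail Y t \<partial>M)"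
      by (intro Bochner_Integration.integral_cong) (auto simp: indicator_def)
    finally show ?thesis using * by simp
  qed
qed

text \<open>The law of the normalized vector under the change of measure by \<open>N x powr \<alpha>\<close>, which accounts for
  the larger chance of long directions to cause an exceedance.\<close>

definition tilted_direction :: "('b::euclidean_space \<Rightarrow> real) \<Rightarrow> real \<Rightarrow> 'b measure \<Rightarrow> 'b measure" where
  "tilted_direction N \<alpha> \<tau> =
    distr (density \<tau> (\<lambda>x. ennreal (N x powr \<alpha> / (\<integral>x. N x powr \<alpha> \<partial>\<tau>)))) borel (\<lambda>x. (1 / N x) *\<^sub>R x)"

context polar_limit
begin

context
  fixes N :: "'b \<Rightarrow> real" and I :: real
  assumes N: "is_norm N" and I_def: "I = (\<integral>x. N x powr \<alpha> \<partial>\<tau>)" and I_pos: "I > 0"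
begin

lemma [measurable]: "N \<in> borel_measurable borel" by (rule is_norm_borel[OF N])

lemma norm_tail_pos: "\<forall>\<^sub>F t in at_top. tail (\<lambda>\<omega>. N (V \<omega> *\<^sub>R W \<omega>)) t > 0"
proof -
  have "\<forall>\<^sub>F t in at_top. tail (\<lambda>\<omega>. N (V \<omega> *\<^sub>R W \<omega>)) t / tail V t > 0"
    using norm_tail_limit[OF N] I_pos unfolding I_def[symmetric] by (rule order_tendstoD)
  then show ?thesis
    using pos by (auto elim!: eventually_mono simp: zero_less_divide_iff not_less[symmetric] dest: less_asym)
qed

lemma integral_tilted_direction:
  assumes [measurable]: "f \<in> borel_measurable borel"
  shows "(\<integral>x. f x \<partial>tilted_direction N \<alpha> \<tau>) = (\<integral>x. N x powr \<alpha> / I * f ((1 / N x) *\<^sub>R x) \<partial>\<tau>)"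
  unfolding tilted_direction_def I_def[symmetric]
  using I_pos by (simp add: integral_distr integral_density)

text \<open>Dividing the limits for the directional functional and for the norm cancels the unknown tail of
  \<open>V\<close>.\<close>

lemma spectral_distribution_tilted:
  "spectral_distribution N M (\<lambda>\<omega>. V \<omega> *\<^sub>R W \<omega>) (tilted_direction N \<alpha> \<tau>)"
proof -
  let ?\<sigma> = "tilted_direction N \<alpha> \<tau>" and ?X = "\<lambda>\<omega>. V \<omega> *\<^sub>R W \<omega>"
  let ?D = "density \<tau> (\<lambda>x. ennreal (N x powr \<alpha> / I))"
  have \<sigma>: "?\<sigma> = distr ?D borel (\<lambda>x. (1 / N x) *\<^sub>R x)" by (simp add: tilted_direction_def I_def)
  have sets: "sets ?\<sigma> = sets borel" by (simp add: \<sigma>)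
  have int: "integrable \<tau> (\<lambda>x. N x powr \<alpha>)"
    using I_pos unfolding I_def by (metis not_integrable_integral_eq order_less_irrefl)
  have "emeasure ?D (space ?D) = (\<integral>\<^sup>+x. ennreal (N x powr \<alpha> / I) \<partial>\<tau>)"
    by (subst emeasure_density) (auto intro!: nn_integral_cong)
  also have "\<dots> = ennreal (\<integral>x. N x powr \<alpha> / I \<partial>\<tau>)"
    using int I_pos by (intro nn_integral_eq_integral) auto
  also have "\<dots> = 1" using I_pos by (simp add: I_def[symmetric])
  finally have "prob_space ?D" by (intro prob_spaceI)
  then have "prob_space ?\<sigma>" unfolding \<sigma> by (rule prob_space.prob_space_distr) measurable
  moreover have "AE x in ?\<sigma>. N x = 1"
    unfolding \<sigma>
  proof (subst AE_distr_iff)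
    show "AE x in ?D. N ((1 / N x) *\<^sub>R x) = 1"
    proof (subst AE_density)
      show "AE x in \<tau>. 0 < ennreal (N x powr \<alpha> / I) \<longrightarrow> N ((1 / N x) *\<^sub>R x) = 1"
      proof (rule AE_I2, rule impI)
        fix x assume "0 < ennreal (N x powr \<alpha> / I)"
        then have "x \<noteq> 0" by (auto simp: is_norm_zero[OF N])
        then show "N ((1 / N x) *\<^sub>R x) = 1" by (rule is_norm_normalize[OF N])
      qed
    qed measurable
  qed measurable
  moreover have "weak_conv_borel
       (\<lambda>t. distr (uniform_measure M {\<omega> \<in> space M. N (?X \<omega>) > t}) borel (\<lambda>\<omega>. (1 / N (?X \<omega>)) *\<^sub>R ?X \<omega>))
       ?\<sigma> at_top"
    unfolding weak_conv_borel_def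
  proof (intro allI impI)
    fix f :: "'b \<Rightarrow> real" assume f: "continuous_on UNIV f" "bounded (range f)"
    obtain B where B: "\<And>x. \<bar>f x\<bar> \<le> B" using f(2) by (auto simp: bounded_iff)
    have [measurable]: "f \<in> borel_measurable borel" by (rule borel_measurable_continuous_onI[OF f(1)])
    have "((\<lambda>t. (expectation (\<lambda>\<omega>. f ((1 / N (?X \<omega>)) *\<^sub>R ?X \<omega>) * indicator {t<..} (N (?X \<omega>))) / tail V t)
        / (tail (\<lambda>\<omega>. N (?X \<omega>)) t / tail V t)) \<longlongrightarrow> (\<integral>x. f ((1 / N x) *\<^sub>R x) * N x powr \<alpha> \<partial>\<tau>) / I) at_top"
      using I_pos unfolding I_def
      by (intro tendsto_divide normalized_limit[OF N f(1) B] norm_tail_limit[OF N]) auto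
    also have "(\<integral>x. f ((1 / N x) *\<^sub>R x) * N x powr \<alpha> \<partial>\<tau>) / I = (\<integral>x. f x \<partial>?\<sigma>)"
      by (simp add: integral_tilted_direction mult.commute)
    finally show "((\<lambda>t. \<integral>x. f x \<partial>distr (uniform_measure M {\<omega> \<in> space M. N (?X \<omega>) > t}) borel
        (\<lambda>\<omega>. (1 / N (?X \<omega>)) *\<^sub>R ?X \<omega>)) \<longlongrightarrow> (\<integral>x. f x \<partial>?\<sigma>)) at_top"
    proof (rule Lim_transform_eventually)
      show "\<forall>\<^sub>F t in at_top. (expectation (\<lambda>\<omega>. f ((1 / N (?X \<omega>)) *\<^sub>R ?X \<omega>) * indicator {t<..} (N (?X \<omega>))) / tail V t)
        / (tail (\<lambda>\<omega>. N (?X \<omega>)) t / tail V t) = (\<integral>x. f x \<partial>distr (uniform_measure M {\<omega> \<in> space M. N (?X \<omega>) > t}) borel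
        (\<lambda>\<omega>. (1 / N (?X \<omega>)) *\<^sub>R ?X \<omega>))"
        using pos by (intro always_eventually allI, subst expectation_normalized_conditional) (auto simp: less_imp_neq[THEN not_sym])
    qed
  qed
  ultimately show ?thesis unfolding spectral_distribution_def using sets by blast
qed

text \<open>The factor \<open>1 / I\<close> changes the normalization from \<open>P(V > t)\<close> to the tail of the norm. A function
  with compact support in the punctured space extends continuously by 0 to the origin, so that
  \<open>polar_limit_integral\<close> applies.\<close>

lemma regularly_varying_polar:
  "regularly_varying N M (\<lambda>\<omega>. V \<omega> *\<^sub>R W \<omega>) \<alpha> (scale_measure (1 / ennreal I) (polar_measure \<alpha> \<tau>))"
proof -
  let ?\<mu> = "scale_measure (1 / ennreal I) (polar_measure \<alpha> \<tau>)" and ?X = "\<lambda>\<omega>. V \<omega> *\<^sub>R W \<omega>"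
  have sets_pm: "sets (polar_measure \<alpha> \<tau>) = sets punctured_borel"
    by (simp add: polar_measure_def punctured_borel_def sets_restrict_space)
  have int_bnd: "integrable spec.Q (\<lambda>z. 1 * indicator {c<..} (radius \<alpha> (snd z) * N (fst z)) :: real)"
      "(\<integral>z. 1 * indicator {c<..} (radius \<alpha> (snd z) * N (fst z)) \<partial>spec.Q) = c powr (- \<alpha>) * I" if "c > 0" for c
  proof -
    obtain D where D: "\<And>x. x \<in> K \<Longrightarrow> N x \<le> D"
      using compact_bounded_above[OF spec.K is_norm_continuous[OF N]] by blast
    show "integrable spec.Q (\<lambda>z. 1 * indicator {c<..} (radius \<alpha> (snd z) * N (fst z)) :: real)"
      "(\<integral>z. 1 * indicator {c<..} (radius \<alpha> (snd z) * N (fst z)) \<partial>spec.Q) = c powr (- \<alpha>) * I"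
      using spec.radial_integral[of "\<lambda>_. 1" 1 N D c] D that is_norm_nonneg[OF N] by (auto simp: I_def)
  qed
  have em: "emeasure (polar_measure \<alpha> \<tau>) {x. N x > c} = ennreal (c powr (- \<alpha>) * I)" if "c > 0" for c
  proof -
    have "emeasure (polar_measure \<alpha> \<tau>) {x. N x > c} = emeasure (distr spec.Q borel (polar_map \<alpha>)) {x. N x > c}"
      unfolding polar_measure_def using that by (subst emeasure_restrict_space) (auto simp: is_norm_zero[OF N])
    also have "\<dots> = (\<integral>\<^sup>+x. indicator {x. N x > c} x \<partial>distr spec.Q borel (polar_map \<alpha>))"
      by (subst nn_integral_indicator) auto
    also have "\<dots> = (\<integral>\<^sup>+z. indicator {x. N x > c} (polar_map \<alpha> z) \<partial>spec.Q)"
      by (rule nn_integral_distr) auto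
    also have "\<dots> = (\<integral>\<^sup>+z. ennreal (1 * indicator {c<..} (radius \<alpha> (snd z) * N (fst z))) \<partial>spec.Q)"
      by (intro nn_integral_cong) (simp add: polar_map_def is_norm_scaleR[OF N] indicator_def)
    also have "\<dots> = ennreal (c powr (- \<alpha>) * I)"
      using int_bnd[OF that] by (subst nn_integral_eq_integral) auto
    finally show ?thesis .
  qed
  have scale: "emeasure ?\<mu> A = 1 / ennreal I * emeasure (polar_measure \<alpha> \<tau>) A" for A by simp
  have fin: "1 / ennreal I < \<infinity>" using inverse_ennreal_times[OF I_pos, of 1] ennreal_less_top[of "1 / I"] by simp
  have "radon_punctured ?\<mu>"
    unfolding radon_punctured_def
  proof (intro conjI allI impI)
    show "sets ?\<mu> = sets punctured_borel" by (simp add: sets_pm)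
    fix C :: "'b set" assume C: "compact C" "C \<subseteq> - {0}"
    show "emeasure ?\<mu> C < \<infinity>"
    proof (cases "C = {}")
      case False
      then obtain x where x: "x \<in> C" "\<And>y. y \<in> C \<Longrightarrow> N x \<le> N y"
        using continuous_attains_inf[OF C(1) _ is_norm_continuous[OF N]] by blast
      then have "N x > 0" using C(2) is_norm_pos_iff[OF N, of x] by auto
      then have "C \<subseteq> {y. N y > N x / 2}" using x(2) by fastforce
      then have "emeasure (polar_measure \<alpha> \<tau>) C \<le> emeasure (polar_measure \<alpha> \<tau>) {y. N y > N x / 2}"
        using \<open>N x > 0\<close> by (intro emeasure_mono)
          (auto simp: sets_pm punctured_borel_def sets_restrict_space is_norm_zero[OF N]
            intro!: image_eqI[of _ _ "{y. N y > N x / 2}"])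
      also have "\<dots> < \<infinity>" using \<open>N x > 0\<close> by (subst em) auto
      finally show ?thesis unfolding scale using fin by (simp add: ennreal_mult_less_top)
    qed simp
  qed
  moreover have "emeasure ?\<mu> (- {0}) \<noteq> 0"
  proof -
    have "emeasure (polar_measure \<alpha> \<tau>) {x. N x > 1} \<le> emeasure (polar_measure \<alpha> \<tau>) (- {0})"
      by (intro emeasure_mono)
        (auto simp: sets_pm punctured_borel_def sets_restrict_space is_norm_zero[OF N])
    then have "emeasure (polar_measure \<alpha> \<tau>) (- {0}) \<noteq> 0" using em[of 1] I_pos by auto
    then show ?thesis unfolding scale by (auto simp: ennreal_divide_eq_0_iff)
  qed
  moreover have "vague_conv_punctured
       (\<lambda>t. scale_measure (1 / ennreal (\<P>(\<omega> in M. N (?X \<omega>) > t)))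
              (restrict_space (distr M borel (\<lambda>\<omega>. (1 / t) *\<^sub>R ?X \<omega>)) (- {0})))
       ?\<mu> at_top"
    unfolding vague_conv_punctured_def
  proof (intro allI impI)
    fix f :: "'b \<Rightarrow> real"
    assume f: "continuous_on (- {0}) f" and f_nn: "\<forall>x. 0 \<le> f x"
      and "\<exists>K. compact K \<and> K \<subseteq> - {0} \<and> (\<forall>x. x \<notin> K \<longrightarrow> f x = 0)"
    then obtain C where C: "compact C" "C \<subseteq> - {0}" "\<And>x. x \<notin> C \<Longrightarrow> f x = 0" by blast
    have "open (- C)" using C(1) by (simp add: compact_imp_closed open_Compl)
    moreover have "0 \<in> - C" using C(2) by auto
    ultimately obtain \<delta>0 where \<delta>0: "\<delta>0 > 0" "ball 0 \<delta>0 \<subseteq> - C" by (auto simp: open_contains_ball)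
    define \<delta> where "\<delta> = \<delta>0 / 2"
    have \<delta>: "\<delta> > 0" "\<And>x. norm x \<le> \<delta> \<Longrightarrow> f x = 0"
      using \<delta>0 by (auto simp: \<delta>_def subset_iff intro!: C(3))
    have "continuous_on (- C) f" using C(3) by (intro continuous_on_eq[OF continuous_on_const[of _ 0]]) auto
    then have "continuous_on (- {0} \<union> - C) f"
      using f \<open>open (- C)\<close> by (intro continuous_on_open_Un) auto
    moreover have "- {0} \<union> - C = UNIV" using C(2) by auto
    ultimately have fc: "continuous_on UNIV f" by simp
    then have [measurable]: "f \<in> borel_measurable borel" by (rule borel_measurable_continuous_onI)
    obtain B0 where B0: "\<And>x. x \<in> C \<Longrightarrow> \<bar>f x\<bar> \<le> B0"
      using compact_imp_bounded[OF compact_continuous_image[OF continuous_on_subset[OF fc] C(1)]]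
      by (auto simp: bounded_iff)
    have fb: "\<bar>f x\<bar> \<le> max B0 0" for x
      using B0[of x] C(3)[of x] by (cases "x \<in> C") auto
    have f00: "f 0 = 0" using \<delta>(2)[of 0] \<delta>(1) by simp
    have restr: "(\<integral>\<^sup>+x. ennreal (f x) \<partial>restrict_space \<nu> (- {0})) = (\<integral>\<^sup>+x. ennreal (f x) \<partial>\<nu>)"
      if "sets \<nu> = sets borel" for \<nu>
    proof -
      have "space \<nu> = UNIV" using sets_eq_imp_space_eq[OF that] by simp
      then have "(\<integral>\<^sup>+x. ennreal (f x) \<partial>restrict_space \<nu> (- {0})) = (\<integral>\<^sup>+x. ennreal (f x) * indicator (- {0}) x \<partial>\<nu>)"
        by (intro nn_integral_restrict_space) (simp add: that)
      also have "\<dots> = (\<integral>\<^sup>+x. ennreal (f x) \<partial>\<nu>)"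
        by (intro nn_integral_cong) (auto simp: indicator_def f00)
      finally show ?thesis .
    qed
    have mr: "(\<lambda>x. ennreal (f x)) \<in> borel_measurable (restrict_space \<nu> (- {0}))" if [measurable_cong]: "sets \<nu> = sets borel" for \<nu>
      by (intro measurable_restrict_space1) measurable
    have lhs: "(\<integral>\<^sup>+x. ennreal (f x) \<partial>scale_measure (1 / ennreal (\<P>(\<omega> in M. N (?X \<omega>) > t)))
              (restrict_space (distr M borel (\<lambda>\<omega>. (1 / t) *\<^sub>R ?X \<omega>)) (- {0})))
      = ennreal ((expectation (\<lambda>\<omega>. f ((1 / t) *\<^sub>R ?X \<omega>)) / tail V t) / (tail (\<lambda>\<omega>. N (?X \<omega>)) t / tail V t))"
      if t: "tail (\<lambda>\<omega>. N (?X \<omega>)) t > 0" for t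
    proof -
      have "(\<integral>\<^sup>+x. ennreal (f x) \<partial>distr M borel (\<lambda>\<omega>. (1 / t) *\<^sub>R ?X \<omega>)) = (\<integral>\<^sup>+\<omega>. ennreal (f ((1 / t) *\<^sub>R ?X \<omega>)) \<partial>M)"
        by (rule nn_integral_distr) auto
      also have "\<dots> = ennreal (expectation (\<lambda>\<omega>. f ((1 / t) *\<^sub>R ?X \<omega>)))"
        using fb f_nn by (intro nn_integral_eq_integral integrable_const_bound[where B = "max B0 0"]) auto
      finally have *: "(\<integral>\<^sup>+x. ennreal (f x) \<partial>scale_measure (1 / ennreal (\<P>(\<omega> in M. N (?X \<omega>) > t)))
              (restrict_space (distr M borel (\<lambda>\<omega>. (1 / t) *\<^sub>R ?X \<omega>)) (- {0})))
          = 1 / ennreal (tail (\<lambda>\<omega>. N (?X \<omega>)) t) * ennreal (expectation (\<lambda>\<omega>. f ((1 / t) *\<^sub>R ?X \<omega>)))"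
        by (subst nn_integral_scale_measure) (auto simp: restr tail_def intro!: mr)
      have "0 \<le> expectation (\<lambda>\<omega>. f ((1 / t) *\<^sub>R ?X \<omega>))" using f_nn by (intro integral_nonneg_AE) auto
      then show ?thesis unfolding * using t pos[of t]
        by (simp add: inverse_ennreal_times)
    qed
    have rhs: "(\<integral>\<^sup>+x. ennreal (f x) \<partial>?\<mu>) = ennreal ((\<integral>z. f (polar_map \<alpha> z) \<partial>spec.Q) / I)"
    proof -
      have "(\<integral>\<^sup>+x. ennreal (f x) \<partial>distr spec.Q borel (polar_map \<alpha>)) = (\<integral>\<^sup>+z. ennreal (f (polar_map \<alpha> z)) \<partial>spec.Q)"
        by (rule nn_integral_distr) auto
      also have "\<dots> = ennreal (\<integral>z. f (polar_map \<alpha> z) \<partial>spec.Q)"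
        using f_nn by (intro nn_integral_eq_integral spec.integrable_away_from_zero[OF _ fb \<delta>]) auto
      finally have *: "(\<integral>\<^sup>+x. ennreal (f x) \<partial>?\<mu>) = 1 / ennreal I * ennreal (\<integral>z. f (polar_map \<alpha> z) \<partial>spec.Q)"
        unfolding polar_measure_def by (subst nn_integral_scale_measure) (auto simp: restr intro!: mr)
      have "0 \<le> (\<integral>z. f (polar_map \<alpha> z) \<partial>spec.Q)" using f_nn by (intro integral_nonneg_AE) auto
      then show ?thesis unfolding * using I_pos
        by (simp only: inverse_ennreal_times)
    qed
    have "((\<lambda>t. ennreal ((expectation (\<lambda>\<omega>. f ((1 / t) *\<^sub>R ?X \<omega>)) / tail V t) / (tail (\<lambda>\<omega>. N (?X \<omega>)) t / tail V t)))
      \<longlongrightarrow> ennreal ((\<integral>z. f (polar_map \<alpha> z) \<partial>spec.Q) / I)) at_top"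
      using I_pos norm_tail_limit[OF N]
      by (intro tendsto_ennrealI tendsto_divide polar_limit_integral[OF fc fb \<delta>]) (auto simp: I_def)
    then show "((\<lambda>t. \<integral>\<^sup>+x. ennreal (f x) \<partial>scale_measure (1 / ennreal (\<P>(\<omega> in M. N (?X \<omega>) > t)))
              (restrict_space (distr M borel (\<lambda>\<omega>. (1 / t) *\<^sub>R ?X \<omega>)) (- {0})))
        \<longlongrightarrow> (\<integral>\<^sup>+x. ennreal (f x) \<partial>?\<mu>)) at_top"
      unfolding rhs
    proof (rule Lim_transform_eventually)
      show "\<forall>\<^sub>F t in at_top. ennreal ((expectation (\<lambda>\<omega>. f ((1 / t) *\<^sub>R ?X \<omega>)) / tail V t) / (tail (\<lambda>\<omega>. N (?X \<omega>)) t / tail V t))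
        = (\<integral>\<^sup>+x. ennreal (f x) \<partial>scale_measure (1 / ennreal (\<P>(\<omega> in M. N (?X \<omega>) > t)))
              (restrict_space (distr M borel (\<lambda>\<omega>. (1 / t) *\<^sub>R ?X \<omega>)) (- {0})))"
        using norm_tail_pos by eventually_elim (rule lhs[symmetric])
    qed
  qed
  moreover have "emeasure ?\<mu> ((\<lambda>x. t *\<^sub>R x) ` B) = ennreal (t powr (- \<alpha>)) * emeasure ?\<mu> B"
    if "t > 0" "B \<in> sets punctured_borel" for t B
    unfolding scale spec.emeasure_polar_scale[OF that] by (simp add: mult.left_commute)
  ultimately show ?thesis
    unfolding regularly_varying_def using spec.\<alpha> by simp
qed

end
end

section \<open>Regular variation of the norm\<close>

text \<open>Some annulus has positive mass because countably many of them exhaust the punctured space; a tent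
  over it is the test function.\<close>

lemma exists_annulus_function:
  fixes \<mu> :: "'a::euclidean_space measure"
  assumes radon: "radon_punctured \<mu>" and nonnull: "emeasure \<mu> (- {0}) \<noteq> 0"
  obtains f :: "'a \<Rightarrow> real" and b a :: real where "continuous_on UNIV f" "\<And>x. 0 \<le> f x" "\<And>x. f x \<le> b"
    "0 < a" "\<And>x. f x \<noteq> 0 \<Longrightarrow> a \<le> norm x \<and> norm x \<le> b"
    "0 < (\<integral>\<^sup>+x. ennreal (f x) \<partial>\<mu>)" "(\<integral>\<^sup>+x. ennreal (f x) \<partial>\<mu>) < \<infinity>"
proof -
  have sets: "sets \<mu> = sets punctured_borel" using radon by (simp add: radon_punctured_def)
  then have space: "space \<mu> = - {0}"
    by (simp add: sets_eq_imp_space_eq[OF sets] punctured_borel_def space_restrict_space)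
  have sets_iff: "A \<in> sets \<mu>" if "A \<in> sets borel" "A \<subseteq> - {0}" for A
    using that unfolding sets punctured_borel_def by (subst sets_restrict_space_iff) auto
  define S where "S k = {x :: 'a. 1 / real (Suc k) < norm x \<and> norm x < real (Suc k)}" for k
  have "x \<in> (\<Union>k. S k)" if "x \<noteq> 0" for x
  proof -
    obtain k where k: "max (norm x) (1 / norm x) < real k" using reals_Archimedean2 by blast
    then have "norm x < real k" "1 < real k * norm x" using that by (auto simp: field_simps)
    moreover have "real k * norm x \<le> real (Suc k) * norm x" by (intro mult_right_mono) auto
    ultimately have "1 / real (Suc k) < norm x" "norm x < real (Suc k)" by (auto simp: divide_less_eq mult.commute)
    then show ?thesis by (auto simp: S_def)
  qed
  then have "(\<Union>k. S k) = - {0}" by (auto simp: S_def)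
  moreover have S_sets: "S k \<in> sets \<mu>" for k
    by (rule sets_iff) (auto simp: S_def)
  ultimately obtain k where k: "emeasure \<mu> (S k) \<noteq> 0"
    using emeasure_UN_eq_0[of \<mu> S] nonnull by auto
  define b where "b = real (Suc k)"
  define f where "f x = max 0 (min (norm x - 1 / b) (b - norm x))" for x :: 'a
  have b: "b > 0" by (simp add: b_def)
  have fc: "continuous_on UNIV f" unfolding f_def by (intro continuous_intros)
  have fb: "0 \<le> f x" "f x \<le> b" for x using b norm_ge_zero[of x] by (auto simp: f_def min_le_iff_disj)
  have supp: "1 / b \<le> norm x \<and> norm x \<le> b" if "f x \<noteq> 0" for x using that by (auto simp: f_def max_def min_def split: if_splits)
  have pos: "f x > 0" if "x \<in> S k" for x using that by (auto simp: f_def S_def b_def)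
  have fm: "f \<in> borel_measurable \<mu>"
  proof -
    have "f \<in> borel_measurable punctured_borel"
      unfolding punctured_borel_def by (intro measurable_restrict_space1 borel_measurable_continuous_onI fc)
    then show ?thesis using measurable_cong_sets[OF sets refl] by blast
  qed
  have "0 < (\<integral>\<^sup>+x. ennreal (f x) \<partial>\<mu>)"
  proof (rule ccontr)
    assume "\<not> ?thesis"
    then have "(\<integral>\<^sup>+x. ennreal (f x) \<partial>\<mu>) = 0" by simp
    then have "emeasure \<mu> {x \<in> space \<mu>. ennreal (f x) \<noteq> 0} = 0"
      using fm by (subst (asm) nn_integral_0_iff) auto
    moreover have "emeasure \<mu> (S k) \<le> emeasure \<mu> {x \<in> space \<mu>. ennreal (f x) \<noteq> 0}"
      using fm sets.sets_into_space[OF S_sets] by (intro emeasure_mono) (auto dest: pos)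
    ultimately show False using k by simp
  qed
  moreover have "(\<integral>\<^sup>+x. ennreal (f x) \<partial>\<mu>) < \<infinity>"
  proof -
    define C where "C = cball (0::'a) b - ball 0 (1 / b)"
    have "compact C" unfolding C_def by (intro compact_diff) auto
    moreover have C0: "C \<subseteq> - {0}" using b by (auto simp: C_def)
    ultimately have fin: "emeasure \<mu> C < \<infinity>" using radon by (simp add: radon_punctured_def)
    have "C \<in> sets \<mu>" using C0 by (intro sets_iff) (auto simp: C_def)
    have "(\<integral>\<^sup>+x. ennreal (f x) \<partial>\<mu>) \<le> (\<integral>\<^sup>+x. ennreal b * indicator C x \<partial>\<mu>)"
      using fb supp by (intro nn_integral_mono) (force simp: C_def indicator_def intro!: ennreal_leI)
    also have "\<dots> = ennreal b * emeasure \<mu> C" using \<open>C \<in> sets \<mu>\<close> by (simp add: nn_integral_cmult_indicator)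
    also have "\<dots> < \<infinity>" using fin by (simp add: ennreal_mult_less_top)
    finally show ?thesis .
  qed
  moreover have "1 / b > 0" using b by simp
  ultimately show ?thesis using that[OF fc fb, of "1 / b"] supp by blast
qed

lemma nn_integral_homogeneous:
  fixes \<mu> :: "'a::euclidean_space measure" and f :: "'a \<Rightarrow> ennreal"
  assumes sets: "sets \<mu> = sets punctured_borel" and "s > 0"
    and hom: "\<And>B. B \<in> sets punctured_borel \<Longrightarrow> emeasure \<mu> ((\<lambda>x. s *\<^sub>R x) ` B) = c * emeasure \<mu> B"
    and f: "f \<in> borel_measurable borel"
  shows "(\<integral>\<^sup>+x. f ((1 / s) *\<^sub>R x) \<partial>\<mu>) = c * (\<integral>\<^sup>+x. f x \<partial>\<mu>)"
proof -
  have space: "space \<mu> = - {0}"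
    by (simp add: sets_eq_imp_space_eq[OF sets] punctured_borel_def space_restrict_space)
  have fm: "f \<in> borel_measurable \<mu>"
  proof -
    have "f \<in> borel_measurable punctured_borel"
      unfolding punctured_borel_def by (intro measurable_restrict_space1 f)
    then show ?thesis using measurable_cong_sets[OF sets refl] by blast
  qed
  have "(\<lambda>x. (1 / s) *\<^sub>R x) \<in> measurable punctured_borel (punctured_borel :: 'a measure)"
    unfolding punctured_borel_def using \<open>s > 0\<close> by (intro measurable_restrict_space3) auto
  then have sm: "(\<lambda>x. (1 / s) *\<^sub>R x) \<in> measurable \<mu> \<mu>"
    using measurable_cong_sets[OF sets sets] by blast
  have "distr \<mu> \<mu> (\<lambda>x. (1 / s) *\<^sub>R x) = scale_measure c \<mu>"
  proof (rule measure_eqI)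
    fix B assume "B \<in> sets (distr \<mu> \<mu> (\<lambda>x. (1 / s) *\<^sub>R x))"
    then have B: "B \<in> sets \<mu>" by simp
    have "(\<lambda>x. (1 / s) *\<^sub>R x) -` B \<inter> space \<mu> = (\<lambda>x. s *\<^sub>R x) ` B"
    proof (intro set_eqI iffI)
      fix x assume "x \<in> (\<lambda>x. (1 / s) *\<^sub>R x) -` B \<inter> space \<mu>"
      then have "(1 / s) *\<^sub>R x \<in> B" "x = s *\<^sub>R ((1 / s) *\<^sub>R x)" using \<open>s > 0\<close> by auto
      then show "x \<in> (\<lambda>x. s *\<^sub>R x) ` B" by blast
    next
      fix x assume "x \<in> (\<lambda>x. s *\<^sub>R x) ` B"
      then obtain y where y: "y \<in> B" "x = s *\<^sub>R y" by blast
      moreover have "y \<noteq> 0" using y(1) sets.sets_into_space[OF B] unfolding space by blast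
      ultimately show "x \<in> (\<lambda>x. (1 / s) *\<^sub>R x) -` B \<inter> space \<mu>"
        using \<open>s > 0\<close> by (simp add: space)
    qed
    then have "emeasure (distr \<mu> \<mu> (\<lambda>x. (1 / s) *\<^sub>R x)) B = emeasure \<mu> ((\<lambda>x. s *\<^sub>R x) ` B)"
      using B by (simp add: emeasure_distr[OF sm])
    then show "emeasure (distr \<mu> \<mu> (\<lambda>x. (1 / s) *\<^sub>R x)) B = emeasure (scale_measure c \<mu>) B"
      using hom B sets by simp
  qed simp
  then have "(\<integral>\<^sup>+x. f x \<partial>distr \<mu> \<mu> (\<lambda>x. (1 / s) *\<^sub>R x)) = c * (\<integral>\<^sup>+x. f x \<partial>\<mu>)"
    using fm by (simp add: nn_integral_scale_measure)
  then show ?thesis using fm by (simp add: nn_integral_distr[OF sm])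
qed

context prob_space
begin

context
  fixes N :: "'b::euclidean_space \<Rightarrow> real" and A :: "'a \<Rightarrow> 'b" and \<alpha> :: real and \<mu>
  assumes N: "is_norm N" and rv: "regularly_varying N M A \<alpha> \<mu>"
begin

text \<open>For a test function \<open>f\<close> with finite positive integral \<open>j\<close>, the expectation \<open>e (s * t)\<close> of \<open>f\<close> at
  \<open>A / (s * t)\<close> can be evaluated in two ways: at level \<open>s * t\<close> it is equivalent to \<open>j\<close> times the tail
  at \<open>s * t\<close>; at level \<open>t\<close>, by homogeneity of the limit measure, to \<open>s powr (- \<alpha>) * j\<close> times the tail
  at \<open>t\<close>. The quotient is the claim. In this way vague convergence on the punctured space suffices,
  although it does not by itself control the mass far out. The tail cannot vanish, since then
  the expectations would vanish eventually and the limit \<open>j\<close> would be 0.\<close>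

lemma regularly_varying_norm_tail:
  shows "tail (\<lambda>\<omega>. N (A \<omega>)) t > 0" (is ?pos)
    and "s > 0 \<Longrightarrow> ((\<lambda>t. tail (\<lambda>\<omega>. N (A \<omega>)) (s * t) / tail (\<lambda>\<omega>. N (A \<omega>)) t) \<longlongrightarrow> s powr (- \<alpha>)) at_top"
      (is "_ \<Longrightarrow> ?lim s")
proof -
  let ?T = "tail (\<lambda>\<omega>. N (A \<omega>))"
  have A [measurable]: "A \<in> borel_measurable M" and radon: "radon_punctured \<mu>"
    and nonnull: "emeasure \<mu> (- {0}) \<noteq> 0"
    and vague: "vague_conv_punctured (\<lambda>t. scale_measure (1 / ennreal (\<P>(\<omega> in M. N (A \<omega>) > t)))
              (restrict_space (distr M borel (\<lambda>\<omega>. (1 / t) *\<^sub>R A \<omega>)) (- {0}))) \<mu> at_top"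
    and hom: "\<And>t B. t > 0 \<Longrightarrow> B \<in> sets punctured_borel \<Longrightarrow>
        emeasure \<mu> ((\<lambda>x. t *\<^sub>R x) ` B) = ennreal (t powr (- \<alpha>)) * emeasure \<mu> B"
    using rv by (auto simp: regularly_varying_def)
  note [measurable] = is_norm_borel[OF N]
  have sets: "sets \<mu> = sets punctured_borel" using radon by (simp add: radon_punctured_def)
  obtain f a b where fc: "continuous_on UNIV f" and f_nn: "\<And>x. 0 \<le> f x" and fb: "\<And>x. f x \<le> b"
    and a: "0 < a" and supp: "\<And>x. f x \<noteq> 0 \<Longrightarrow> a \<le> norm x \<and> norm x \<le> b"
    and J: "0 < (\<integral>\<^sup>+x. ennreal (f x) \<partial>\<mu>)" "(\<integral>\<^sup>+x. ennreal (f x) \<partial>\<mu>) < \<infinity>"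
    using exists_annulus_function[OF radon nonnull] by blast
  have [measurable]: "f \<in> borel_measurable borel" using fc by (rule borel_measurable_continuous_onI)
  define j where "j = enn2real (\<integral>\<^sup>+x. ennreal (f x) \<partial>\<mu>)"
  have j: "j > 0" "(\<integral>\<^sup>+x. ennreal (f x) \<partial>\<mu>) = ennreal j"
    using J by (auto simp: j_def enn2real_positive_iff)
  define e where "e t = expectation (\<lambda>\<omega>. f ((1 / t) *\<^sub>R A \<omega>))" for t
  have e: "e t \<ge> 0" for t unfolding e_def using f_nn by (intro integral_nonneg_AE) auto
  have lim0: "((\<lambda>t. 1 / ennreal (?T t) * ennreal (e (s * t))) \<longlongrightarrow> ennreal (s powr (- \<alpha>) * j)) at_top"
    if "s > 0" for s
  proof -
    let ?f = "\<lambda>x. f ((1 / s) *\<^sub>R x)"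
    have "continuous_on (- {0}) ?f"
      by (intro continuous_on_compose2[OF fc] continuous_intros) auto
    moreover have "compact (cball 0 (s * b) - ball (0::'b) (s * a))" by (intro compact_diff) auto
    moreover have "cball 0 (s * b) - ball (0::'b) (s * a) \<subseteq> - {0}" using a that by auto
    moreover have "?f x = 0" if "x \<notin> cball 0 (s * b) - ball (0::'b) (s * a)" for x
    proof (rule ccontr)
      assume "?f x \<noteq> 0"
      then have "a \<le> norm ((1 / s) *\<^sub>R x) \<and> norm ((1 / s) *\<^sub>R x) \<le> b" by (rule supp)
      then show False using that \<open>s > 0\<close> by (auto simp: field_simps)
    qed
    ultimately have "((\<lambda>t. \<integral>\<^sup>+x. ennreal (?f x) \<partial>scale_measure (1 / ennreal (\<P>(\<omega> in M. N (A \<omega>) > t)))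
              (restrict_space (distr M borel (\<lambda>\<omega>. (1 / t) *\<^sub>R A \<omega>)) (- {0})))
        \<longlongrightarrow> (\<integral>\<^sup>+x. ennreal (?f x) \<partial>\<mu>)) at_top"
      using vague f_nn unfolding vague_conv_punctured_def by blast
    moreover have "(\<integral>\<^sup>+x. ennreal (?f x) \<partial>\<mu>) = ennreal (s powr (- \<alpha>) * j)"
      using nn_integral_homogeneous[OF sets \<open>s > 0\<close> hom[OF \<open>s > 0\<close>], of "\<lambda>x. ennreal (f x)"] j
      by (simp add: ennreal_mult)
    moreover have "(\<integral>\<^sup>+x. ennreal (?f x) \<partial>scale_measure (1 / ennreal (\<P>(\<omega> in M. N (A \<omega>) > t)))
              (restrict_space (distr M borel (\<lambda>\<omega>. (1 / t) *\<^sub>R A \<omega>)) (- {0})))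
        = 1 / ennreal (?T t) * ennreal (e (s * t))" for t
    proof -
      have f0: "f 0 = 0" using supp[of 0] a by auto
      have "(\<integral>\<^sup>+x. ennreal (?f x) \<partial>restrict_space (distr M borel (\<lambda>\<omega>. (1 / t) *\<^sub>R A \<omega>)) (- {0}))
        = (\<integral>\<^sup>+x. ennreal (?f x) * indicator (- {0}) x \<partial>distr M borel (\<lambda>\<omega>. (1 / t) *\<^sub>R A \<omega>))"
        by (rule nn_integral_restrict_space) simp
      also have "\<dots> = (\<integral>\<^sup>+x. ennreal (?f x) \<partial>distr M borel (\<lambda>\<omega>. (1 / t) *\<^sub>R A \<omega>))"
        by (intro nn_integral_cong) (auto simp: indicator_def f0)
      also have "\<dots> = (\<integral>\<^sup>+\<omega>. ennreal (f ((1 / (s * t)) *\<^sub>R A \<omega>)) \<partial>M)"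
        by (subst nn_integral_distr) auto
      also have "\<dots> = ennreal (e (s * t))"
        unfolding e_def using fb f_nn by (intro nn_integral_eq_integral integrable_const_bound[where B = b]) auto
      finally show ?thesis
        by (subst nn_integral_scale_measure) (auto simp: tail_def intro!: measurable_restrict_space1)
    qed
    ultimately show ?thesis by simp
  qed
  have pos: "?T t > 0" for t
  proof (rule ccontr)
    assume "\<not> ?T t > 0"
    then have t: "?T t = 0" using tail_nonneg[of "\<lambda>\<omega>. N (A \<omega>)" t] by linarith
    obtain c where c: "c > 0" "\<And>x. c * norm x \<le> N x" using is_norm_ge_norm[OF N] by blast
    have zero: "?T u = 0" if "u \<ge> t" for u
      using tail_antimono[of "\<lambda>\<omega>. N (A \<omega>)" t u] that t tail_nonneg[of "\<lambda>\<omega>. N (A \<omega>)" u] by simp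
    have "e u = 0" if "u > max 0 (t / (c * a))" for u
    proof -
      have "AE \<omega> in M. N (A \<omega>) \<le> t"
      proof -
        have "{\<omega> \<in> space M. t < N (A \<omega>)} \<in> null_sets M"
          using t by (simp add: tail_def emeasure_eq_measure null_sets_def)
        from AE_not_in[OF this] AE_space show ?thesis by eventually_elim auto
      qed
      then have "AE \<omega> in M. f ((1 / u) *\<^sub>R A \<omega>) = 0"
      proof eventually_elim
        fix \<omega> assume "N (A \<omega>) \<le> t"
        then have "c * norm (A \<omega>) \<le> t" using c(2)[of "A \<omega>"] by linarith
        moreover have "t < c * (a * u)" using that c(1) a by (simp add: field_simps)
        ultimately have "c * norm (A \<omega>) < c * (a * u)" by linarith
        then have "norm (A \<omega>) < a * u" using c(1) by simp
        then show "f ((1 / u) *\<^sub>R A \<omega>) = 0"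
          using supp[of "(1 / u) *\<^sub>R A \<omega>"] that by (auto simp: field_simps)
      qed
      then show ?thesis unfolding e_def by (simp add: integral_eq_zero_AE)
    qed
    then have "\<forall>\<^sub>F u in at_top. 1 / ennreal (?T u) * ennreal (e (1 * u)) = 0"
      using eventually_gt_at_top[of "max 0 (t / (c * a))"] by (auto elim!: eventually_mono)
    from Lim_transform_eventually[OF lim0[OF zero_less_one] this]
    have "((\<lambda>u::real. 0) \<longlongrightarrow> ennreal j) at_top" by simp
    from tendsto_unique[OF _ this tendsto_const] have "ennreal j = 0" by simp
    then show False using j(1) by simp
  qed
  have lim: "((\<lambda>t. e (s * t) / ?T t) \<longlongrightarrow> s powr (- \<alpha>) * j) at_top" if "s > 0" for s
  proof -
    have "((\<lambda>t. ennreal (e (s * t) / ?T t)) \<longlongrightarrow> ennreal (s powr (- \<alpha>) * j)) at_top"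
      using lim0[OF that] by (simp add: inverse_ennreal_times pos e)
    then show ?thesis
      using j(1) e pos by (subst (asm) tendsto_ennreal_iff) (auto intro!: always_eventually divide_nonneg_pos)
  qed
  show ?pos by (rule pos)
  show "?lim s" if "s > 0"
  proof -
    have s_lim: "filterlim (\<lambda>t. s * t) at_top at_top"
      using that by (intro filterlim_tendsto_pos_mult_at_top[OF tendsto_const _ filterlim_ident])
    have L1: "((\<lambda>t. e (s * t) / ?T (s * t)) \<longlongrightarrow> j) at_top"
      using filterlim_compose[OF lim[of 1] s_lim] by simp
    have "((\<lambda>t. (e (s * t) / ?T t) / (e (s * t) / ?T (s * t))) \<longlongrightarrow> (s powr (- \<alpha>) * j) / j) at_top"
      using j(1) by (intro tendsto_divide lim that L1) auto
    moreover have "\<forall>\<^sub>F t in at_top. (e (s * t) / ?T t) / (e (s * t) / ?T (s * t)) = ?T (s * t) / ?T t"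
      using order_tendstoD(1)[OF L1 j(1)]
    proof eventually_elim
      fix t assume "0 < e (s * t) / ?T (s * t)"
      then have "e (s * t) \<noteq> 0" by auto
      then show "(e (s * t) / ?T t) / (e (s * t) / ?T (s * t)) = ?T (s * t) / ?T t"
        by (simp add: divide_simps)
    qed
    ultimately show ?thesis using j(1) by (simp add: Lim_transform_eventually)
  qed
qed

end
end

section \<open>Regular variation of matrix products\<close>

lemma distr_compose_cong:
  assumes "X \<in> borel_measurable M" "Y \<in> borel_measurable M" "distr M borel X = distr M borel Y"
    and "h \<in> borel_measurable borel"
  shows "distr M borel (\<lambda>\<omega>. h (X \<omega>)) = distr M borel (\<lambda>\<omega>. h (Y \<omega>))"
  using distr_distr[OF assms(4,1)] distr_distr[OF assms(4,2)] assms(3) by (simp add: comp_def)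

lemma onorm_orthogonal_matrix:
  fixes Q :: "real^'d^'d"
  assumes "orthogonal_matrix Q"
  shows "onorm (\<lambda>x. Q *v x) = 1"
proof -
  have "orthogonal_transformation ((*v) Q)"
    using assms by (simp add: orthogonal_transformation_matrix)
  then have "norm (Q *v x) = norm x" for x by (rule orthogonal_transformation_norm)
  then have "onorm (\<lambda>x. Q *v x) = onorm (\<lambda>x :: real^'d. x)" by (simp add: onorm_def)
  then show ?thesis by (simp add: onorm_id)
qed

lemma mat_prod_orthogonal:
  assumes "\<And>i. 1 \<le> i \<Longrightarrow> i \<le> n \<Longrightarrow> orthogonal_matrix (X i \<omega>)"
  shows "orthogonal_matrix (mat_prod X n \<omega>)"
  using assms by (induction n) (auto intro: orthogonal_matrix_id orthogonal_matrix_mul)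

text \<open>On unit vectors both the weight and the normalization are trivial.\<close>

lemma tilted_direction_unit:
  assumes "prob_space \<tau>" and [measurable_cong]: "sets \<tau> = sets borel" and N: "is_norm N"
    and unit: "AE x in \<tau>. N x = 1"
  shows "tilted_direction N \<alpha> \<tau> = \<tau>"
proof -
  interpret prob_space \<tau> by fact
  note [measurable] = is_norm_borel[OF N]
  have "(\<integral>x. N x powr \<alpha> \<partial>\<tau>) = (\<integral>x. 1 \<partial>\<tau>)"
    using unit by (intro integral_cong_AE) (auto elim!: eventually_mono)
  then have I: "(\<integral>x. N x powr \<alpha> \<partial>\<tau>) = 1" by (simp add: prob_space)
  have "density \<tau> (\<lambda>x. ennreal (N x powr \<alpha> / 1)) = density \<tau> (\<lambda>_. 1)"
    using unit by (intro density_cong) (auto elim!: eventually_mono)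
  then have "tilted_direction N \<alpha> \<tau> = distr \<tau> borel (\<lambda>x. (1 / N x) *\<^sub>R x)"
    unfolding tilted_direction_def I by (simp add: density_1)
  also have "\<dots> = distr \<tau> borel (\<lambda>x. x)"
    using unit by (intro distr_cong_AE) (auto elim!: eventually_mono)
  also have "\<dots> = \<tau>" by (rule distr_id2) (simp add: assms)
  finally show ?thesis .
qed

theorem corollary4p1:
  fixes N :: "real^'d^'d \<Rightarrow> real"
    and M :: "'w measure" and M' :: "'v measure"
    and A :: "'w \<Rightarrow> real^'d^'d" and As :: "nat \<Rightarrow> 'w \<Rightarrow> real^'d^'d"
    and \<Theta> :: "nat \<Rightarrow> 'v \<Rightarrow> real^'d^'d"
    and \<alpha> :: real and \<mu> \<sigma> :: "(real^'d^'d) measure" and n :: nat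
  assumes "is_norm N"
    and "prob_space M" and "prob_space M'"
    and "regularly_varying N M A \<alpha> \<mu>"
    and "iid_with_law M {1..} As (distr M borel A)"
    and "spectral_distribution N M A \<sigma>"
    and "iid_with_law M' {1..} \<Theta> \<sigma>"
    and "((\<lambda>t. \<P>(\<omega> in M. N (A \<omega>) > t) / \<P>(\<omega> in M. N (As 1 \<omega>) * N (As 2 \<omega>) > t)) \<longlongrightarrow> 0) at_top"
    and "n \<ge> 1"
  shows "((\<lambda>t. \<P>(\<omega> in M. N (mat_prod As n \<omega>) > t) / \<P>(\<omega> in M. (\<Prod>i=1..n. N (As i \<omega>)) > t))
            \<longlongrightarrow> (\<integral>\<omega>. N (mat_prod \<Theta> n \<omega>) powr \<alpha> \<partial>M')) at_top \<and>
         (\<P>(\<omega> in M'. N (mat_prod \<Theta> n \<omega>) > 0) > 0 \<longrightarrow>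
           (\<exists>\<mu>\<^sub>\<Pi>. regularly_varying N M (mat_prod As n) \<alpha> \<mu>\<^sub>\<Pi>) \<and>
           (\<exists>\<sigma>\<^sub>\<Pi>. spectral_distribution N M (mat_prod As n) \<sigma>\<^sub>\<Pi> \<and>
              (\<forall>B\<in>sets borel. measure \<sigma>\<^sub>\<Pi> B =
                 (\<integral>\<omega>. N (mat_prod \<Theta> n \<omega>) powr \<alpha> / (\<integral>\<omega>'. N (mat_prod \<Theta> n \<omega>') powr \<alpha> \<partial>M')
                      * indicator B ((1 / N (mat_prod \<Theta> n \<omega>)) *\<^sub>R mat_prod \<Theta> n \<omega>) \<partial>M')))) \<and>
         (N = (\<lambda>Q. onorm (\<lambda>x. Q *v x)) \<longrightarrow> (AE Q in \<sigma>. orthogonal_matrix Q) \<longrightarrow>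
           spectral_distribution N M (mat_prod As n) (distr M' borel (mat_prod \<Theta> n)))"
proof -
  note N = \<open>is_norm N\<close>
  interpret M: prob_space M by fact
  interpret M': prob_space M' by fact
  note [measurable] = is_norm_borel[OF N]
  have A [measurable]: "A \<in> borel_measurable M" and \<alpha>: "\<alpha> > 0"
    using assms(4) by (auto simp: regularly_varying_def)
  have As_ind: "M.indep_vars (\<lambda>_. borel) As {1..}"
    and As_law: "\<And>i. i \<ge> 1 \<Longrightarrow> distr M borel (As i) = distr M borel A"
    using assms(5) by (auto simp: iid_with_law_def)
  have As_m: "As i \<in> borel_measurable M" if "i \<ge> 1" for i
    using As_ind that by (auto simp: M.indep_vars_def)
  have \<Theta>_m: "\<Theta> i \<in> borel_measurable M'" and \<Theta>_law: "distr M' borel (\<Theta> i) = \<sigma>" if "i \<ge> 1" for i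
    using assms(7) that by (auto simp: iid_with_law_def M'.indep_vars_def)
  have \<sigma>: "prob_space \<sigma>" "sets \<sigma> = sets borel" "AE x in \<sigma>. N x = 1"
    and \<sigma>_weak: "weak_conv_borel
       (\<lambda>t. distr (uniform_measure M {\<omega> \<in> space M. N (A \<omega>) > t}) borel (\<lambda>\<omega>. (1 / N (A \<omega>)) *\<^sub>R A \<omega>)) \<sigma> at_top"
    using assms(6) by (auto simp: spectral_distribution_def)
  define R where "R i \<omega> = N (As i \<omega>)" for i \<omega>
  define U where "U i \<omega> = (1 / R i \<omega>) *\<^sub>R As i \<omega>" for i \<omega>
  have tail_R1: "M.tail (R 1) = M.tail (\<lambda>\<omega>. N (A \<omega>))"
    unfolding R_def using As_m[of 1] distr_compose_cong[OF As_m[of 1] A As_law, of N] by (intro M.tail_cong_distr) auto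
  interpret \<sigma>: prob_space \<sigma> by fact
  interpret P: polar_factors M U R \<alpha> "{x. N x \<le> 1}" \<sigma>
  proof
    have polar_m: "(\<lambda>x. ((1 / N x) *\<^sub>R x, N x)) \<in> borel_measurable borel" by measurable
    then show "M.indep_vars (\<lambda>_. borel) (\<lambda>i \<omega>. (U i \<omega>, R i \<omega>)) {1..}"
      unfolding U_def R_def by (intro M.indep_vars_compose2[OF As_ind])
    show "distr M borel (\<lambda>\<omega>. (U i \<omega>, R i \<omega>)) = distr M borel (\<lambda>\<omega>. (U 1 \<omega>, R 1 \<omega>))" if "i \<ge> 1" for i
      unfolding U_def R_def
      using distr_compose_cong[OF As_m[OF that] As_m[of 1] _ polar_m] As_law[OF that] As_law[of 1] by simp
    show "compact {x. N x \<le> 1}" by (rule is_norm_compact_ball[OF N])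
    show "U i \<omega> \<in> {x. N x \<le> 1}" for i \<omega> using is_norm_normalize_le[OF N] by (simp add: U_def R_def)
    show "AE x in \<sigma>. x \<in> {x. N x \<le> 1}" using \<sigma>(3) by eventually_elim simp
    show "0 < M.tail (R 1) t" for t
      unfolding tail_R1 by (rule M.regularly_varying_norm_tail(1)[OF N assms(4)])
    show "((\<lambda>t. M.tail (R 1) (c * t) / M.tail (R 1) t) \<longlongrightarrow> c powr - \<alpha>) at_top" if "c > 0" for c
      unfolding tail_R1 by (rule M.regularly_varying_norm_tail(2)[OF N assms(4) that])
    show "((\<lambda>t. M.tail (R 1) t / M.tail (\<lambda>\<omega>. R 1 \<omega> * R 2 \<omega>) t) \<longlongrightarrow> 0) at_top"
      using assms(8) unfolding tail_R1 unfolding M.tail_def R_def .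
    fix f :: "real^'d^'d \<Rightarrow> real" assume f: "continuous_on UNIV f" "bounded (range f)"
    have [measurable]: "f \<in> borel_measurable borel" using f(1) by (rule borel_measurable_continuous_onI)
    let ?h = "\<lambda>t x. f ((1 / N x) *\<^sub>R x) * indicator {t<..} (N x)"
    have "M.expectation (\<lambda>\<omega>. f (U 1 \<omega>) * indicator {t<..} (R 1 \<omega>)) = M.expectation (\<lambda>\<omega>. ?h t (A \<omega>))" for t
    proof -
      have "M.expectation (\<lambda>\<omega>. ?h t (As 1 \<omega>)) = (\<integral>x. ?h t x \<partial>distr M borel (As 1))"
        by (rule integral_distr[OF As_m[OF order_refl], symmetric]) measurable
      also have "\<dots> = M.expectation (\<lambda>\<omega>. ?h t (A \<omega>))"
        unfolding As_law[OF order_refl] by (rule integral_distr) measurable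
      finally show ?thesis by (simp add: U_def R_def)
    qed
    moreover have "(\<integral>x. f x \<partial>distr (uniform_measure M {\<omega> \<in> space M. N (A \<omega>) > t}) borel (\<lambda>\<omega>. (1 / N (A \<omega>)) *\<^sub>R A \<omega>))
        = M.expectation (\<lambda>\<omega>. ?h t (A \<omega>)) / M.tail (\<lambda>\<omega>. N (A \<omega>)) t" for t
      by (rule M.expectation_normalized_conditional) measurable
    moreover have "((\<lambda>t. \<integral>x. f x \<partial>distr (uniform_measure M {\<omega> \<in> space M. N (A \<omega>) > t}) borel
        (\<lambda>\<omega>. (1 / N (A \<omega>)) *\<^sub>R A \<omega>)) \<longlongrightarrow> (\<integral>x. f x \<partial>\<sigma>)) at_top"
      using \<sigma>_weak f unfolding weak_conv_borel_def by blast
    ultimately show "((\<lambda>t. M.expectation (\<lambda>\<omega>. f (U 1 \<omega>) * indicator {t<..} (R 1 \<omega>)) / M.tail (R 1) t)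
        \<longlongrightarrow> (\<integral>x. f x \<partial>\<sigma>)) at_top"
      unfolding tail_R1 by presburger
  next
    show "0 \<le> R i \<omega>" for i \<omega> unfolding R_def by (rule is_norm_nonneg[OF N])
    show "sets \<sigma> = sets borel" by (fact \<sigma>(2))
  qed
  obtain m where n: "n = Suc m" using \<open>n \<ge> 1\<close> by (cases n) auto
  have T_m [measurable]: "mat_prod \<Theta> n \<in> borel_measurable M'"
    by (intro borel_measurable_mat_prod \<Theta>_m)
  define \<tau> where "\<tau> = distr M' borel (mat_prod \<Theta> n)"
  have \<tau>: "prob_space \<tau>" "sets \<tau> = sets borel" by (auto simp: \<tau>_def intro: M'.prob_space_distr)
  interpret \<tau>: prob_space \<tau> by fact
  interpret L: polar_limit M \<tau> \<alpha> "P.K n" "mat_prod U n" "P.V n"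
  proof
    show "AE x in \<tau>. x \<in> P.K n"
      unfolding \<tau>_def n by (rule P.direction_of_product(2)[OF assms(3,7)])
    show "0 < M.tail (P.V n) t" for t unfolding n by (rule P.tail_V_pos)
    show "((\<lambda>t. M.tail (P.V n) (c * t) / M.tail (P.V n) t) \<longlongrightarrow> c powr - \<alpha>) at_top" if "c > 0" for c
      unfolding n by (rule P.tail_V_rv[OF that])
    show "((\<lambda>t. M.expectation (\<lambda>\<omega>. f (mat_prod U n \<omega>) * indicator {t<..} (P.V n \<omega>)) / M.tail (P.V n) t)
        \<longlongrightarrow> (\<integral>x. f x \<partial>\<tau>)) at_top" if "continuous_on UNIV f" "bounded (range f)" for f
      unfolding \<tau>_def n by (rule P.direction_of_product(1)[OF assms(3,7) that])
  qed (auto simp: \<tau> \<alpha> P.compact_K P.V_nonneg P.mat_prod_in_K)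
  have As_eq: "As i \<omega> = R i \<omega> *\<^sub>R U i \<omega>" for i \<omega>
    using is_norm_polar[OF N, of "As i \<omega>"] by (simp add: R_def U_def)
  have prod: "mat_prod As n = (\<lambda>\<omega>. P.V n \<omega> *\<^sub>R mat_prod U n \<omega>)"
  proof
    fix \<omega>
    have "mat_prod As n \<omega> = mat_prod (\<lambda>i x. R i x *\<^sub>R U i x) n \<omega>" by (rule mat_prod_cong) (rule As_eq)
    then show "mat_prod As n \<omega> = P.V n \<omega> *\<^sub>R mat_prod U n \<omega>" by (simp add: mat_prod_scaleR P.V_def)
  qed
  have I: "(\<integral>x. N x powr \<alpha> \<partial>\<tau>) = (\<integral>\<omega>. N (mat_prod \<Theta> n \<omega>) powr \<alpha> \<partial>M')"
    unfolding \<tau>_def by (subst integral_distr) auto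
  have I_pos: "(\<integral>x. N x powr \<alpha> \<partial>\<tau>) > 0" if pos: "\<P>(\<omega> in M'. N (mat_prod \<Theta> n \<omega>) > 0) > 0"
  proof -
    obtain D where D: "\<And>x. x \<in> P.K n \<Longrightarrow> N x \<le> D"
      using compact_bounded_above[OF P.compact_K is_norm_continuous[OF N]] by blast
    have "integrable \<tau> (\<lambda>x. N x powr \<alpha>)"
    proof (rule \<tau>.integrable_const_bound[where B = "D powr \<alpha>"])
      show "AE x in \<tau>. norm (N x powr \<alpha>) \<le> D powr \<alpha>"
        using L.spec.AE_K
        by eventually_elim (use D is_norm_nonneg[OF N] \<alpha> in \<open>auto intro!: powr_mono2\<close>)
    qed (simp add: \<tau>)
    then have iff: "(\<integral>x. N x powr \<alpha> \<partial>\<tau>) = 0 \<longleftrightarrow> (AE x in \<tau>. N x powr \<alpha> = 0)"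
      by (intro integral_nonneg_eq_0_iff_AE) auto
    have "(\<integral>x. N x powr \<alpha> \<partial>\<tau>) \<noteq> 0"
    proof
      assume "(\<integral>x. N x powr \<alpha> \<partial>\<tau>) = 0"
      then have "AE x in \<tau>. N x powr \<alpha> = 0" using iff by simp
      then have "AE \<omega> in M'. N (mat_prod \<Theta> n \<omega>) powr \<alpha> = 0"
        unfolding \<tau>_def by (rule AE_distrD[OF T_m])
      then have "AE \<omega> in M'. \<not> 0 < N (mat_prod \<Theta> n \<omega>)" by eventually_elim simp
      then have "M'.prob {\<omega> \<in> space M'. 0 < N (mat_prod \<Theta> n \<omega>)} = 0"
        by (subst M'.prob_eq_0) auto
      then show False using pos by simp
    qed
    moreover have "(\<integral>x. N x powr \<alpha> \<partial>\<tau>) \<ge> 0" by (intro integral_nonneg_AE) auto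
    ultimately show ?thesis by linarith
  qed
  show ?thesis
  proof (intro conjI impI)
    show "((\<lambda>t. \<P>(\<omega> in M. N (mat_prod As n \<omega>) > t) / \<P>(\<omega> in M. (\<Prod>i=1..n. N (As i \<omega>)) > t))
            \<longlongrightarrow> (\<integral>\<omega>. N (mat_prod \<Theta> n \<omega>) powr \<alpha> \<partial>M')) at_top"
      using L.norm_tail_limit[OF N] unfolding I prod M.tail_def P.V_def R_def .
    assume pos: "\<P>(\<omega> in M'. N (mat_prod \<Theta> n \<omega>) > 0) > 0"
    show "\<exists>\<mu>\<^sub>\<Pi>. regularly_varying N M (mat_prod As n) \<alpha> \<mu>\<^sub>\<Pi>"
      unfolding prod using L.regularly_varying_polar[OF N refl I_pos[OF pos]] by blast
    show "\<exists>\<sigma>\<^sub>\<Pi>. spectral_distribution N M (mat_prod As n) \<sigma>\<^sub>\<Pi> \<and>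
              (\<forall>B\<in>sets borel. measure \<sigma>\<^sub>\<Pi> B =
                 (\<integral>\<omega>. N (mat_prod \<Theta> n \<omega>) powr \<alpha> / (\<integral>\<omega>'. N (mat_prod \<Theta> n \<omega>') powr \<alpha> \<partial>M')
                      * indicator B ((1 / N (mat_prod \<Theta> n \<omega>)) *\<^sub>R mat_prod \<Theta> n \<omega>) \<partial>M'))"
    proof (intro exI conjI ballI)
      show "spectral_distribution N M (mat_prod As n) (tilted_direction N \<alpha> \<tau>)"
        unfolding prod by (rule L.spectral_distribution_tilted[OF N refl I_pos[OF pos]])
      fix B :: "(real^'d^'d) set" assume B [measurable]: "B \<in> sets borel"
      have "measure (tilted_direction N \<alpha> \<tau>) B = (\<integral>x. indicator B x \<partial>tilted_direction N \<alpha> \<tau>)"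
        by (simp add: tilted_direction_def)
      also have "\<dots> = (\<integral>x. N x powr \<alpha> / (\<integral>x. N x powr \<alpha> \<partial>\<tau>) * indicator B ((1 / N x) *\<^sub>R x) \<partial>\<tau>)"
        by (rule L.integral_tilted_direction[OF N refl I_pos[OF pos]]) measurable
      also have "\<dots> = (\<integral>\<omega>. N (mat_prod \<Theta> n \<omega>) powr \<alpha> / (\<integral>\<omega>'. N (mat_prod \<Theta> n \<omega>') powr \<alpha> \<partial>M')
                      * indicator B ((1 / N (mat_prod \<Theta> n \<omega>)) *\<^sub>R mat_prod \<Theta> n \<omega>) \<partial>M')"
        unfolding I unfolding \<tau>_def by (subst integral_distr) auto
      finally show "measure (tilted_direction N \<alpha> \<tau>) B = (\<integral>\<omega>. N (mat_prod \<Theta> n \<omega>) powr \<alpha> / (\<integral>\<omega>'. N (mat_prod \<Theta> n \<omega>') powr \<alpha> \<partial>M')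
                      * indicator B ((1 / N (mat_prod \<Theta> n \<omega>)) *\<^sub>R mat_prod \<Theta> n \<omega>) \<partial>M')" .
    qed
  next
    assume N_op: "N = (\<lambda>Q. onorm (\<lambda>x. Q *v x))" and orth: "AE Q in \<sigma>. orthogonal_matrix Q"
    have "AE \<omega> in M'. orthogonal_matrix (\<Theta> i \<omega>)" if "i \<ge> 1" for i
      using orth unfolding \<Theta>_law[OF that, symmetric] by (rule AE_distrD[OF \<Theta>_m[OF that]])
    then have "AE \<omega> in M'. \<forall>i\<in>{1..}. orthogonal_matrix (\<Theta> i \<omega>)"
      by (subst AE_ball_countable) auto
    then have unit': "AE \<omega> in M'. N (mat_prod \<Theta> n \<omega>) = 1"
    proof eventually_elim
      fix \<omega> assume "\<forall>i\<in>{1..}. orthogonal_matrix (\<Theta> i \<omega>)"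
      then have "orthogonal_matrix (mat_prod \<Theta> n \<omega>)" by (intro mat_prod_orthogonal) auto
      then show "N (mat_prod \<Theta> n \<omega>) = 1" unfolding N_op by (rule onorm_orthogonal_matrix)
    qed
    then have unit: "AE x in \<tau>. N x = 1" unfolding \<tau>_def by (subst AE_distr_iff) auto
    have "AE \<omega> in M'. 0 < N (mat_prod \<Theta> n \<omega>)" using unit' by eventually_elim simp
    then have "M'.prob {\<omega> \<in> space M'. 0 < N (mat_prod \<Theta> n \<omega>)} = 1" by (subst M'.prob_Collect_eq_1) auto
    then have "(\<integral>x. N x powr \<alpha> \<partial>\<tau>) > 0" by (intro I_pos) simp
    from L.spectral_distribution_tilted[OF N refl this]
    show "spectral_distribution N M (mat_prod As n) (distr M' borel (mat_prod \<Theta> n))"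
      unfolding prod tilted_direction_unit[OF \<tau> N unit] \<tau>_def[symmetric] .
  qed
qed

end
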